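(* Suppose that: (a) $E\|F(x,\xi)\|^2<\infty$ for all $x\in O$; (b) for a.e. $\omega\in\Omega$ the map $x\mapsto F(x,\xi(\omega))$ is continuously differentiable on $O$, and $E\|d_xF(x,\xi)\|^2<\infty$ for all $x\in O$; (c) there is a square integrable random variable $C$ such that $\|F(x,\xi(\omega))-F(x',\xi(\omega))\|+\|d_xF(x,\xi(\omega))-d_xF(x',\xi(\omega))\|\le C(\omega)\|x-x'\|$ for all $x,x'\in O$ and a.e. $\omega\in\Omega$. Suppose further that $x_0\in S\cap O$ solves $0\in f_0(x_0)+N_S(x_0)$ and that, with $z_0=x_0-f_0(x_0)$, $L=df_0(x_0)$, $K=T_S(x_0)\cap\{z_0-x_0\}^\perp$, the map $L_K:\mathbb{R}^q\to\mathbb{R}^q$, $L_K(h)=L(\Pi_K(h))+h-\Pi_K(h)$, is a homeomorphism from $\mathbb{R}^q$ to $\mathbb{R}^q$. Let $z_n$ be the solutions of the sample average normal map equations $(f_n)_S(z)=0$ near $z_0$ (as fixed in the context), and let $Y_0$ be a normal random vector in $\mathbb{R}^q$ with mean zero and covariance matrix $\Sigma_0$, the covariance matrix of $F(x_0,\xi)$. Then for each $\epsilon>0$, $$\lim_{n\to\infty}\mathrm{Prob}\{\sqrt{n}\,\|d(f_0)_S(z_0)(z_n-z_0)+d(f_n)_S(z_n)(z_0-z_n)\|>\epsilon\}=0.$$ Consequently, $-\sqrt{n}\,d(f_n)_S(z_n)(z_0-z_n)\Rightarrow Y_0$ as $n\to\infty$, where $\Rightarrow$ denotes weak convergence (convergence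 in distribution).
   Context: Setting. $(\Omega,\mathcal{F},P)$ is a probability space; $\xi$ is a random vector on $\Omega$ supported on a closed set $\Xi\subset\mathbb{R}^d$; $O\subset\mathbb{R}^q$ is open; $F:O\times\Xi\to\mathbb{R}^q$ is measurable and $f_0(x)=E[F(x,\xi)]$ is well defined for each $x\in O$; $d_xF$ is the partial derivative in $x$ (a $q\times q$ matrix). $S\subset\mathbb{R}^q$ is a polyhedral convex set. $\xi^1,\xi^2,\dots$ are i.i.d. with the distribution of $\xi$, and $f_n(x)=f_n(x,\omega)=n^{-1}\sum_{i=1}^nF(x,\xi^i(\omega))$. Under (a)-(c), $f_0$ is continuously differentiable on $O$. Convex notions. $N_S(x)=\{v:\langle v,s-x\rangle\le0\ \forall s\in S\}$; $T_S(x)=\{v:\exists t>0,\ x+tv\in S\}$ for $x\in S$; $\Pi_C$ is the Euclidean projection onto a closed convex set $C$. B-derivative. A locally Lipschitz function $g$ is B-differentiable at $x$ if there is a positively homogeneous function $G=dg(x)$ with $g(x+v)=g(x)+G(v)+o(v)$; then $dg(x)(h)$ is the directional derivative of $g$ at $x$ along $h$. $\Pi_S$ is piecewise affine and hence B-differentiable everywhere. Normal maps. For a function $g$ on $O$ with values in $\mathbb{R}^q$, $g_S(z)=g(\Pi_S(z))+z-\Pi_S(z)$ for $z\in\Pi_S^{-1}(O)$. For $g$ differentiable at $\Pi_S(z)$, $dg_S(z)(h)=dg(\Pi_S(z))(d\Pi_S(z)(h))+h-d\Pi_S(z)(h)$. One has $\Pi_S(z_0)=x_0$, $(f_0)_S(z_0)=0$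 and $d(f_0)_S(z_0)=L_K$. SAA solutions. It is a known result that, under the hypotheses of the claim, there are neighborhoods $X_0$ of $x_0$ in $O$ and $Z$ of $z_0$ such that for a.e. $\omega$ there is an integer $N_\omega$ such that for each $n\ge N_\omega$ the equation $(f_n)_S(z)=0$ has a unique solution $z_n$ in $Z$, and $x_n=\Pi_S(z_n)$ is the unique solution in $X_0$ of $0\in f_n(x)+N_S(x)$; moreover $z_n\to z_0$ and $x_n\to x_0$ almost surely, $\sqrt n(z_n-z_0)\Rightarrow (L_K)^{-1}(Y_0)$ and $\sqrt n L_K(z_n-z_0)\Rightarrow Y_0$, with $Y_0$ normal with mean $0$ and covariance matrix $\Sigma_0$. Such neighborhoods are fixed; $z_n$ denotes this solution (for $n<N_\omega$, any measurable choice in $\Pi_S^{-1}(O)$), and $x_n=\Pi_S(z_n)$. *)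

theory Defs
  imports "HOL-Probability.Probability"
begin

text \<open>The normal cone at a point outside \<open>S\<close> is empty, so that
  \<open>0 \<in> f x + N\<^sub>S x\<close> forces \<open>x \<in> S\<close>.\<close>

definition normal_cone :: "'a::real_inner set \<Rightarrow> 'a \<Rightarrow> 'a set" where
  "normal_cone S x = {v. x \<in> S \<and> (\<forall>s\<in>S. v \<bullet> (s - x) \<le> 0)}"

definition tangent_cone :: "'a::real_vector set \<Rightarrow> 'a \<Rightarrow> 'a set" where
  "tangent_cone S x = {v. \<exists>t>0. x + t *\<^sub>R v \<in> S}"

definition solves_inclusion :: "'a::real_inner set \<Rightarrow> ('a \<Rightarrow> 'a) \<Rightarrow> 'a \<Rightarrow> bool" where
  "solves_inclusion S f x \<longleftrightarrow> 0 \<in> {f x + v | v. v \<in> normal_cone S x}"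

definition has_B_derivative ::
    "('a::real_normed_vector \<Rightarrow> 'b::real_normed_vector) \<Rightarrow> ('a \<Rightarrow> 'b) \<Rightarrow> 'a \<Rightarrow> bool" where
  "has_B_derivative g G x \<longleftrightarrow>
     (\<exists>u>0. \<exists>B. B-lipschitz_on (ball x u) g) \<and>
     (\<forall>t v. t > 0 \<longrightarrow> G (t *\<^sub>R v) = t *\<^sub>R G v) \<and>
     ((\<lambda>v. (g (x + v) - g x - G v) /\<^sub>R norm v) \<longlongrightarrow> 0) (at 0)"

lemma has_B_derivative_unique:
  fixes g :: "'a::real_normed_vector \<Rightarrow> 'b::real_normed_vector"
  assumes "has_B_derivative g G x" "has_B_derivative g H x"
  shows "G = H"
proof
  fix v :: 'a
  have hom: "\<And>t w. t > 0 \<Longrightarrow> G (t *\<^sub>R w) = t *\<^sub>R G w"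
            "\<And>t w. t > 0 \<Longrightarrow> H (t *\<^sub>R w) = t *\<^sub>R H w"
    using assms by (auto simp: has_B_derivative_def)
  show "G v = H v"
  proof (cases "v = 0")
    case True
    have "G 0 = (2::real) *\<^sub>R G 0" "H 0 = (2::real) *\<^sub>R H 0"
      using hom(1)[of 2 0] hom(2)[of 2 0] by auto
    then show ?thesis
      using True by (simp add: scaleR_2)
  next
    case False
    let ?r = "\<lambda>K w. (g (x + w) - g x - K w) /\<^sub>R norm w"
    have "((\<lambda>w. ?r H w - ?r G w) \<longlongrightarrow> 0 - 0) (at 0)"
      using assms unfolding has_B_derivative_def by (intro tendsto_diff) auto
    then have lim: "((\<lambda>w. (G w - H w) /\<^sub>R norm w) \<longlongrightarrow> 0) (at 0)"
      by (simp add: algebra_simps)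
    have "filterlim (\<lambda>t::real. t *\<^sub>R v) (at 0) (at_right 0)"
      unfolding filterlim_at
      using False by (auto intro!: tendsto_eq_intros simp: eventually_at_filter)
    then have "((\<lambda>t. (G (t *\<^sub>R v) - H (t *\<^sub>R v)) /\<^sub>R norm (t *\<^sub>R v)) \<longlongrightarrow> 0) (at_right (0::real))"
      by (rule filterlim_compose[OF lim])
    moreover have "\<forall>\<^sub>F t in at_right (0::real).
        (G (t *\<^sub>R v) - H (t *\<^sub>R v)) /\<^sub>R norm (t *\<^sub>R v) = (G v - H v) /\<^sub>R norm v"
      by (auto simp: eventually_at_filter hom scaleR_diff_right[symmetric])
    ultimately have "((\<lambda>t. (G v - H v) /\<^sub>R norm v) \<longlongrightarrow> 0) (at_right (0::real))"
      by (rule Lim_transform_eventually)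
    then have "(G v - H v) /\<^sub>R norm v = 0"
      by (simp add: tendsto_const_iff)
    then show ?thesis
      using False by simp
  qed
qed

definition B_derivative ::
    "('a::real_normed_vector \<Rightarrow> 'b::real_normed_vector) \<Rightarrow> 'a \<Rightarrow> 'a \<Rightarrow> 'b" where
  "B_derivative g x = (THE G. has_B_derivative g G x)"

text \<open>The Euclidean projection onto \<open>S\<close> is \<^const>\<open>closest_point\<close> \<open>S\<close>.
  The normal map is meant on the preimage of the domain of \<open>g\<close> under this projection.\<close>

definition normal_map :: "(real^'q) set \<Rightarrow> (real^'q \<Rightarrow> real^'q) \<Rightarrow> real^'q \<Rightarrow> real^'q" where
  "normal_map S g z = g (closest_point S z) + z - closest_point S z"

text \<open>The B-derivative of the normal map of \<open>S\<close> and \<open>g\<close> at \<open>z\<close> in direction \<open>h\<close>, for \<open>g\<close>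
  differentiable at the projection of \<open>z\<close>.\<close>

definition normal_map_deriv ::
    "(real^'q) set \<Rightarrow> (real^'q \<Rightarrow> real^'q) \<Rightarrow> real^'q \<Rightarrow> real^'q \<Rightarrow> real^'q" where
  "normal_map_deriv S g z h =
     jacobian g (at (closest_point S z)) *v B_derivative (closest_point S) z h
       + h - B_derivative (closest_point S) z h"

text \<open>Matrices carry the library (Frobenius) norm; the integrability and Lipschitz conditions
  in which it is used do not depend on the choice of the matrix norm.\<close>

definition C1_on :: "(real^'n \<Rightarrow> real^'m) \<Rightarrow> (real^'n) set \<Rightarrow> bool" where
  "C1_on g D \<longleftrightarrow> (\<forall>x\<in>D. g differentiable (at x)) \<and> continuous_on D (\<lambda>x. jacobian g (at x))"

definition covariance_matrix :: "'w measure \<Rightarrow> ('w \<Rightarrow> real^'n) \<Rightarrow> real^'n^'n" where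
  "covariance_matrix M X =
     (\<chi> i j. \<integral>\<omega>. (X \<omega> $ i - (\<integral>\<omega>'. X \<omega>' $ i \<partial>M)) * (X \<omega> $ j - (\<integral>\<omega>'. X \<omega>' $ j \<partial>M)) \<partial>M)"

definition normal_law :: "real \<Rightarrow> real \<Rightarrow> real measure" where
  "normal_law m v =
     (if v = 0 then return borel m else density lborel (\<lambda>x. ennreal (normal_density m (sqrt v) x)))"

text \<open>A possibly degenerate normal vector: every linear combination of the components has a
  (possibly degenerate) univariate normal law.\<close>

definition normal_vector :: "'v measure \<Rightarrow> ('v \<Rightarrow> real^'n) \<Rightarrow> real^'n \<Rightarrow> real^'n^'n \<Rightarrow> bool" where
  "normal_vector N Y \<mu> \<Sigma> \<longleftrightarrow>
     Y \<in> borel_measurable N \<and>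
     (\<forall>t. distr N borel (\<lambda>\<omega>. t \<bullet> Y \<omega>) = normal_law (t \<bullet> \<mu>) (t \<bullet> (\<Sigma> *v t)))"

definition conv_in_distribution ::
    "'w measure \<Rightarrow> (nat \<Rightarrow> 'w \<Rightarrow> 'b::topological_space) \<Rightarrow> 'v measure \<Rightarrow> ('v \<Rightarrow> 'b) \<Rightarrow> bool" where
  "conv_in_distribution M X N Y \<longleftrightarrow>
     (\<forall>n. X n \<in> borel_measurable M) \<and> Y \<in> borel_measurable N \<and>
     (\<forall>\<phi>::'b \<Rightarrow> real. continuous_on UNIV \<phi> \<and> bounded (range \<phi>) \<longrightarrow>
        (\<lambda>n. \<integral>\<omega>. \<phi> (X n \<omega>) \<partial>M) \<longlonglongrightarrow> (\<integral>\<omega>. \<phi> (Y \<omega>) \<partial>N))"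

text \<open>The functions \<open>F(x, \<xi>)\<close>, its \<open>x\<close>-derivative and the derivative of the sample average are
  controlled only up to a null set of \<open>\<omega>\<close>, which need not have measurable subsets.  Expectations
  and probabilities involving them are therefore taken in the completion of the probability
  space; on measurable functions and events nothing changes.\<close>

definition mean_map ::
    "'w measure \<Rightarrow> (real^'q \<Rightarrow> real^'d \<Rightarrow> real^'q) \<Rightarrow> ('w \<Rightarrow> real^'d) \<Rightarrow> real^'q \<Rightarrow> real^'q" where
  "mean_map M F \<xi> x = (\<integral>\<omega>. F x (\<xi> \<omega>) \<partial>completion M)"

definition saa_map ::
    "(real^'q \<Rightarrow> real^'d \<Rightarrow> real^'q) \<Rightarrow> (nat \<Rightarrow> 'w \<Rightarrow> real^'d) \<Rightarrow> nat \<Rightarrow> 'w \<Rightarrow> real^'q \<Rightarrow> real^'q" where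
  "saa_map F \<xi>s n \<omega> x = (1 / real n) *\<^sub>R (\<Sum>i=1..n. F x (\<xi>s i \<omega>))"

end

theory Submission
  imports Defs
begin

text \<open>Let \<open>h\<^sub>n = z\<^sub>n - z\<^sub>0\<close> and \<open>e\<^sub>n = f\<^sub>n(x\<^sub>0) - f\<^sub>0(x\<^sub>0)\<close>.  Since \<open>S\<close> is
  polyhedral, \<open>\<Pi>\<^sub>S(z\<^sub>0 + h) = x\<^sub>0 + \<Pi>\<^sub>K h\<close> for all small \<open>h\<close>, and the B-derivative of \<open>\<Pi>\<^sub>S\<close> at
  \<open>z\<^sub>0 + h\<close> in direction \<open>-h\<close> is exactly \<open>-\<Pi>\<^sub>K h\<close>.  Hence the quantity to be estimated equals
  \<open>(L - df\<^sub>n(x\<^sub>n)) \<Pi>\<^sub>K h\<^sub>n\<close>, while the equation for \<open>z\<^sub>n\<close> reads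
  \<open>e\<^sub>n + L\<^sub>K h\<^sub>n + (df\<^sub>n(x\<^sub>0) - L) \<Pi>\<^sub>K h\<^sub>n + O(|h\<^sub>n|\<^sup>2) = 0\<close>.  By Brouwer's theorem this equation
  has a small solution as soon as \<open>e\<^sub>n\<close> and \<open>df\<^sub>n(x\<^sub>0) - L\<close> are small; by uniqueness it is \<open>h\<^sub>n\<close>,
  and \<open>|h\<^sub>n| \<le> const |e\<^sub>n|\<close>.  Chebyshev's inequality bounds \<open>\<surd>n e\<^sub>n\<close> in probability, so both
  \<open>\<surd>n (L - df\<^sub>n(x\<^sub>n)) \<Pi>\<^sub>K h\<^sub>n\<close> and the difference between \<open>d(f\<^sub>n)\<^sub>S(z\<^sub>n)(z\<^sub>0 - z\<^sub>n)\<close> and \<open>e\<^sub>n\<close>,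
  scaled by \<open>\<surd>n\<close>, tend to zero in probability; the limit law comes from the central limit theorem for \<open>e\<^sub>n\<close>.

  The regularity hypotheses hold off null sets for \<open>\<xi>\<close> itself, uniformly in \<open>x\<close>.  That they pass to
  the samples \<open>\<xi>\<^sup>i\<close>, which merely have the same law, is a statement about projections of Borel
  sets and rests on Choquet's capacitability argument.\<close>

section \<open>Projections onto polyhedra\<close>

text \<open>The modulus \<open>C\<close> of (c) is a function of \<open>\<omega>\<close>, not of the
  value \<open>\<xi> \<omega>\<close>, so it has no counterpart for the samples. It is replaced by a
  Borel function \<open>c\<close> of the sample value: the supremum, over a countable dense set of
  pairs of points, of the quotients that measure the first-order remainder and the variation of the
  derivative. Then \<open>c (\<xi> \<omega>)\<close> is at most twice the positive part of
  \<open>C \<omega>\<close>, and the averages of \<open>c\<close> over the samples are random moduli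
  for \<open>f n\<close>. Showing that \<open>c\<close> dominates the quotients at all pairs
  simultaneously, also for the samples, is where projections of Borel sets come in. The final
  estimate is deterministic on an event on which three averages (values at \<open>x0\<close>,
  derivatives at \<open>x0\<close>, moduli) are under control. The bounds on the first and the third
  fix the probability of this event; the bound on the second can then still be chosen as small as
  the wanted accuracy requires, because the derivatives obey a weak law of large numbers.\<close>

lemma closest_point_eqI:
  fixes S :: "'a::euclidean_space set"
  assumes "convex S" "closed S" "x \<in> S" "\<And>s. s \<in> S \<Longrightarrow> (z - x) \<bullet> (s - x) \<le> 0"
  shows "closest_point S z = x"
proof (rule closest_point_unique[symmetric, OF assms(1-3)], rule ballI)
  fix s assume "s \<in> S"
  have "(z - s) \<bullet> (z - s) = (z - x) \<bullet> (z - x) - 2 * ((z - x) \<bullet> (s - x)) + (s - x) \<bullet> (s - x)"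
    by (simp add: inner_diff_left inner_diff_right inner_commute algebra_simps)
  then have "(norm (z - x))\<^sup>2 \<le> (norm (z - s))\<^sup>2"
    using assms(4)[OF \<open>s \<in> S\<close>] inner_ge_zero[of "s - x"]
    unfolding power2_norm_eq_inner by linarith
  then show "dist z x \<le> dist z s"
    unfolding dist_norm by (rule power2_le_imp_le) simp
qed

text \<open>A halfspace active at \<open>x\<close> contains \<open>x + w\<close> for every feasible
  direction \<open>w\<close>, whatever its length; an inactive one is not left before the distance
  \<open>(b - a \<bullet> x) / norm a\<close>. As there are finitely many halfspaces, one radius
  serves all of them.\<close>

lemma polyhedron_tangent_cone_local:
  fixes S :: "'a::euclidean_space set"
  assumes "polyhedron S" "x \<in> S"
  obtains r where "r > 0" "\<And>w. w \<in> tangent_cone S x \<Longrightarrow> norm w \<le> r \<Longrightarrow> x + w \<in> S"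
proof -
  obtain \<H> where fin: "finite \<H>" and S: "S = \<Inter>\<H>"
    and ab: "\<forall>h\<in>\<H>. \<exists>a b. a \<noteq> 0 \<and> h = {x. a \<bullet> x \<le> b}"
    using assms(1) unfolding polyhedron_def by blast
  have "\<exists>r>0. \<forall>w. w \<in> tangent_cone S x \<longrightarrow> norm w \<le> r \<longrightarrow> x + w \<in> h" if "h \<in> \<H>" for h
  proof -
    obtain a b where h: "h = {x. a \<bullet> x \<le> b}" and "a \<noteq> 0"
      using ab \<open>h \<in> \<H>\<close> by blast
    have xh: "a \<bullet> x \<le> b"
      using assms(2) that S h by auto
    show ?thesis
    proof (cases "a \<bullet> x = b")
      case True
      have "x + w \<in> h" if w: "w \<in> tangent_cone S x" for w
      proof -
        obtain t where "t > 0" "x + t *\<^sub>R w \<in> S"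
          using w by (auto simp: tangent_cone_def)
        then have "a \<bullet> (x + t *\<^sub>R w) \<le> b"
          using S h \<open>h \<in> \<H>\<close> by auto
        then have "a \<bullet> w \<le> 0"
          using True \<open>t > 0\<close> by (simp add: inner_add_right mult_le_0_iff)
        then show ?thesis
          using True h by (simp add: inner_add_right)
      qed
      then show ?thesis
        by (intro exI[of _ 1]) auto
    next
      case False
      have "x + w \<in> h" if w: "norm w \<le> (b - a \<bullet> x) / norm a" for w
      proof -
        have "a \<bullet> w \<le> norm a * norm w"
          by (rule norm_cauchy_schwarz)
        also have "\<dots> \<le> b - a \<bullet> x"
          using w \<open>a \<noteq> 0\<close> by (simp add: field_simps)
        finally show ?thesis
          by (simp add: h inner_add_right)
      qed
      then show ?thesis
        using False xh \<open>a \<noteq> 0\<close> by (intro exI[of _ "(b - a \<bullet> x) / norm a"]) auto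
    qed
  qed
  then obtain \<rho> where \<rho>: "\<And>h. h \<in> \<H> \<Longrightarrow> \<rho> h > 0"
    "\<And>h w. h \<in> \<H> \<Longrightarrow> w \<in> tangent_cone S x \<Longrightarrow> norm w \<le> \<rho> h \<Longrightarrow> x + w \<in> h"
    by metis
  \<comment> \<open>The \<open>1\<close> covers the empty family of halfspaces, that is
    \<open>S = UNIV\<close>.\<close>
  show thesis
  proof (rule that[of "Min (insert 1 (\<rho> ` \<H>))"])
    show "Min (insert 1 (\<rho> ` \<H>)) > 0"
      using fin \<rho>(1) by (subst Min_gr_iff) auto
  next
    fix w assume w: "w \<in> tangent_cone S x" "norm w \<le> Min (insert 1 (\<rho> ` \<H>))"
    have "norm w \<le> \<rho> h" if "h \<in> \<H>" for h
      using w(2) fin that by (intro order_trans[OF w(2)] Min_le) auto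
    then show "x + w \<in> S"
      using \<rho>(2) w(1) S by auto
  qed
qed

section \<open>Tangent cones and critical cones\<close>

definition critical_cone :: "'a::real_inner set \<Rightarrow> 'a \<Rightarrow> 'a \<Rightarrow> 'a set" where
  "critical_cone S x v = tangent_cone S x \<inter> {w. v \<bullet> w = 0}"

lemma tangent_cone_diff: "s \<in> S \<Longrightarrow> s - x \<in> tangent_cone S x"
  by (auto simp: tangent_cone_def intro!: exI[of _ 1])

lemma tangent_cone_scaleR:
  assumes "w \<in> tangent_cone S x" "t > 0"
  shows "t *\<^sub>R w \<in> tangent_cone S x"
proof -
  obtain u where "u > 0" "x + u *\<^sub>R w \<in> S"
    using assms(1) by (auto simp: tangent_cone_def)
  then show ?thesis
    using assms(2) by (auto simp: tangent_cone_def intro!: exI[of _ "u / t"])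
qed

lemma critical_cone_scaleR:
  "w \<in> critical_cone S x v \<Longrightarrow> t > 0 \<Longrightarrow> t *\<^sub>R w \<in> critical_cone S x v"
  by (simp add: critical_cone_def tangent_cone_scaleR)

lemma zero_in_critical_cone: "x \<in> S \<Longrightarrow> 0 \<in> critical_cone S x v"
  by (auto simp: critical_cone_def tangent_cone_def intro!: exI[of _ 1])

text \<open>Feasible directions of a general closed convex set need not form a closed set. For a
  polyhedron one radius serves all directions, so after scaling by \<open>t\<close> the points
  \<open>x + t *\<^sub>R X n\<close> eventually lie in \<open>S\<close>, and the limit is taken in
  \<open>S\<close>.\<close>

lemma closed_tangent_cone:
  fixes S :: "'a::euclidean_space set"
  assumes "polyhedron S" "x \<in> S"
  shows "closed (tangent_cone S x)"
  unfolding closed_sequential_limits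
proof (intro allI impI, elim conjE)
  fix X l assume X: "\<forall>n. X n \<in> tangent_cone S x" and lim: "X \<longlonglongrightarrow> l"
  obtain r where r: "r > 0" "\<And>w. w \<in> tangent_cone S x \<Longrightarrow> norm w \<le> r \<Longrightarrow> x + w \<in> S"
    using polyhedron_tangent_cone_local[OF assms] by blast
  define t where "t = r / (norm l + 1)"
  have t: "t > 0" "t * norm l < r"
    using r(1) add_nonneg_pos[OF norm_ge_zero[of l] zero_less_one]
    unfolding t_def by (simp_all add: pos_divide_less_eq distrib_left)
  have "(\<lambda>n. norm (t *\<^sub>R X n)) \<longlonglongrightarrow> norm (t *\<^sub>R l)"
    by (intro tendsto_intros lim)
  then have "\<forall>\<^sub>F n in sequentially. norm (t *\<^sub>R X n) < r"
    by (rule order_tendstoD) (use t in auto)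
  then have "\<forall>\<^sub>F n in sequentially. x + t *\<^sub>R X n \<in> S"
    by eventually_elim (intro r(2) tangent_cone_scaleR; use t X in auto)
  moreover have "(\<lambda>n. x + t *\<^sub>R X n) \<longlonglongrightarrow> x + t *\<^sub>R l"
    by (intro tendsto_intros lim)
  ultimately have "x + t *\<^sub>R l \<in> S"
    using Lim_in_closed_set[OF polyhedron_imp_closed[OF assms(1)]] by force
  then show "l \<in> tangent_cone S x"
    using t by (auto simp: tangent_cone_def)
qed

lemma convex_tangent_cone:
  assumes "convex S"
  shows "convex (tangent_cone S x)"
proof (rule convexI)
  fix v w :: 'a and a b :: real
  assume v: "v \<in> tangent_cone S x" and w: "w \<in> tangent_cone S x"
    and ab: "0 \<le> a" "0 \<le> b" "a + b = 1"
  obtain t u where t: "t > 0" "x + t *\<^sub>R v \<in> S" and u: "u > 0" "x + u *\<^sub>R w \<in> S"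
    using v w by (auto simp: tangent_cone_def)
  \<comment> \<open>The weights \<open>a * u / c\<close> and \<open>b * t / c\<close> compensate for
    the different step lengths \<open>t\<close> and \<open>u\<close>: both directions then appear
    with the common factor \<open>t * u / c\<close>.\<close>
  define c where "c = a * u + b * t"
  have c: "c > 0"
  proof (cases "a = 0")
    case True
    then show ?thesis using ab t by (simp add: c_def)
  next
    case False
    then show ?thesis using ab t u by (simp add: c_def add_pos_nonneg)
  qed
  have "(a * u / c) *\<^sub>R (x + t *\<^sub>R v) + (b * t / c) *\<^sub>R (x + u *\<^sub>R w) \<in> S"
    using ab t u c by (intro convexD[OF assms]) (auto simp: c_def simp flip: add_divide_distrib)
  moreover have "(a * u / c) *\<^sub>R (x + t *\<^sub>R v) + (b * t / c) *\<^sub>R (x + u *\<^sub>R w)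
      = (a * u / c + b * t / c) *\<^sub>R x + (t * u / c) *\<^sub>R (a *\<^sub>R v + b *\<^sub>R w)"
    by (simp add: algebra_simps)
  moreover have "a * u / c + b * t / c = 1"
    using c by (simp add: c_def flip: add_divide_distrib)
  ultimately have "x + (t * u / c) *\<^sub>R (a *\<^sub>R v + b *\<^sub>R w) \<in> S"
    by simp
  then show "a *\<^sub>R v + b *\<^sub>R w \<in> tangent_cone S x"
    using t u c by (auto simp: tangent_cone_def intro!: exI[of _ "t * u / c"])
qed

lemma critical_cone_closed_convex:
  fixes S :: "'a::euclidean_space set"
  assumes "polyhedron S" "x \<in> S"
  shows "closed (critical_cone S x v)" "convex (critical_cone S x v)"
proof -
  show "closed (critical_cone S x v)"
    unfolding critical_cone_def by (intro closed_Int closed_tangent_cone assms closed_hyperplane)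
  show "convex (critical_cone S x v)"
    unfolding critical_cone_def
    by (intro convex_Int convex_tangent_cone polyhedron_imp_convex assms convex_hyperplane)
qed

section \<open>Projections onto cones and the local form of the projection\<close>

lemma closest_point_cone_inner:
  fixes K :: "'a::euclidean_space set"
  assumes "closed K" "convex K" "0 \<in> K" "\<And>w t. w \<in> K \<Longrightarrow> t > 0 \<Longrightarrow> t *\<^sub>R w \<in> K"
  shows "(h - closest_point K h) \<bullet> closest_point K h = 0"
    and "w \<in> K \<Longrightarrow> (h - closest_point K h) \<bullet> w \<le> 0"
proof -
  let ?k = "closest_point K h"
  have k: "?k \<in> K"
    using assms by (intro closest_point_in_set) auto
  have dot: "(h - ?k) \<bullet> (w - ?k) \<le> 0" if "w \<in> K" for w
    using assms that by (intro closest_point_dot)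
  \<comment> \<open>Twice the projection and \<open>0\<close> both belong to the cone and test the
    variational inequality in opposite directions.\<close>
  have "(h - ?k) \<bullet> (2 *\<^sub>R ?k - ?k) \<le> 0" "(h - ?k) \<bullet> (0 - ?k) \<le> 0"
    using k assms(3,4) by (intro dot; simp)+
  then show *: "(h - ?k) \<bullet> ?k = 0"
    by (simp add: inner_diff_right)
  show "(h - ?k) \<bullet> w \<le> 0" if "w \<in> K" for w
    using dot[OF that] * by (simp add: inner_diff_right)
qed

lemma closest_point_cone_scaleR:
  fixes K :: "'a::euclidean_space set"
  assumes "closed K" "convex K" "0 \<in> K" "\<And>w t. w \<in> K \<Longrightarrow> t > 0 \<Longrightarrow> t *\<^sub>R w \<in> K" "t > 0"
  shows "closest_point K (t *\<^sub>R h) = t *\<^sub>R closest_point K h"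
proof (rule closest_point_eqI[OF assms(2,1)])
  have "closest_point K h \<in> K"
    using assms by (intro closest_point_in_set) auto
  then show "t *\<^sub>R closest_point K h \<in> K"
    using assms by auto
next
  fix s assume "s \<in> K"
  then have "(h - closest_point K h) \<bullet> s \<le> 0"
    using assms by (intro closest_point_cone_inner) auto
  moreover have "(h - closest_point K h) \<bullet> closest_point K h = 0"
    using assms by (intro closest_point_cone_inner) auto
  moreover have "(t *\<^sub>R h - t *\<^sub>R closest_point K h) \<bullet> (s - t *\<^sub>R closest_point K h)
     = t * ((h - closest_point K h) \<bullet> s) - t * t * ((h - closest_point K h) \<bullet> closest_point K h)"
    by (simp add: algebra_simps inner_diff_left inner_diff_right)
  ultimately show "(t *\<^sub>R h - t *\<^sub>R closest_point K h) \<bullet> (s - t *\<^sub>R closest_point K h) \<le> 0"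
    using assms(5) by (simp add: mult_le_0_iff)
qed

lemma norm_closest_point_le:
  fixes K :: "'a::euclidean_space set"
  assumes "closed K" "convex K" "0 \<in> K"
  shows "norm (closest_point K h) \<le> norm h"
  using closest_point_lipschitz[OF assms(2,1), of h 0] assms(3) closest_point_self[OF assms(3)]
  by (auto simp: dist_norm)

text \<open>Near \<open>x\<close> the polyhedron is the convex hull of finitely many points \<open>p\<close>, and the normality
  inequality at \<open>x + \<Pi>\<^sub>K h\<close> has to be checked only in the directions \<open>p - x\<close>.  Those orthogonal to
  \<open>z - x\<close> lie in \<open>K\<close>; for the others \<open>(z - x) \<bullet> (p - x)\<close> is negative, hence stays so for
  small \<open>h\<close>.\<close>

lemma closest_point_polyhedron_local:
  fixes S :: "'a::euclidean_space set" and z :: 'a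
  assumes "polyhedron S" "S \<noteq> {}"
  defines "x \<equiv> closest_point S z"
  defines "K \<equiv> critical_cone S x (z - x)"
  obtains r where "r > 0"
    "\<And>h. norm h \<le> r \<Longrightarrow> closest_point S (z + h) = x + closest_point K h"
proof -
  have clS: "closed S" and cvS: "convex S"
    using assms(1) polyhedron_imp_closed polyhedron_imp_convex by auto
  have xS: "x \<in> S"
    unfolding x_def by (rule closest_point_in_set[OF clS assms(2)])
  define v where "v = z - x"
  have vS: "v \<bullet> (s - x) \<le> 0" if "s \<in> S" for s
    unfolding v_def x_def by (rule closest_point_dot[OF cvS clS that])
  have K: "closed K" "convex K" "0 \<in> K" "\<And>w t. w \<in> K \<Longrightarrow> t > 0 \<Longrightarrow> t *\<^sub>R w \<in> K"
    unfolding K_def using critical_cone_closed_convex[OF assms(1) xS] zero_in_critical_cone[OF xS]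
    by (auto intro: critical_cone_scaleR)
  obtain r1 where r1: "r1 > 0" "\<And>w. w \<in> tangent_cone S x \<Longrightarrow> norm w \<le> r1 \<Longrightarrow> x + w \<in> S"
    using polyhedron_tangent_cone_local[OF assms(1) xS] by blast
  \<comment> \<open>The cube makes the polyhedron bounded, hence the convex hull of finitely many
    points; the centre \<open>x\<close> keeps it a neighbourhood of \<open>x\<close> in
    \<open>S\<close>.\<close>
  define Q where "Q = S \<inter> cbox (x - One) (x + One)"
  have "polytope Q"
    unfolding Q_def polytope_eq_bounded_polyhedron
    using assms(1) by (auto intro: bounded_subset[OF bounded_cbox])
  then obtain V where V: "finite V" "Q = convex hull V"
    unfolding polytope_def by blast
  have VS: "p \<in> S" if "p \<in> V" for p
    using V hull_inc[OF that, of convex] unfolding Q_def by auto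
  \<comment> \<open>Up to this norm of \<open>h\<close>, Cauchy-Schwarz keeps the contribution of
    \<open>h - k\<close> from outweighing the negative \<open>v \<bullet> (p - x)\<close>. The value
    \<open>1\<close> is a placeholder for points orthogonal to \<open>v\<close>, which impose no
    restriction.\<close>
  define \<rho> where "\<rho> p = (if v \<bullet> (p - x) < 0 then - (v \<bullet> (p - x)) / norm (p - x) else 1)" for p
  define r where "r = Min (insert r1 (\<rho> ` V))"
  have \<rho>: "\<rho> p > 0" for p
    by (auto simp: \<rho>_def intro!: divide_neg_pos)
  show thesis
  proof (rule that[of r])
    show "r > 0"
      unfolding r_def using V(1) r1(1) \<rho> by (subst Min_gr_iff) auto
  next
    fix h :: 'a assume h: "norm h \<le> r"
    define k where "k = closest_point K h"
    have h\<rho>: "norm h \<le> \<rho> p" if "p \<in> V" for p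
      using V(1) that by (auto intro!: order_trans[OF h] Min_le simp: r_def)
    have hr1: "norm h \<le> r1"
      using V(1) by (auto intro!: order_trans[OF h] Min_le simp: r_def)
    have kK: "k \<in> K"
      unfolding k_def using K by (intro closest_point_in_set) auto
    have nk: "norm k \<le> norm h"
      unfolding k_def by (rule norm_closest_point_le[OF K(1-3)])
    have hk: "(h - k) \<bullet> k = 0" "\<And>w. w \<in> K \<Longrightarrow> (h - k) \<bullet> w \<le> 0"
      unfolding k_def by (rule closest_point_cone_inner[OF K]; assumption)+
    \<comment> \<open>Moreau decomposition: \<open>h - k\<close> and \<open>k\<close> are
      orthogonal.\<close>
    have nhk: "norm (h - k) \<le> norm h"
    proof -
      have "h \<bullet> h = (h - k) \<bullet> (h - k) + k \<bullet> k + 2 * ((h - k) \<bullet> k)"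
        by (simp add: inner_diff_left inner_diff_right inner_commute)
      then have "(norm (h - k))\<^sup>2 \<le> (norm h)\<^sup>2"
        using hk(1) by (simp add: power2_norm_eq_inner)
      then show ?thesis
        by (rule power2_le_imp_le) simp
    qed
    have vk: "v \<bullet> k = 0" and kT: "k \<in> tangent_cone S x"
      using kK by (auto simp: K_def critical_cone_def v_def)
    have pV: "(v + h - k) \<bullet> (p - x) \<le> 0" if "p \<in> V" for p
    proof (cases "v \<bullet> (p - x) < 0")
      case True
      have "p \<noteq> x" using True by auto
      have "norm h * norm (p - x) \<le> - (v \<bullet> (p - x))"
        using h\<rho>[OF that] True \<open>p \<noteq> x\<close> by (simp add: \<rho>_def field_simps)
      moreover have "(h - k) \<bullet> (p - x) \<le> norm h * norm (p - x)"
        by (rule order_trans[OF norm_cauchy_schwarz]) (intro mult_right_mono nhk norm_ge_zero)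
      ultimately show ?thesis
        by (simp add: inner_add_left inner_diff_left)
    next
      case False
      then have "v \<bullet> (p - x) = 0"
        using vS[OF VS[OF that]] by simp
      then have "p - x \<in> K"
        unfolding K_def critical_cone_def using VS[OF that] tangent_cone_diff v_def by auto
      then show ?thesis
        using hk(2) \<open>v \<bullet> (p - x) = 0\<close> by (simp add: inner_add_left inner_diff_left)
    qed
    have "V \<subseteq> {p. (v + h - k) \<bullet> p \<le> (v + h - k) \<bullet> x}"
      using pV by (auto simp: inner_diff_right)
    then have "Q \<subseteq> {p. (v + h - k) \<bullet> p \<le> (v + h - k) \<bullet> x}"
      unfolding V(2) by (rule hull_minimal) (rule convex_halfspace_le)
    then have pQ: "(v + h - k) \<bullet> (p - x) \<le> 0" if "p \<in> Q" for p
      using that by (auto simp: inner_diff_right)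
    have pS: "(v + h - k) \<bullet> (s - x) \<le> 0" if "s \<in> S" for s
    proof -
      \<comment> \<open>A point \<open>s\<close> far away is pulled along the segment towards
        \<open>x\<close> into the cube; the inequality is homogeneous in
        \<open>s - x\<close>.\<close>
      define t where "t = 1 / (1 + norm (s - x))"
      have n: "1 + norm (s - x) > 0" by (intro add_pos_nonneg) auto
      have t: "t > 0" "t \<le> 1" "t * norm (s - x) \<le> 1"
        using n unfolding t_def by auto
      have "x + t *\<^sub>R (s - x) \<in> S"
        using convexD_alt[OF cvS xS that, of t] t by (simp add: algebra_simps)
      moreover have "\<bar>(t *\<^sub>R (s - x)) \<bullet> i\<bar> \<le> 1" if "i \<in> Basis" for i
        using Basis_le_norm[OF that, of "t *\<^sub>R (s - x)"] t by simp
      then have "x + t *\<^sub>R (s - x) \<in> cbox (x - One) (x + One)"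
        unfolding mem_box by (auto simp: inner_diff_left inner_add_left abs_le_iff algebra_simps)
      ultimately have "(v + h - k) \<bullet> (x + t *\<^sub>R (s - x) - x) \<le> 0"
        by (intro pQ) (auto simp: Q_def)
      then show ?thesis
        using t(1) by (simp add: mult_le_0_iff)
    qed
    have "closest_point S (z + h) = x + k"
    proof (rule closest_point_eqI[OF cvS clS])
      show "x + k \<in> S"
        using r1(2)[OF kT] nk hr1 by simp
      fix s assume "s \<in> S"
      have "(z + h - (x + k)) \<bullet> (s - (x + k)) = (v + h - k) \<bullet> (s - x) - v \<bullet> k - (h - k) \<bullet> k"
        by (simp add: v_def inner_diff_left inner_diff_right inner_add_left inner_add_right)
      then show "(z + h - (x + k)) \<bullet> (s - (x + k)) \<le> 0"
        using pS[OF \<open>s \<in> S\<close>] vk hk(1) by simp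
    qed
    then show "closest_point S (z + h) = x + closest_point K h"
      unfolding k_def .
  qed
qed

section \<open>The B-derivative of the projection\<close>

lemma has_B_derivative_closest_point:
  fixes S :: "'a::euclidean_space set"
  assumes "polyhedron S" "S \<noteq> {}"
  shows "has_B_derivative (closest_point S)
    (closest_point (critical_cone S (closest_point S z) (z - closest_point S z))) z"
proof -
  define x where "x = closest_point S z"
  define K where "K = critical_cone S x (z - x)"
  have clS: "closed S" and cvS: "convex S"
    using assms(1) polyhedron_imp_closed polyhedron_imp_convex by auto
  have xS: "x \<in> S"
    unfolding x_def by (rule closest_point_in_set[OF clS assms(2)])
  have K: "closed K" "convex K" "0 \<in> K" "\<And>w t. w \<in> K \<Longrightarrow> t > 0 \<Longrightarrow> t *\<^sub>R w \<in> K"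
    unfolding K_def using critical_cone_closed_convex[OF assms(1) xS] zero_in_critical_cone[OF xS]
    by (auto intro: critical_cone_scaleR)
  obtain r where r: "r > 0"
    "\<And>h. norm h \<le> r \<Longrightarrow> closest_point S (z + h) = x + closest_point K h"
    using closest_point_polyhedron_local[OF assms, of z] unfolding x_def K_def by blast
  have "1-lipschitz_on (ball z 1) (closest_point S)"
    by (rule lipschitz_onI) (use closest_point_lipschitz[OF cvS clS assms(2)] in auto)
  \<comment> \<open>Near \<open>z\<close> the expansion is exact, so the remainder vanishes on a
    punctured ball.\<close>
  moreover have "\<forall>\<^sub>F v in at 0. (closest_point S (z + v) - closest_point S z - closest_point K v) /\<^sub>R norm v = 0"
    unfolding eventually_at using r by (auto intro!: exI[of _ r] simp: x_def)
  then have "((\<lambda>v. (closest_point S (z + v) - closest_point S z - closest_point K v) /\<^sub>R norm v) \<longlongrightarrow> 0) (at 0)"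
    by (rule tendsto_eventually)
  ultimately show ?thesis
    unfolding has_B_derivative_def x_def[symmetric] K_def[symmetric]
    using closest_point_cone_scaleR[OF K] by (auto intro!: exI[of _ 1])
qed

lemma B_derivative_eqI: "has_B_derivative g G x \<Longrightarrow> B_derivative g x = G"
  unfolding B_derivative_def using has_B_derivative_unique by blast

lemma B_derivative_closest_point:
  fixes S :: "'a::euclidean_space set"
  assumes "polyhedron S" "S \<noteq> {}"
  shows "B_derivative (closest_point S) z
    = closest_point (critical_cone S (closest_point S z) (z - closest_point S z))"
  by (rule B_derivative_eqI[OF has_B_derivative_closest_point[OF assms]])

text \<open>Along a ray the difference quotients are eventually constant. Unlike the formula with
  the critical cone, this describes the B-derivative by values of the projection alone, at an
  arbitrary base point.\<close>

lemma B_derivative_closest_point_eventually: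
  fixes S :: "'a::euclidean_space set"
  assumes "polyhedron S" "S \<noteq> {}"
  shows "\<forall>\<^sub>F t in at_right 0. closest_point S (z + t *\<^sub>R h)
    = closest_point S z + t *\<^sub>R B_derivative (closest_point S) z h"
proof -
  define x where "x = closest_point S z"
  define K where "K = critical_cone S x (z - x)"
  have clS: "closed S" and cvS: "convex S"
    using assms(1) polyhedron_imp_closed polyhedron_imp_convex by auto
  have xS: "x \<in> S"
    unfolding x_def by (rule closest_point_in_set[OF clS assms(2)])
  have K: "closed K" "convex K" "0 \<in> K" "\<And>w t. w \<in> K \<Longrightarrow> t > 0 \<Longrightarrow> t *\<^sub>R w \<in> K"
    unfolding K_def using critical_cone_closed_convex[OF assms(1) xS] zero_in_critical_cone[OF xS]
    by (auto intro: critical_cone_scaleR)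
  obtain r where r: "r > 0"
    "\<And>h. norm h \<le> r \<Longrightarrow> closest_point S (z + h) = x + closest_point K h"
    using closest_point_polyhedron_local[OF assms, of z] unfolding x_def K_def by blast
  have "((\<lambda>t::real. norm (t *\<^sub>R h)) \<longlongrightarrow> norm (0 *\<^sub>R h)) (at_right 0)"
    by (intro tendsto_intros)
  then have "\<forall>\<^sub>F t::real in at_right 0. norm (t *\<^sub>R h) < r"
    by (rule order_tendstoD) (use r in simp)
  then show ?thesis
    using eventually_at_right_less[of "0::real"]
  proof eventually_elim
    case (elim t)
    then show ?case
      using r(2)[of "t *\<^sub>R h"] closest_point_cone_scaleR[OF K]
      by (simp add: B_derivative_closest_point[OF assms] x_def K_def)
  qed
qed

text \<open>The critical cone may jump with the base point, so joint measurability is read off from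
  difference quotients, which are continuous in base point and direction and converge because they
  are eventually constant.\<close>

lemma borel_measurable_B_derivative_closest_point:
  fixes S :: "'a::euclidean_space set"
  assumes S: "polyhedron S" "S \<noteq> {}"
    and [measurable]: "z \<in> borel_measurable M" "h \<in> borel_measurable M"
  shows "(\<lambda>\<omega>. B_derivative (closest_point S) (z \<omega>) (h \<omega>)) \<in> borel_measurable M"
proof -
  have "continuous_on UNIV (closest_point S)"
    using S by (intro continuous_on_closest_point polyhedron_imp_convex polyhedron_imp_closed)
  then have [measurable]: "closest_point S \<in> borel_measurable borel"
    by (rule borel_measurable_continuous_onI)
  let ?q = "\<lambda>k \<omega>. real (Suc k) *\<^sub>R (closest_point S (z \<omega> + (1 / real (Suc k)) *\<^sub>R h \<omega>) - closest_point S (z \<omega>))"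
  show ?thesis
  proof (rule borel_measurable_LIMSEQ_metric[of ?q])
    fix \<omega>
    have "filterlim (\<lambda>k. 1 / real (Suc k)) (at_right 0) sequentially"
      using LIMSEQ_inverse_real_of_nat by (auto simp: filterlim_at inverse_eq_divide)
    then have "\<forall>\<^sub>F k in sequentially. closest_point S (z \<omega> + (1 / real (Suc k)) *\<^sub>R h \<omega>)
      = closest_point S (z \<omega>) + (1 / real (Suc k)) *\<^sub>R B_derivative (closest_point S) (z \<omega>) (h \<omega>)"
      using B_derivative_closest_point_eventually[OF S] by (auto simp: filterlim_iff)
    then have "\<forall>\<^sub>F k in sequentially. ?q k \<omega> = B_derivative (closest_point S) (z \<omega>) (h \<omega>)"
      by eventually_elim simp
    then show "(\<lambda>k. ?q k \<omega>) \<longlonglongrightarrow> B_derivative (closest_point S) (z \<omega>) (h \<omega>)"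
      by (rule tendsto_eventually)
  qed measurable
qed

text \<open>The critical cone at \<open>z + h\<close> may differ from \<open>K\<close>. But the
  segment from \<open>z + h\<close> back to \<open>z\<close> consists of the points
  \<open>z + (1 - t) *\<^sub>R h\<close>, on which the projection is affine in \<open>t\<close> by
  positive homogeneity of the projection onto \<open>K\<close>; its slope there is the derivative in
  direction \<open>- h\<close>.\<close>

lemma B_derivative_closest_point_towards:
  fixes S :: "'a::euclidean_space set" and z :: 'a
  assumes S: "polyhedron S" "S \<noteq> {}"
  defines "x \<equiv> closest_point S z"
  defines "K \<equiv> critical_cone S x (z - x)"
  assumes r: "\<And>h. norm h \<le> r \<Longrightarrow> closest_point S (z + h) = x + closest_point K h"
    and h: "norm h \<le> r"
  shows "B_derivative (closest_point S) (z + h) (- h) = - closest_point K h"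
proof -
  have xS: "x \<in> S"
    unfolding x_def using S polyhedron_imp_closed by (intro closest_point_in_set)
  have K: "closed K" "convex K" "0 \<in> K" "\<And>w t. w \<in> K \<Longrightarrow> t > 0 \<Longrightarrow> t *\<^sub>R w \<in> K"
    unfolding K_def using critical_cone_closed_convex[OF S(1) xS] zero_in_critical_cone[OF xS]
    by (auto intro: critical_cone_scaleR)
  have "\<forall>\<^sub>F t::real in at_right 0. t < 1 \<and> 0 < t"
    by (intro eventually_conj order_tendstoD[OF tendsto_ident_at] eventually_at_right_less) auto
  then have "\<forall>\<^sub>F t in at_right 0. 0 < t \<and> t *\<^sub>R B_derivative (closest_point S) (z + h) (- h) = t *\<^sub>R (- closest_point K h)"
    using B_derivative_closest_point_eventually[OF S, of "z + h" "- h"]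
  proof eventually_elim
    case (elim t)
    have "norm ((1 - t) *\<^sub>R h) \<le> r"
      using elim h by (simp add: mult_left_le_one_le order_trans[OF _ h])
    then have "closest_point S (z + (1 - t) *\<^sub>R h) = x + (1 - t) *\<^sub>R closest_point K h"
      using r elim closest_point_cone_scaleR[OF K, of "1 - t" h] by simp
    moreover have "z + h + t *\<^sub>R (- h) = z + (1 - t) *\<^sub>R h"
      by (simp add: algebra_simps)
    ultimately have "x + (1 - t) *\<^sub>R closest_point K h = x + closest_point K h + t *\<^sub>R B_derivative (closest_point S) (z + h) (- h)"
      using elim r[OF h] by metis
    then have "(1 - t) *\<^sub>R closest_point K h
      = closest_point K h + t *\<^sub>R B_derivative (closest_point S) (z + h) (- h)"
      by (simp add: add.assoc)
    then have "t *\<^sub>R closest_point K h + t *\<^sub>R B_derivative (closest_point S) (z + h) (- h) = 0"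
      by (simp add: algebra_simps)
    then show ?case
      using elim(1) by (simp add: eq_neg_iff_add_eq_0 add.commute)
  qed
  then obtain t :: real where "t > 0" "t *\<^sub>R B_derivative (closest_point S) (z + h) (- h) = t *\<^sub>R (- closest_point K h)"
    using eventually_happens'[OF trivial_limit_at_right_real] by blast
  then show ?thesis
    by (metis less_irrefl scaleR_cancel_left)
qed

section \<open>Almost sure uniform properties and equality in law\<close>

text \<open>Analytic sets, presented as projections of closed sets along Baire space
  \<open>nat \<Rightarrow> nat\<close>. In this form countable unions and intersections amount to
  recoding the auxiliary sequence.\<close>

definition souslin :: "'a::topological_space set \<Rightarrow> bool" where
  "souslin A \<longleftrightarrow> (\<exists>C :: ('a \<times> (nat \<Rightarrow> nat)) set. closed C \<and> A = fst ` C)"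

lemma souslin_closed: "closed A \<Longrightarrow> souslin A"
  unfolding souslin_def by (rule exI[of _ "A \<times> UNIV"]) (auto simp: closed_Times)

lemma continuous_on_reindex_seq:
  "continuous_on UNIV (\<lambda>p :: 'a::topological_space \<times> (nat \<Rightarrow> nat). (fst p, \<lambda>i. snd p (\<phi> i)))"
  by (intro continuous_on_Pair continuous_on_fst continuous_on_id
      continuous_on_coordinatewise_then_product
      continuous_on_compose2[OF continuous_on_product_coordinates continuous_on_snd]) auto

text \<open>The first entry of the sequence names the set \<open>A k\<close> to which the point
  belongs; the remaining entries are the witness for that set.\<close>

lemma souslin_UN:
  assumes "\<And>k::nat. souslin (A k)"
  shows "souslin (\<Union>k. A k)"
proof -
  obtain C :: "nat \<Rightarrow> ('a \<times> (nat \<Rightarrow> nat)) set" where C: "\<And>k. closed (C k)" "\<And>k. A k = fst ` C k"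
    using assms unfolding souslin_def by metis
  let ?\<phi> = "\<lambda>p. (fst p, \<lambda>i. snd p (Suc i))"
  \<comment> \<open>An implication as a closed condition: \<open>{p. snd p 0 \<noteq> k}\<close> is
    closed as well as open, since the entries are discrete.\<close>
  define C' where "C' = (\<Inter>k. {p. snd p 0 \<noteq> k} \<union> ?\<phi> -` C k)"
  have "{p :: 'a \<times> (nat \<Rightarrow> nat). snd p 0 \<noteq> k} = (\<lambda>p. snd p 0) -` (- {k})" for k
    by auto
  moreover have "closed ((\<lambda>p :: 'a \<times> (nat \<Rightarrow> nat). snd p 0) -` (- {k}))" for k
    by (intro closed_vimage continuous_on_compose2[OF continuous_on_product_coordinates continuous_on_snd])
      (auto simp: closed_def Topological_Spaces.open_discrete intro: continuous_on_id)
  ultimately have "closed C'"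
    unfolding C'_def
    by (intro closed_INT ballI closed_Un closed_vimage C(1) continuous_on_reindex_seq) auto
  moreover have "(\<Union>k. A k) = fst ` C'"
  proof (intro equalityI subsetI)
    fix x assume "x \<in> (\<Union>k. A k)"
    then obtain k \<sigma> where "(x, \<sigma>) \<in> C k"
      using C(2) by auto
    then have "(x, case_nat k \<sigma>) \<in> C'"
      unfolding C'_def by auto
    then show "x \<in> fst ` C'"
      by force
  next
    fix x assume "x \<in> fst ` C'"
    then obtain \<sigma> where "(x, \<sigma>) \<in> C'"
      by auto
    then have "(x, \<lambda>i. \<sigma> (Suc i)) \<in> C (\<sigma> 0)"
      unfolding C'_def by auto
    then show "x \<in> (\<Union>k. A k)"
      using C(2) by force
  qed
  ultimately show ?thesis
    unfolding souslin_def by blast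
qed

text \<open>One sequence codes countably many: the witness for \<open>A k\<close> is stored at the
  positions \<open>prod_encode (k, i)\<close>.\<close>

lemma souslin_INT:
  assumes "\<And>k::nat. souslin (A k)"
  shows "souslin (\<Inter>k. A k)"
proof -
  obtain C :: "nat \<Rightarrow> ('a \<times> (nat \<Rightarrow> nat)) set" where C: "\<And>k. closed (C k)" "\<And>k. A k = fst ` C k"
    using assms unfolding souslin_def by metis
  let ?\<phi> = "\<lambda>k p. (fst p, \<lambda>i. snd p (prod_encode (k, i)))"
  define C' where "C' = (\<Inter>k. ?\<phi> k -` C k)"
  have "closed C'"
    unfolding C'_def by (intro closed_INT ballI closed_vimage C(1) continuous_on_reindex_seq)
  moreover have "(\<Inter>k. A k) = fst ` C'"
  proof (intro equalityI subsetI)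
    fix x assume x: "x \<in> (\<Inter>k. A k)"
    have "\<exists>\<sigma>. (x, \<sigma>) \<in> C k" for k
      using x C(2) by force
    then obtain \<sigma> where "\<And>k. (x, \<sigma> k) \<in> C k"
      by metis
    then have "(x, \<lambda>n. \<sigma> (fst (prod_decode n)) (snd (prod_decode n))) \<in> C'"
      unfolding C'_def by auto
    then show "x \<in> fst ` C'"
      by force
  next
    fix x assume "x \<in> fst ` C'"
    then obtain \<sigma> where "(x, \<sigma>) \<in> C'"
      by auto
    then have "(x, \<lambda>i. \<sigma> (prod_encode (k, i))) \<in> C k" for k
      unfolding C'_def by auto
    then show "x \<in> (\<Inter>k. A k)"
      using C(2) by force
  qed
  ultimately show ?thesis
    unfolding souslin_def by blast
qed

lemma souslin_open:
  fixes U :: "'a::euclidean_space set"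
  assumes "open U"
  shows "souslin U"
proof -
  obtain \<D> where \<D>: "countable \<D>" "\<And>X. X \<in> \<D> \<Longrightarrow> \<exists>a b. X = cbox a b" "\<Union>\<D> = U"
    using open_countable_Union_open_cbox[OF assms] by metis
  \<comment> \<open>The empty set is added so that \<open>from_nat_into\<close> enumerates a
    nonempty family even for empty \<open>U\<close>.\<close>
  have cl: "souslin X" if "X \<in> \<D> \<union> {{}}" for X
    using \<D>(2) that by (auto intro: souslin_closed closed_cbox)
  have "U = (\<Union>k. from_nat_into (insert {} \<D>) k)"
    using \<D>(1,3) by (simp add: range_from_nat_into)
  moreover have "souslin (from_nat_into (insert {} \<D>) k)" for k
    using from_nat_into[of "insert {} \<D>" k] by (intro cl) auto
  ultimately show ?thesis
    using souslin_UN by metis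
qed

text \<open>Souslin sets are not closed under complements, so the induction carries a set and its
  complement together.\<close>

lemma souslin_borel:
  fixes B :: "'a::euclidean_space set"
  assumes "B \<in> sets borel"
  shows "souslin B"
proof -
  have "B \<in> sigma_sets UNIV {U. open U}"
    using assms by (simp add: borel_def)
  then have "souslin B \<and> souslin (- B)"
  proof induction
    case (Basic a)
    then show ?case
      by (auto intro: souslin_open souslin_closed simp: closed_def)
  next
    case Empty
    then show ?case
      by (auto intro: souslin_closed)
  next
    case (Compl a)
    then show ?case
      by (simp flip: Compl_eq_Diff_UNIV)
  next
    case (Union a)
    then have "souslin (\<Inter>i. - a i)" "souslin (\<Union>i. a i)"
      by (auto intro: souslin_INT souslin_UN)
    then show ?case
      by (simp add: Compl_UN)
  qed
  then show ?thesis ..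
qed

section \<open>Capacitability of projections\<close>

lemma compact_seq_le: "compact {\<sigma> :: nat \<Rightarrow> nat. \<forall>i. \<sigma> i \<le> m i}"
proof -
  have "compactin (product_topology (\<lambda>i. euclidean) UNIV) (Pi\<^sub>E UNIV (\<lambda>i. {..m i}))"
    unfolding compactin_PiE by (auto intro: finite_imp_compact)
  then have "compact (Pi\<^sub>E UNIV (\<lambda>i. {..m i}))"
    by (simp add: euclidean_product_topology)
  moreover have "Pi\<^sub>E UNIV (\<lambda>i. {..m i}) = {\<sigma>. \<forall>i. \<sigma> i \<le> m i}"
    by (auto simp: PiE_iff)
  ultimately show ?thesis
    by simp
qed

lemma tendsto_coordinatewise:
  fixes f :: "'c \<Rightarrow> 'a \<Rightarrow> 'b::topological_space"
  assumes "\<And>i. ((\<lambda>x. f x i) \<longlongrightarrow> l i) F"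
  shows "(f \<longlongrightarrow> l) F"
proof -
  have "limitin (product_topology (\<lambda>i. euclidean) UNIV) f l F"
    using assms by (auto simp: limitin_componentwise)
  then show ?thesis
    by (simp add: euclidean_product_topology)
qed

text \<open>Choquet's capacitability argument: writing \<open>B\<close> as the projection of a closed set of pairs
  \<open>(x, \<sigma>)\<close>, bounds on the norm of \<open>x\<close> and on the successive \<open>\<sigma> i\<close> are chosen one after the
  other so that the outer measure of the image stays above \<open>a\<close>; all bounds together cut
  out a compact set.\<close>

lemma null_set_continuous_image:
  fixes B :: "'a::euclidean_space set" and \<mu> :: "'b::euclidean_space measure"
  assumes "finite_measure \<mu>" and sets: "sets \<mu> = sets borel"
    and cont: "continuous_on UNIV f" and "B \<in> sets borel"
    and null: "\<And>C. compact C \<Longrightarrow> C \<subseteq> B \<Longrightarrow> emeasure \<mu> (f ` C) = 0"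
  obtains N where "N \<in> null_sets \<mu>" "f ` B \<subseteq> N"
proof -
  interpret finite_measure \<mu> by fact
  have space: "space \<mu> = UNIV"
    using sets_eq_imp_space_eq[OF sets] by simp
  have "outer_measure_of \<mu> (f ` B) = 0"
  proof (rule ccontr)
    assume "outer_measure_of \<mu> (f ` B) \<noteq> 0"
    then have "0 < outer_measure_of \<mu> (f ` B)"
      by (simp add: zero_less_iff_neq_zero)
    then obtain a where a: "0 < a" "a < outer_measure_of \<mu> (f ` B)"
      using dense by blast
    obtain C :: "('a \<times> (nat \<Rightarrow> nat)) set" where C: "closed C" "B = fst ` C"
      using souslin_borel[OF \<open>B \<in> sets borel\<close>] by (auto simp: souslin_def)
    define \<pi> where "\<pi> p = f (fst p)" for p :: "'a \<times> (nat \<Rightarrow> nat)"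
    \<comment> \<open>Index \<open>0\<close> stands for the norm of the point and index
      \<open>Suc j\<close> for entry \<open>j\<close> of the sequence, so that one list of bounds
      governs both.\<close>
    define g where "g i p = (case i of 0 \<Rightarrow> nat \<lceil>norm (fst p)\<rceil> | Suc j \<Rightarrow> snd p j)"
      for i :: nat and p :: "'a \<times> (nat \<Rightarrow> nat)"
    define E where "E ns = {p\<in>C. \<forall>i<length ns. g i p \<le> ns ! i}" for ns
    have step: "\<exists>m. a < outer_measure_of \<mu> (\<pi> ` E (ns @ [m]))"
      if "a < outer_measure_of \<mu> (\<pi> ` E ns)" for ns
    proof -
      have E: "E (ns @ [m]) = {p \<in> E ns. g (length ns) p \<le> m}" for m
        unfolding E_def by (auto simp: nth_append less_Suc_eq)
      have "\<pi> ` E ns = (\<Union>m. \<pi> ` E (ns @ [m]))"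
        unfolding E by blast
      \<comment> \<open>Outer measures are continuous along increasing unions even of nonmeasurable
        sets, which is why the bounds can be found one at a time.\<close>
      then have "outer_measure_of \<mu> (\<pi> ` E ns) = (SUP m. outer_measure_of \<mu> (\<pi> ` E (ns @ [m])))"
        by (subst SUP_outer_measure_of_incseq) (auto simp: space incseq_def E)
      then show ?thesis
        using that by (simp add: less_SUP_iff)
    qed
    define l where "l = rec_nat [] (\<lambda>_ ns. ns @ [SOME m. a < outer_measure_of \<mu> (\<pi> ` E (ns @ [m]))])"
    have l_Suc: "l (Suc k) = l k @ [SOME m. a < outer_measure_of \<mu> (\<pi> ` E (l k @ [m]))]" for k
      by (simp add: l_def)
    have l: "length (l k) = k \<and> a < outer_measure_of \<mu> (\<pi> ` E (l k))" for k
    proof (induction k)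
      case 0
      have "\<pi> ` E [] = f ` B"
        unfolding C(2) E_def \<pi>_def by auto
      then show ?case
        using a by (simp add: l_def)
    next
      case (Suc k)
      then show ?case
        unfolding l_Suc using someI_ex[OF step, of "l k"] by simp
    qed
    define n where "n i = l (Suc i) ! i" for i
    have l_nth: "i < k \<Longrightarrow> l k ! i = n i" for i k
    proof (induction k)
      case (Suc k)
      then show ?case
        using l[of k] by (cases "i = k") (auto simp: n_def l_Suc nth_append)
    qed simp
    have En: "a < outer_measure_of \<mu> (\<pi> ` {p\<in>C. \<forall>i<k. g i p \<le> n i})" for k
      using l[of k] l_nth unfolding E_def by (auto cong: conj_cong)
    define K where "K = cball (0::'a) (real (n 0)) \<times> {\<sigma>. \<forall>i. \<sigma> i \<le> n (Suc i)}"
    have K: "compact K"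
      unfolding K_def by (intro compact_Times compact_cball compact_seq_le)
    then have H: "compact (fst ` (C \<inter> K))"
      by (intro compact_continuous_image continuous_on_fst continuous_on_id closed_Int_compact C(1))
    have le: "a \<le> emeasure \<mu> O'" if O': "open O'" "f ` fst ` (C \<inter> K) \<subseteq> O'" for O'
    proof -
      \<comment> \<open>Finitely many bounds do not give compactness, but their images shrink into
        every open neighbourhood of the image of the compact set; otherwise points
        \<open>P k\<close> obeying the first bounds and mapped outside \<open>O'\<close> would
        accumulate inside.\<close>
      have "\<exists>k. \<pi> ` {p\<in>C. \<forall>i<k. g i p \<le> n i} \<subseteq> O'"
      proof (rule ccontr)
        assume "\<not> ?thesis"
        then have "\<forall>k. \<exists>p. p \<in> C \<and> (\<forall>i<Suc k. g i p \<le> n i) \<and> \<pi> p \<notin> O'"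
          by blast
        then obtain P where P: "\<And>k. P k \<in> C" "\<And>k i. i < Suc k \<Longrightarrow> g i (P k) \<le> n i" "\<And>k. \<pi> (P k) \<notin> O'"
          by metis
        \<comment> \<open>Truncation enforces all bounds at once and so moves the points into the
          compact set \<open>K\<close>. Each entry is unchanged for all large \<open>k\<close>,
          hence the limit is also a limit of the original points.\<close>
        define Q where "Q k = (fst (P k), \<lambda>i. min (snd (P k) i) (n (Suc i)))" for k
        have "Q k \<in> K" for k
          using P(2)[of 0 k] by (auto simp: Q_def K_def g_def nat_le_iff ceiling_le_iff)
        then obtain p r where p: "p \<in> K" and r: "strict_mono (r::nat\<Rightarrow>nat)" "(Q \<circ> r) \<longlonglongrightarrow> p"
          using compact_imp_seq_compact[OF K] unfolding seq_compact_def by metis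
        have "(\<lambda>k. snd (P (r k)) i) \<longlonglongrightarrow> snd p i" for i
        proof -
          have "(\<lambda>k. snd ((Q \<circ> r) k) i) \<longlonglongrightarrow> snd p i"
            using continuous_on_tendsto_compose[OF continuous_on_product_coordinates tendsto_snd[OF r(2)]]
            by simp
          moreover have "\<forall>\<^sub>F k in sequentially. snd ((Q \<circ> r) k) i = snd (P (r k)) i"
            using eventually_gt_at_top[of i]
          proof eventually_elim
            case (elim k)
            then have "Suc i < Suc (r k)"
              using seq_suble[OF r(1), of k] by simp
            from P(2)[OF this] show ?case
              by (simp add: Q_def g_def)
          qed
          ultimately show ?thesis
            by (rule Lim_transform_eventually)
        qed
        then have "(\<lambda>k. snd (P (r k))) \<longlonglongrightarrow> snd p"
          by (rule tendsto_coordinatewise)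
        moreover have fst: "(\<lambda>k. fst (P (r k))) \<longlonglongrightarrow> fst p"
          using tendsto_fst[OF r(2)] by (simp add: Q_def)
        ultimately have "(\<lambda>k. P (r k)) \<longlonglongrightarrow> p"
          using tendsto_Pair[of "\<lambda>k. fst (P (r k))" "fst p" sequentially "\<lambda>k. snd (P (r k))" "snd p"]
          by simp
        then have "p \<in> C"
          by (rule Lim_in_closed_set[OF C(1) _ sequentially_bot, rotated]) (simp add: P(1))
        then have "\<pi> p \<in> O'"
          using O'(2) p unfolding \<pi>_def by blast
        moreover have "(\<lambda>k. \<pi> (P (r k))) \<longlonglongrightarrow> \<pi> p"
          unfolding \<pi>_def using continuous_on_tendsto_compose[OF cont fst] by simp
        ultimately have "\<forall>\<^sub>F k in sequentially. \<pi> (P (r k)) \<in> O'"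
          using O'(1) by (auto dest: topological_tendstoD)
        then show False
          using P(3) by simp
      qed
      then obtain k where "\<pi> ` {p\<in>C. \<forall>i<k. g i p \<le> n i} \<subseteq> O'" ..
      from order_trans[OF less_imp_le[OF En[of k]] outer_measure_of_mono[OF this]]
      have "a \<le> outer_measure_of \<mu> O'" .
      then show ?thesis
        using O'(1) sets by simp
    qed
    have comp: "compact (f ` fst ` (C \<inter> K))"
      by (rule compact_continuous_image[OF continuous_on_subset[OF cont] H]) simp
    \<comment> \<open>Outer regularity carries the bound from open neighbourhoods to the compact
      image itself, which is null by hypothesis.\<close>
    have "a \<le> (INF U \<in> {U. f ` fst ` (C \<inter> K) \<subseteq> U \<and> open U}. emeasure \<mu> U)"
      by (rule INF_greatest) (auto intro: le)
    also have "\<dots> = emeasure \<mu> (f ` fst ` (C \<inter> K))"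
      using comp by (intro outer_regular[symmetric] sets) (auto intro: borel_compact)
    also have "\<dots> = 0"
      using H C(2) by (intro null) auto
    finally show False
      using a by simp
  qed
  moreover obtain N where "N \<in> sets \<mu>" "f ` B \<subseteq> N" "outer_measure_of \<mu> (f ` B) = emeasure \<mu> N"
    using outer_measure_of_attain[of "f ` B" \<mu>] space by auto
  ultimately show thesis
    by (intro that[of N]) auto
qed

text \<open>A property that holds for all values of a parameter simultaneously may define a
  nonmeasurable set of points.  It nevertheless depends on the law of the random
  vector only.\<close>

lemma AE_all_transfer:
  fixes B :: "('p::euclidean_space \<times> 's::euclidean_space) set"
  assumes "prob_space M" and [measurable]: "\<xi> \<in> borel_measurable M" "\<eta> \<in> borel_measurable M"
    and "distr M borel \<eta> = distr M borel \<xi>"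
    and "B \<in> sets borel" and "AE \<omega> in M. \<forall>p. (p, \<xi> \<omega>) \<notin> B"
  shows "AE \<omega> in M. \<forall>p. (p, \<eta> \<omega>) \<notin> B"
proof -
  interpret prob_space M by fact
  interpret D: prob_space "distr M borel \<xi>"
    by (rule prob_space_distr) measurable
  obtain N where N: "N \<in> null_sets (distr M borel \<xi>)" "snd ` B \<subseteq> N"
  proof (rule null_set_continuous_image[where B = B and f = snd and \<mu> = "distr M borel \<xi>"])
    fix C assume C: "compact C" "C \<subseteq> B"
    have [measurable]: "snd ` C \<in> sets borel"
      by (intro borel_compact compact_continuous_image continuous_on_snd continuous_on_id C)
    \<comment> \<open>For compact parts of \<open>B\<close> the projection is compact, hence Borel,
      and the almost sure statement can be read as one about the law.\<close>
    have "AE \<omega> in M. \<xi> \<omega> \<notin> snd ` C"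
      using assms(6) by eventually_elim (use C in force)
    then have "AE s in distr M borel \<xi>. s \<notin> snd ` C"
      by (subst AE_distr_iff) auto
    then show "emeasure (distr M borel \<xi>) (snd ` C) = 0"
      by (subst (asm) AE_iff_measurable[of "snd ` C"]) auto
  qed (auto simp: assms D.finite_measure_axioms intro: continuous_on_snd)
  have [measurable]: "N \<in> sets borel"
    using N(1) by (simp add: null_sets_def)
  have "AE s in distr M borel \<eta>. s \<notin> N"
    unfolding assms(4) using N(1) by (rule AE_not_in)
  then have "AE \<omega> in M. \<eta> \<omega> \<notin> N"
    by (subst (asm) AE_distr_iff) auto
  then show ?thesis
    by eventually_elim (use N(2) in force)
qed

text \<open>A supremum over a countable dense subset of \<open>P\<close> is Borel in
  \<open>s\<close>. For almost every value of \<open>\<xi>\<close> continuity extends the bound to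
  all of \<open>P\<close>; since its failure at a value \<open>s\<close> is described by a Borel set
  of pairs, the extension passes to every \<open>\<eta>\<close> with the same law, although nothing
  is known beforehand about the continuity of \<open>R\<close> at values of
  \<open>\<eta>\<close>.\<close>

lemma uniform_majorant_transfer:
  fixes R :: "'p::euclidean_space \<Rightarrow> 's::euclidean_space \<Rightarrow> real"
  assumes "prob_space M" and [measurable]: "\<xi> \<in> borel_measurable M"
    and [measurable]: "P \<in> sets borel"
    and [measurable]: "(\<lambda>(p, s). R p s) \<in> borel_measurable borel"
    and bound: "AE \<omega> in M. continuous_on P (\<lambda>p. R p (\<xi> \<omega>)) \<and> (\<forall>p\<in>P. R p (\<xi> \<omega>) \<le> C \<omega>)"
  obtains c where "c \<in> borel_measurable borel" "\<And>s. 0 \<le> c s" "AE \<omega> in M. c (\<xi> \<omega>) \<le> max 0 (C \<omega>)"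
    "\<And>\<eta>. \<eta> \<in> borel_measurable M \<Longrightarrow> distr M borel \<eta> = distr M borel \<xi> \<Longrightarrow>
      AE \<omega> in M. \<forall>p\<in>P. R p (\<eta> \<omega>) \<le> c (\<eta> \<omega>)"
proof -
  obtain Q where Q: "countable Q" "Q \<subseteq> P" "P \<subseteq> closure Q"
    using separable by metis
  define c' where "c' s = (SUP p\<in>Q. ennreal (R p s))" for s
  have [measurable]: "(\<lambda>s. R p s) \<in> borel_measurable borel" for p
  proof -
    have "(\<lambda>s. (\<lambda>(p, s). R p s) (p, s)) \<in> borel_measurable borel"
      by measurable
    then show ?thesis by simp
  qed
  have [measurable]: "c' \<in> borel_measurable borel"
    unfolding c'_def using Q(1) by measurable
  \<comment> \<open>An infinite supremum counts as failure, because \<open>enn2real\<close> would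
    turn it into \<open>0\<close>.\<close>
  define B where "B = {(p, s). p \<in> P \<and> (c' s = \<top> \<or> c' s < ennreal (R p s))}"
  have [measurable]: "(\<lambda>x. R (fst x) (snd x)) \<in> borel_measurable (borel \<Otimes>\<^sub>M borel)"
    using assms(4) unfolding borel_prod by (simp add: case_prod_beta')
  have "B = {x \<in> space (borel \<Otimes>\<^sub>M borel). fst x \<in> P \<and> (c' (snd x) = \<top> \<or> c' (snd x) < ennreal (R (fst x) (snd x)))}"
    unfolding B_def by (auto simp: space_pair_measure)
  also have "\<dots> \<in> sets (borel \<Otimes>\<^sub>M borel)"
    by measurable
  finally have B: "B \<in> sets borel"
    unfolding borel_prod .
  have c'_le: "c' (\<xi> \<omega>) \<le> ennreal (C \<omega>)" if "\<forall>p\<in>P. R p (\<xi> \<omega>) \<le> C \<omega>" for \<omega>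
    unfolding c'_def using that Q(2) by (intro SUP_least ennreal_leI) auto
  have "AE \<omega> in M. \<forall>p. (p, \<xi> \<omega>) \<notin> B"
    using bound
  proof eventually_elim
    case (elim \<omega>)
    have fin: "c' (\<xi> \<omega>) < \<top>"
      using c'_le elim by (meson ennreal_less_top le_less_trans)
    have "R p (\<xi> \<omega>) \<le> enn2real (c' (\<xi> \<omega>))" if "p \<in> P" for p
    proof -
      obtain q where q: "\<And>n. q n \<in> Q" "q \<longlonglongrightarrow> p"
        using subsetD[OF Q(3) \<open>p \<in> P\<close>] unfolding closure_sequential by blast
      have "R (q n) (\<xi> \<omega>) \<le> enn2real (c' (\<xi> \<omega>))" for n
      proof -
        have "ennreal (R (q n) (\<xi> \<omega>)) \<le> c' (\<xi> \<omega>)"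
          unfolding c'_def by (rule SUP_upper) (rule q(1))
        then show ?thesis
          using fin by (cases "c' (\<xi> \<omega>)") (auto simp: ennreal_le_iff2)
      qed
      moreover have "(\<lambda>n. R (q n) (\<xi> \<omega>)) \<longlonglongrightarrow> R p (\<xi> \<omega>)"
        by (rule continuous_on_tendsto_compose[OF conjunct1[OF elim] q(2) that])
          (use q(1) Q(2) in \<open>auto intro!: always_eventually\<close>)
      ultimately show ?thesis
        by (intro LIMSEQ_le_const2) auto
    qed
    then have "ennreal (R p (\<xi> \<omega>)) \<le> c' (\<xi> \<omega>)" if "p \<in> P" for p
      using that fin by (metis ennreal_enn2real ennreal_leI)
    then show ?case
      using fin by (auto simp: B_def not_less)
  qed
  note transfer = AE_all_transfer[OF assms(1,2) _ _ B this]
  show thesis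
  proof (rule that[of "\<lambda>s. enn2real (c' s)"])
    show "AE \<omega> in M. enn2real (c' (\<xi> \<omega>)) \<le> max 0 (C \<omega>)"
      using bound
    proof eventually_elim
      case (elim \<omega>)
      then have "enn2real (c' (\<xi> \<omega>)) \<le> enn2real (ennreal (C \<omega>))"
        using c'_le by (intro enn2real_mono) auto
      then show ?case
        by (cases "C \<omega> \<ge> 0") (auto simp: ennreal_neg)
    qed
  next
    fix \<eta> assume \<eta>: "\<eta> \<in> borel_measurable M" "distr M borel \<eta> = distr M borel \<xi>"
    show "AE \<omega> in M. \<forall>p\<in>P. R p (\<eta> \<omega>) \<le> enn2real (c' (\<eta> \<omega>))"
      using transfer[OF \<eta>]
    proof eventually_elim
      case (elim \<omega>)
      show ?case
      proof
        fix p assume "p \<in> P"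
        then have "c' (\<eta> \<omega>) \<noteq> \<top>" "ennreal (R p (\<eta> \<omega>)) \<le> c' (\<eta> \<omega>)"
          using elim[rule_format, of p] by (auto simp: B_def)
        then show "R p (\<eta> \<omega>) \<le> enn2real (c' (\<eta> \<omega>))"
          by (cases "c' (\<eta> \<omega>)") (auto simp: ennreal_le_iff2)
      qed
    qed
  qed measurable
qed

section \<open>Convergence in distribution\<close>

text \<open>Real trigonometric polynomials. The free phase provides sines and constants, so no
  complex exponentials are needed.\<close>

inductive_set trig_sums :: "('a::euclidean_space \<Rightarrow> real) set" where
  cos: "(\<lambda>x. c * cos (t \<bullet> x + d)) \<in> trig_sums"
| add: "f \<in> trig_sums \<Longrightarrow> g \<in> trig_sums \<Longrightarrow> (\<lambda>x. f x + g x) \<in> trig_sums"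

lemma trig_sums_const: "(\<lambda>_. c) \<in> trig_sums"
  using trig_sums.cos[of c 0 0] by simp

lemma trig_sums_cos_mult:
  assumes "f \<in> trig_sums"
  shows "(\<lambda>x. (c * cos (t \<bullet> x + d)) * f x) \<in> trig_sums"
  using assms
proof induction
  case (cos c' t' d')
  have "(c * cos (t \<bullet> x + d)) * (c' * cos (t' \<bullet> x + d'))
      = (c * c' / 2) * cos ((t - t') \<bullet> x + (d - d')) + (c * c' / 2) * cos ((t + t') \<bullet> x + (d + d'))" for x
  proof -
    have "(t - t') \<bullet> x + (d - d') = (t \<bullet> x + d) - (t' \<bullet> x + d')"
      "(t + t') \<bullet> x + (d + d') = (t \<bullet> x + d) + (t' \<bullet> x + d')"
      by (simp_all add: inner_diff_left inner_add_left)
    moreover have "(c * a) * (c' * b) = c * c' * (a * b)" for a b :: real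
      by simp
    ultimately show ?thesis
      by (simp only: cos_times_cos) (simp add: field_simps)
  qed
  then show ?case
    by (simp only:) (intro trig_sums.intros)
next
  case (add f g)
  then show ?case
    by (simp only: distrib_left) (intro trig_sums.intros)
qed

lemma trig_sums_mult:
  assumes "f \<in> trig_sums" "g \<in> trig_sums"
  shows "(\<lambda>x. f x * g x) \<in> trig_sums"
  using assms(1)
proof induction
  case (cos c t d)
  then show ?case
    by (rule trig_sums_cos_mult[OF assms(2)])
next
  case (add f1 f2)
  then show ?case
    by (simp only: distrib_right) (intro trig_sums.intros)
qed

lemma trig_sums_continuous: "f \<in> trig_sums \<Longrightarrow> continuous_on A f"
  by (induction rule: trig_sums.induct) (auto intro!: continuous_intros)

lemma trig_sums_bounded:
  assumes "f \<in> trig_sums"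
  obtains B where "\<And>x. \<bar>f x\<bar> \<le> B"
proof -
  have "\<exists>B. \<forall>x. \<bar>f x\<bar> \<le> B"
    using assms
  proof induction
    case (cos c t d)
    have "\<bar>c * cos (t \<bullet> x + d)\<bar> \<le> \<bar>c\<bar> * 1" for x
      unfolding abs_mult by (intro mult_left_mono abs_cos_le_one) auto
    then show ?case by blast
  next
    case (add f g)
    then obtain B1 B2 where "\<And>x. \<bar>f x\<bar> \<le> B1" "\<And>x. \<bar>g x\<bar> \<le> B2" by blast
    then have "\<bar>f x + g x\<bar> \<le> B1 + B2" for x
      by (meson abs_triangle_ineq add_mono order_trans)
    then show ?case by blast
  qed
  then show thesis using that by blast
qed

lemma trig_sums_polynomial:
  fixes q :: "real \<Rightarrow> real"
  assumes "real_polynomial_function q" "f \<in> trig_sums"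
  shows "(\<lambda>x. q (f x)) \<in> trig_sums"
  using assms(1)
proof induction
  case (linear q)
  have "q (f x) = f x * q 1" for x
    using linear_scale[OF bounded_linear.linear[OF linear], of "f x" 1] by simp
  then show ?case
    using trig_sums_mult[OF assms(2) trig_sums_const[of "q 1"]] by simp
next
  case (const c)
  show ?case by (rule trig_sums_const)
next
  case (add q1 q2)
  then show ?case by (intro trig_sums.intros)
next
  case (mult q1 q2)
  then show ?case by (intro trig_sums_mult)
qed

text \<open>The global bound is obtained by composing an approximation on \<open>S\<close> with a polynomial that
  approximates the truncation at height \<open>c\<close>.\<close>

lemma trig_sums_approx:
  fixes \<phi> :: "'a::euclidean_space \<Rightarrow> real"
  assumes "compact S" "continuous_on S \<phi>" "\<And>x. \<bar>\<phi> x\<bar> \<le> c" "e > 0"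
  obtains p where "p \<in> trig_sums" "\<And>x. x \<in> S \<Longrightarrow> \<bar>\<phi> x - p x\<bar> < e" "\<And>x. \<bar>p x\<bar> < c + e"
proof -
  have c: "c \<ge> 0"
    using assms(3)[of 0] by linarith
  interpret function_ring_on trig_sums S
  proof
    fix x y :: 'a assume "x \<noteq> y"
    \<comment> \<open>Scaled so that \<open>t \<bullet> (x - y)\<close> equals \<open>pi\<close>:
      with phase \<open>- (t \<bullet> y)\<close> the cosine is \<open>-1\<close> at
      \<open>x\<close> and \<open>1\<close> at \<open>y\<close>.\<close>
    define t where "t = (pi / (norm (x - y))\<^sup>2) *\<^sub>R (x - y)"
    have "t \<bullet> (x - y) = pi"
      using \<open>x \<noteq> y\<close> unfolding t_def by (simp add: power2_norm_eq_inner)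
    then have "t \<bullet> x - t \<bullet> y = pi"
      by (simp add: inner_diff_right)
    then have "1 * cos (t \<bullet> x + (- (t \<bullet> y))) \<noteq> 1 * cos (t \<bullet> y + (- (t \<bullet> y)))"
      by simp
    then show "\<exists>f\<in>trig_sums. f x \<noteq> f y"
      by (intro bexI[of _ "\<lambda>x. 1 * cos (t \<bullet> x + (- (t \<bullet> y)))"] trig_sums.cos)
  qed (auto intro: assms trig_sums_continuous trig_sums.add trig_sums_mult trig_sums_const)
  obtain g where g: "g \<in> trig_sums" "\<And>x. x \<in> S \<Longrightarrow> \<bar>\<phi> x - g x\<bar> < e / 2"
    using Stone_Weierstrass_basic[OF assms(2), of "e / 2"] assms(4) by auto
  obtain B where B: "\<And>x. \<bar>g x\<bar> \<le> B"
    using trig_sums_bounded[OF g(1)] by blast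
  define \<kappa> where "\<kappa> u = max (- c) (min c u)" for u :: real
  have "continuous_on {-B..B} \<kappa>"
    unfolding \<kappa>_def by (intro continuous_intros)
  then obtain q where q: "real_polynomial_function q" "\<And>u. u \<in> {-B..B} \<Longrightarrow> \<bar>\<kappa> u - q u\<bar> < e / 2"
    using Stone_Weierstrass_real_polynomial_function[of "{-B..B}" \<kappa> "e / 2"] assms(4)
    by (metis compact_Icc half_gt_zero)
  have qg: "\<bar>\<kappa> (g x) - q (g x)\<bar> < e / 2" for x
    using B[of x] by (intro q(2)) (auto simp: abs_le_iff)
  show thesis
  proof (rule that[OF trig_sums_polynomial[OF q(1) g(1)]])
    fix x
    show "\<bar>q (g x)\<bar> < c + e"
    proof -
      have "\<bar>\<kappa> (g x)\<bar> \<le> c"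
        using c by (auto simp: \<kappa>_def abs_le_iff)
      then show ?thesis
        using qg[of x] assms(4) by linarith
    qed
    assume "x \<in> S"
    show "\<bar>\<phi> x - q (g x)\<bar> < e"
    proof -
      \<comment> \<open>Truncation at the height of \<open>\<phi>\<close> never increases the
        distance to \<open>\<phi>\<close>.\<close>
      have "\<bar>\<phi> x - \<kappa> (g x)\<bar> \<le> \<bar>\<phi> x - g x\<bar>"
        using assms(3)[of x] c unfolding \<kappa>_def by linarith
      then show ?thesis
        using qg[of x] g(2)[OF \<open>x \<in> S\<close>] by linarith
    qed
  qed
qed

section \<open>Tightness and the cosine criterion\<close>

lemma (in prob_space) expectation_approx:
  fixes X :: "'a \<Rightarrow> 'b::real_normed_vector" and \<phi> p :: "'b \<Rightarrow> real"
  assumes [measurable]: "X \<in> borel_measurable M" "\<phi> \<in> borel_measurable borel" "p \<in> borel_measurable borel"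
    and \<phi>: "\<And>x. \<bar>\<phi> x\<bar> \<le> c" and p: "\<And>x. \<bar>p x\<bar> \<le> c + 1" and "e \<ge> 0"
    and approx: "\<And>x. norm x \<le> R \<Longrightarrow> \<bar>\<phi> x - p x\<bar> \<le> e"
  shows "\<bar>expectation (\<lambda>\<omega>. \<phi> (X \<omega>)) - expectation (\<lambda>\<omega>. p (X \<omega>))\<bar>
    \<le> e + (2 * c + 1) * prob {\<omega>\<in>space M. norm (X \<omega>) > R}"
proof -
  let ?A = "{\<omega>\<in>space M. norm (X \<omega>) > R}"
  have c: "c \<ge> 0"
    using \<phi>[of 0] by linarith
  have int: "integrable M (\<lambda>\<omega>. \<phi> (X \<omega>))" "integrable M (\<lambda>\<omega>. p (X \<omega>))"
    using \<phi> p by (auto intro!: integrable_const_bound[where B="c + 1"] AE_I2 order_trans[OF \<phi>])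
  have "\<bar>expectation (\<lambda>\<omega>. \<phi> (X \<omega>)) - expectation (\<lambda>\<omega>. p (X \<omega>))\<bar>
      = \<bar>expectation (\<lambda>\<omega>. \<phi> (X \<omega>) - p (X \<omega>))\<bar>"
    using int by simp
  \<comment> \<open>Outside the ball the bounds \<open>c\<close> of \<open>\<phi>\<close> and
    \<open>c + 1\<close> of \<open>p\<close> add up to \<open>2 * c + 1\<close>.\<close>
  also have "\<dots> \<le> expectation (\<lambda>\<omega>. \<bar>\<phi> (X \<omega>) - p (X \<omega>)\<bar>)"
    by (rule integral_abs_bound)
  also have "\<dots> \<le> expectation (\<lambda>\<omega>. e + (2 * c + 1) * indicator ?A \<omega>)"
  proof (rule integral_mono)
    show "integrable M (\<lambda>\<omega>. e + (2 * c + 1) * indicator ?A \<omega>)"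
      by (intro Bochner_Integration.integrable_add integrable_mult_right integrable_real_indicator)
        (auto simp: emeasure_eq_measure)
    fix \<omega> assume "\<omega> \<in> space M"
    then show "\<bar>\<phi> (X \<omega>) - p (X \<omega>)\<bar> \<le> e + (2 * c + 1) * indicator ?A \<omega>"
      using approx[of "X \<omega>"] \<phi>[of "X \<omega>"] p[of "X \<omega>"] \<open>e \<ge> 0\<close>
      by (auto simp: indicator_def)
  qed (use int in auto)
  also have "\<dots> = e + (2 * c + 1) * prob ?A"
    by (subst Bochner_Integration.integral_add) (auto simp: prob_space emeasure_eq_measure intro!: integrable_real_indicator)
  finally show ?thesis .
qed

lemma (in prob_space) norm_tight:
  fixes Y :: "'a \<Rightarrow> 'b::real_normed_vector"
  assumes [measurable]: "Y \<in> borel_measurable M" and "e > 0"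
  obtains R where "prob {\<omega>\<in>space M. norm (Y \<omega>) > R} \<le> e"
proof -
  let ?A = "\<lambda>n::nat. {\<omega>\<in>space M. norm (Y \<omega>) > real n}"
  have "(\<lambda>n. prob (?A n)) \<longlonglongrightarrow> prob (\<Inter>n. ?A n)"
    by (rule finite_Lim_measure_decseq) (auto simp: decseq_def)
  moreover have "(\<Inter>n. ?A n) = {}"
    using real_nat_ceiling_ge by (auto simp flip: not_le)
  ultimately have "(\<lambda>n. prob (?A n)) \<longlonglongrightarrow> 0"
    by simp
  then have "\<forall>\<^sub>F n in sequentially. prob (?A n) < e"
    by (rule order_tendstoD) fact
  then obtain n where "prob (?A n) < e"
    by (auto simp: eventually_sequentially)
  then show thesis
    using that less_imp_le by blast
qed

text \<open>The continuity theorem for characteristic functions, with tightness as a hypothesis: on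
  a large ball the test function is replaced by a trigonometric polynomial, whose global bound makes
  the mass outside the ball harmless.\<close>

lemma conv_in_distribution_cosI:
  fixes X :: "nat \<Rightarrow> 'w \<Rightarrow> 'a::euclidean_space" and Y :: "'v \<Rightarrow> 'a"
  assumes "prob_space M" "prob_space N"
    and X[measurable]: "\<And>n. X n \<in> borel_measurable M" and Y[measurable]: "Y \<in> borel_measurable N"
    and cos: "\<And>t d. (\<lambda>n. \<integral>\<omega>. cos (t \<bullet> X n \<omega> + d) \<partial>M) \<longlonglongrightarrow> (\<integral>\<omega>. cos (t \<bullet> Y \<omega> + d) \<partial>N)"
    and tight: "\<And>e. e > 0 \<Longrightarrow> \<exists>R. \<forall>\<^sub>F n in sequentially. measure M {\<omega>\<in>space M. norm (X n \<omega>) > R} \<le> e"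
  shows "conv_in_distribution M X N Y"
  unfolding conv_in_distribution_def
proof (intro conjI allI impI X Y)
  interpret M: prob_space M by fact
  interpret N: prob_space N by fact
  have trig: "(\<lambda>n. \<integral>\<omega>. p (X n \<omega>) \<partial>M) \<longlonglongrightarrow> (\<integral>\<omega>. p (Y \<omega>) \<partial>N)" if "p \<in> trig_sums" for p
    using that
  proof induction
    case (cos c t d)
    have "(\<lambda>n. c * (\<integral>\<omega>. cos (t \<bullet> X n \<omega> + d) \<partial>M)) \<longlonglongrightarrow> c * (\<integral>\<omega>. cos (t \<bullet> Y \<omega> + d) \<partial>N)"
      by (intro tendsto_intros assms(5))
    then show ?case by simp
  next
    case (add f g)
    have int: "integrable M (\<lambda>\<omega>. h (X n \<omega>))" "integrable N (\<lambda>\<omega>. h (Y \<omega>))" if h: "h \<in> trig_sums" for h n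
    proof -
      have [measurable]: "h \<in> borel_measurable borel"
        by (intro borel_measurable_continuous_onI trig_sums_continuous h)
      obtain B where "\<And>x. \<bar>h x\<bar> \<le> B"
        using trig_sums_bounded[OF h] by blast
      then show "integrable M (\<lambda>\<omega>. h (X n \<omega>))" "integrable N (\<lambda>\<omega>. h (Y \<omega>))"
        by (auto intro!: M.integrable_const_bound[where B=B] N.integrable_const_bound[where B=B])
    qed
    show ?case
      using tendsto_add[OF add.IH] int add.hyps by simp
  qed
  fix \<phi> :: "'a \<Rightarrow> real" assume \<phi>: "continuous_on UNIV \<phi> \<and> bounded (range \<phi>)"
  then have [measurable]: "\<phi> \<in> borel_measurable borel"
    by (intro borel_measurable_continuous_onI) auto
  obtain c where c: "\<And>x. \<bar>\<phi> x\<bar> \<le> c"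
    using \<phi> by (auto simp: bounded_iff)
  have c0: "c \<ge> 0"
    using c[of 0] by linarith
  show "(\<lambda>n. \<integral>\<omega>. \<phi> (X n \<omega>) \<partial>M) \<longlonglongrightarrow> (\<integral>\<omega>. \<phi> (Y \<omega>) \<partial>N)"
  proof (rule tendstoI)
    fix e :: real assume "e > 0"
    \<comment> \<open>Replacing \<open>\<phi>\<close> costs
      \<open>e' + (2 * c + 1) * \<eta>\<close>, at most \<open>e / 4\<close>, for \<open>X n\<close>
      and again for \<open>Y\<close>; comparing the trigonometric polynomials costs
      \<open>e / 8\<close>.\<close>
    define \<eta> where "\<eta> = e / (8 * (2 * c + 1))"
    define e' where "e' = min 1 (e / 8)"
    have \<eta>: "\<eta> > 0" "(2 * c + 1) * \<eta> = e / 8" and e': "e' > 0" "e' \<le> 1" "e' \<le> e / 8"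
      using \<open>e > 0\<close> c0 by (auto simp: \<eta>_def e'_def field_simps)
    obtain R1 where R1: "\<forall>\<^sub>F n in sequentially. M.prob {\<omega>\<in>space M. norm (X n \<omega>) > R1} \<le> \<eta>"
      using tight[OF \<eta>(1)] by blast
    obtain R2 where R2: "N.prob {\<omega>\<in>space N. norm (Y \<omega>) > R2} \<le> \<eta>"
      using N.norm_tight[OF Y \<eta>(1)] by blast
    obtain p where p: "p \<in> trig_sums" "\<And>x. x \<in> cball 0 (max R1 R2) \<Longrightarrow> \<bar>\<phi> x - p x\<bar> < e'"
      "\<And>x. \<bar>p x\<bar> < c + e'"
      using trig_sums_approx[of "cball 0 (max R1 R2)" \<phi> c e'] \<phi> c e'(1)
      by (metis compact_cball continuous_on_subset subset_UNIV)
    have [measurable]: "p \<in> borel_measurable borel"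
      by (intro borel_measurable_continuous_onI trig_sums_continuous p)
    have pc: "\<bar>p x\<bar> \<le> c + 1" for x
      using p(3)[of x] e' by linarith
    have approx: "\<bar>\<phi> x - p x\<bar> \<le> e'" if "norm x \<le> R1 \<or> norm x \<le> R2" for x
      using p(2)[of x] that by (auto simp: le_max_iff_disj intro: less_imp_le)
    have EY: "\<bar>(\<integral>\<omega>. \<phi> (Y \<omega>) \<partial>N) - (\<integral>\<omega>. p (Y \<omega>) \<partial>N)\<bar> \<le> e' + (2 * c + 1) * \<eta>"
      by (rule order_trans[OF N.expectation_approx[where R = R2 and e = e' and c = c]])
        (use c pc approx e' R2 c0 in \<open>auto intro!: mult_left_mono\<close>)
    have "\<forall>\<^sub>F n in sequentially. dist (\<integral>\<omega>. p (X n \<omega>) \<partial>M) (\<integral>\<omega>. p (Y \<omega>) \<partial>N) < e / 8"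
      using trig[OF p(1)] \<open>e > 0\<close> by (intro tendstoD) auto
    with R1 show "\<forall>\<^sub>F n in sequentially. dist (\<integral>\<omega>. \<phi> (X n \<omega>) \<partial>M) (\<integral>\<omega>. \<phi> (Y \<omega>) \<partial>N) < e"
    proof eventually_elim
      case (elim n)
      have "\<bar>(\<integral>\<omega>. \<phi> (X n \<omega>) \<partial>M) - (\<integral>\<omega>. p (X n \<omega>) \<partial>M)\<bar> \<le> e' + (2 * c + 1) * \<eta>"
        by (rule order_trans[OF M.expectation_approx[where R = R1 and e = e' and c = c]])
          (use c pc approx e' elim c0 in \<open>auto intro!: mult_left_mono\<close>)
      then show ?case
        using EY elim(2) e' \<eta>(2) \<open>e > 0\<close> unfolding dist_real_def by linarith
    qed
  qed
qed

section \<open>The central limit theorem tested on cosines\<close>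

lemma integral_normal_law_cos:
  assumes "v > 0"
  shows "(\<integral>u. cos (u + d) \<partial>normal_law 0 v) = (\<integral>u. cos (sqrt v * u + d) \<partial>std_normal_distribution)"
proof -
  define \<sigma> where "\<sigma> = sqrt v"
  have \<sigma>: "\<sigma> > 0" using assms by (simp add: \<sigma>_def)
  have "(\<integral>u. cos (u + d) \<partial>normal_law 0 v) = (\<integral>u. normal_density 0 \<sigma> u * cos (u + d) \<partial>lborel)"
    using assms by (simp add: normal_law_def \<sigma>_def integral_density)
  also have "\<dots> = \<sigma> * (\<integral>u. normal_density 0 \<sigma> (\<sigma> * u) * cos (\<sigma> * u + d) \<partial>lborel)"
    using \<sigma> by (subst lborel_integral_real_affine[where c = \<sigma> and t = 0]) auto
  also have "\<dots> = (\<integral>u. \<sigma> * (normal_density 0 \<sigma> (\<sigma> * u) * cos (\<sigma> * u + d)) \<partial>lborel)"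
    by simp
  also have "\<dots> = (\<integral>u. std_normal_density u * cos (\<sigma> * u + d) \<partial>lborel)"
    using \<sigma> by (intro Bochner_Integration.integral_cong)
      (auto simp: normal_density_def std_normal_density_def real_sqrt_mult power_mult_distrib)
  also have "\<dots> = (\<integral>u. cos (\<sigma> * u + d) \<partial>std_normal_distribution)"
    by (simp add: integral_density)
  finally show ?thesis
    by (simp add: \<sigma>_def)
qed

text \<open>The central limit theorem is applied for positive variance. For \<open>v = 0\<close>
  almost surely all \<open>V i\<close> vanish, which matches the point mass in
  \<open>normal_law\<close>.\<close>

lemma (in prob_space) clt_cos:
  fixes V :: "nat \<Rightarrow> 'a \<Rightarrow> real"
  assumes indep: "indep_vars (\<lambda>_. borel) V UNIV"
    and distr: "\<And>n. distr M borel (V n) = \<mu>"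
    and mean: "\<And>n. expectation (V n) = 0"
    and int: "\<And>n. integrable M (\<lambda>\<omega>. (V n \<omega>)\<^sup>2)"
    and var: "\<And>n. expectation (\<lambda>\<omega>. (V n \<omega>)\<^sup>2) = v"
  shows "(\<lambda>n. expectation (\<lambda>\<omega>. cos ((\<Sum>i<n. V i \<omega>) / sqrt (real n) + d)))
    \<longlonglongrightarrow> (\<integral>u. cos (u + d) \<partial>normal_law 0 v)"
proof -
  have [measurable]: "V n \<in> borel_measurable M" for n
    using indep by (auto simp: indep_vars_def2)
  have "v \<ge> 0"
    unfolding var[of 0, symmetric] by (rule Bochner_Integration.integral_nonneg) simp
  show ?thesis
  proof (cases "v = 0")
    case True
    have "AE \<omega> in M. \<forall>i. (V i \<omega>)\<^sup>2 = 0"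
      unfolding AE_all_countable using int var True
      by (auto simp: integral_nonneg_eq_0_iff_AE)
    then have "expectation (\<lambda>\<omega>. cos ((\<Sum>i<n. V i \<omega>) / sqrt (real n) + d)) = expectation (\<lambda>_. cos d)" for n
      by (intro integral_cong_AE) (auto elim!: eventually_mono)
    then show ?thesis
      using True by (simp add: normal_law_def integral_return prob_space)
  next
    case False
    with \<open>v \<ge> 0\<close> have v: "v > 0" by simp
    then have "sqrt v > 0" by simp
    have "weak_conv_m (\<lambda>n. distr M borel (\<lambda>x. (\<Sum>i<n. V i x) / sqrt (n * (sqrt v)\<^sup>2))) std_normal_distribution"
      by (rule central_limit_theorem_zero_mean[OF indep mean \<open>sqrt v > 0\<close> int _ distr])
        (use v mean var in simp)
    then have "(\<lambda>n. \<integral>u. cos (sqrt v * u + d) \<partial>distr M borel (\<lambda>x. (\<Sum>i<n. V i x) / sqrt (n * (sqrt v)\<^sup>2)))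
        \<longlonglongrightarrow> (\<integral>u. cos (sqrt v * u + d) \<partial>std_normal_distribution)"
      by (rule weak_conv_imp_integral_bdd_continuous_conv[where B=1, rotated 2])
        (auto intro!: real_distribution_distr real_dist_normal_dist continuous_intros)
    moreover have "(\<integral>u. cos (sqrt v * u + d) \<partial>distr M borel (\<lambda>x. (\<Sum>i<n. V i x) / sqrt (n * (sqrt v)\<^sup>2)))
        = expectation (\<lambda>\<omega>. cos ((\<Sum>i<n. V i \<omega>) / sqrt (real n) + d))" for n
      using v by (subst integral_distr) (auto simp: real_sqrt_mult field_simps)
    ultimately show ?thesis
      by (simp add: integral_normal_law_cos[OF v])
  qed
qed

section \<open>Maps with Lipschitz derivative\<close>

text \<open>Cauchy-Schwarz row by row; the norm of \<open>A\<close> is the Frobenius norm.\<close>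

lemma norm_matrix_vector_mult_le:
  fixes A :: "real^'n^'m"
  shows "norm (A *v x) \<le> norm A * norm x"
proof (rule power2_le_imp_le)
  have sq: "(norm v)\<^sup>2 = (\<Sum>i\<in>UNIV. (norm (v $ i))\<^sup>2)" for v :: "'b::real_inner^'c"
    by (simp add: power2_norm_eq_inner inner_vec_def)
  have "(norm (A *v x))\<^sup>2 = (\<Sum>i\<in>UNIV. (A $ i \<bullet> x)\<^sup>2)"
    by (simp add: sq matrix_vector_mul_component)
  also have "\<dots> \<le> (\<Sum>i\<in>UNIV. (norm (A $ i) * norm x)\<^sup>2)"
    by (intro sum_mono) (metis Cauchy_Schwarz_ineq2 abs_le_square_iff abs_mult abs_norm_cancel)
  also have "\<dots> = (norm A * norm x)\<^sup>2"
    by (simp add: power_mult_distrib sq[of A] sum_distrib_right)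
  finally show "(norm (A *v x))\<^sup>2 \<le> (norm A * norm x)\<^sup>2" .
qed simp

lemma bounded_linear_matrix_vector_mul: "bounded_linear ((*v) A)" for A :: "real^'n^'m"
  by (simp add: linear_linear flip: linear_conv_bounded_linear)

lemma jacobian_eqI:
  fixes g :: "real^'n \<Rightarrow> real^'m"
  assumes "(g has_derivative (*v) A) (at x)"
  shows "jacobian g (at x) = A"
  unfolding jacobian_def by (simp flip: frechet_derivative_at[OF assms])

text \<open>Unlike \<^const>\<open>jacobian\<close>, which is an arbitrary choice where there is no derivative, this
  is always a Borel function of the point and of a parameter of the map.\<close>

definition limit_jacobian :: "(real^'n \<Rightarrow> real^'m) \<Rightarrow> real^'n \<Rightarrow> real^'n^'m" where
  "limit_jacobian g x =
     (\<chi> i j. lim (\<lambda>k. real (Suc k) *\<^sub>R (g (x + (1 / real (Suc k)) *\<^sub>R axis j 1) - g x)) $ i)"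

lemma limit_jacobian_eqI:
  fixes g :: "real^'n \<Rightarrow> real^'m"
  assumes "(g has_derivative (*v) A) (at x)"
  shows "limit_jacobian g x = A"
proof -
  have "(\<lambda>k. real (Suc k) *\<^sub>R (g (x + (1 / real (Suc k)) *\<^sub>R axis j 1) - g x)) \<longlonglongrightarrow> A *v axis j 1" for j
  proof -
    define h where "h k = (1 / real (Suc k)) *\<^sub>R (axis j 1 :: real^'n)" for k
    have h0: "h \<longlonglongrightarrow> 0"
      using tendsto_scaleR[OF LIMSEQ_inverse_real_of_nat tendsto_const, of "axis j 1 :: real^'n"]
      unfolding h_def by (simp add: inverse_eq_divide)
    have "filterlim h (at 0) sequentially"
      unfolding filterlim_at using h0 by (auto simp: h_def axis_eq_0_iff)
    moreover have "((\<lambda>h. norm (g (x + h) - g x - A *v h) / norm h) \<longlongrightarrow> 0) (at 0)"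
      using assms by (simp add: has_derivative_at)
    ultimately have "(\<lambda>k. norm (g (x + h k) - g x - A *v h k) / norm (h k)) \<longlonglongrightarrow> 0"
      by (rule filterlim_compose[rotated])
    moreover have "norm (g (x + h k) - g x - A *v h k) / norm (h k)
      = norm (real (Suc k) *\<^sub>R (g (x + h k) - g x) - A *v axis j 1)" for k
    proof -
      have "real (Suc k) *\<^sub>R (g (x + h k) - g x) - A *v axis j 1 = real (Suc k) *\<^sub>R (g (x + h k) - g x - A *v h k)"
        by (simp add: h_def scaleR_diff_right matrix_vector_mult_scaleR)
      then show ?thesis
        by (simp add: h_def)
    qed
    ultimately have "(\<lambda>k. real (Suc k) *\<^sub>R (g (x + h k) - g x) - A *v axis j 1) \<longlonglongrightarrow> 0"
      by (simp add: tendsto_norm_zero_iff)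
    then show ?thesis
      unfolding h_def by (simp add: LIM_zero_iff)
  qed
  then have "lim (\<lambda>k. real (Suc k) *\<^sub>R (g (x + (1 / real (Suc k)) *\<^sub>R axis j 1) - g x)) = A *v axis j 1" for j
    by (rule limI)
  then show ?thesis
    unfolding limit_jacobian_def by (simp add: matrix_vector_mult_basis column_def vec_eq_iff)
qed

lemma borel_measurable_vecI:
  fixes f :: "'a \<Rightarrow> ('b::euclidean_space)^'n"
  assumes "\<And>i. (\<lambda>x. f x $ i) \<in> borel_measurable M"
  shows "f \<in> borel_measurable M"
proof (rule borel_measurable_euclidean_space[THEN iffD2], rule ballI)
  fix b :: "'b^'n" assume "b \<in> Basis"
  then obtain i u where b: "b = axis i u"
    by (auto simp: Basis_vec_def)
  have "(\<lambda>x. f x $ i \<bullet> u) \<in> borel_measurable M"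
    by (intro borel_measurable_inner assms borel_measurable_const)
  then show "(\<lambda>x. f x \<bullet> b) \<in> borel_measurable M"
    by (simp add: b inner_axis)
qed

lemma borel_measurable_limit_jacobian:
  fixes G :: "real^'n \<Rightarrow> 's::euclidean_space \<Rightarrow> real^'m"
  assumes G: "(\<lambda>(x, s). G x s) \<in> borel_measurable borel"
    and [measurable]: "x \<in> borel_measurable M" "s \<in> borel_measurable M"
  shows "(\<lambda>\<omega>. limit_jacobian (\<lambda>y. G y (s \<omega>)) (x \<omega>)) \<in> borel_measurable M"
proof -
  have [measurable]: "(\<lambda>\<omega>. G (y \<omega>) (s \<omega>)) \<in> borel_measurable M" if [measurable]: "y \<in> borel_measurable M" for y
    using measurable_compose[of "\<lambda>\<omega>. (y \<omega>, s \<omega>)" M borel "\<lambda>(x, s). G x s" borel] G by simp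
  show ?thesis
    unfolding limit_jacobian_def
    by (intro borel_measurable_vecI) (simp add: cart_eq_inner_axis[of "lim _"])
qed

text \<open>The points are required to lie in a common ball inside \<open>D\<close>, as \<open>D\<close> need not be convex.\<close>

definition C11_bound :: "(real^'n \<Rightarrow> real^'m) \<Rightarrow> real \<Rightarrow> (real^'n) set \<Rightarrow> bool" where
  "C11_bound g c D \<longleftrightarrow> (\<forall>y r. ball y r \<subseteq> D \<longrightarrow> (\<forall>x\<in>ball y r. \<forall>x'\<in>ball y r.
     norm (g x' - g x - limit_jacobian g x *v (x' - x)) \<le> c * (norm (x' - x))\<^sup>2 \<and>
     norm (limit_jacobian g x' - limit_jacobian g x) \<le> c * norm (x' - x)))"

lemma has_derivative_quadratic:
  fixes g :: "'a::real_normed_vector \<Rightarrow> 'b::real_normed_vector"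
  assumes "bounded_linear A" "\<rho> > 0"
    and bound: "\<And>x'. x' \<in> ball x \<rho> \<Longrightarrow> norm (g x' - g x - A (x' - x)) \<le> c * (norm (x' - x))\<^sup>2"
  shows "(g has_derivative A) (at x)"
proof (rule has_derivativeI_sandwich[of \<rho> _ _ _ _ "\<lambda>x'. c * norm (x' - x)"])
  show "((\<lambda>x'. c * norm (x' - x)) \<longlongrightarrow> 0) (at x)"
    by (auto intro!: tendsto_eq_intros)
  fix y assume "y \<noteq> x" "dist y x < \<rho>"
  then show "norm (g y - g x - A (y - x)) / norm (y - x) \<le> c * norm (y - x)"
    using bound[of y] by (simp add: divide_simps power2_eq_square dist_commute mult.assoc)
qed (use assms in auto)

text \<open>The quadratic remainder forces differentiability, so \<open>C11_bound\<close> can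
  consist of inequalities between Borel functions and say nothing about derivatives.\<close>

lemma C11_bound_has_derivative:
  assumes "C11_bound g c D" "open D" "x \<in> D"
  shows "(g has_derivative (*v) (limit_jacobian g x)) (at x)"
proof -
  obtain \<rho> where \<rho>: "\<rho> > 0" "ball x \<rho> \<subseteq> D"
    using assms(2,3) openE by blast
  show ?thesis
    by (rule has_derivative_quadratic[OF bounded_linear_matrix_vector_mul \<rho>(1), of _ _ _ c])
      (use assms(1) \<rho> in \<open>auto simp: C11_bound_def\<close>)
qed

lemma C11_bound_jacobian:
  assumes "C11_bound g c D" "open D" "x \<in> D"
  shows "jacobian g (at x) = limit_jacobian g x"
  by (rule jacobian_eqI[OF C11_bound_has_derivative[OF assms]])

lemma C11_bound_average:
  fixes g :: "nat \<Rightarrow> real^'n \<Rightarrow> real^'m"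
  assumes g: "\<And>i. i \<in> I \<Longrightarrow> C11_bound (g i) (c i) D" and "open D"
    and f: "\<And>x. x \<in> D \<Longrightarrow> f x = a *\<^sub>R (\<Sum>i\<in>I. g i x)" and "a \<ge> 0"
  shows "C11_bound f (a * (\<Sum>i\<in>I. c i)) D"
    and "x \<in> D \<Longrightarrow> limit_jacobian f x = a *\<^sub>R (\<Sum>i\<in>I. limit_jacobian (g i) x)"
proof -
  show J: "limit_jacobian f x = a *\<^sub>R (\<Sum>i\<in>I. limit_jacobian (g i) x)" if "x \<in> D" for x
  proof (rule limit_jacobian_eqI)
    have "((\<lambda>x. a *\<^sub>R (\<Sum>i\<in>I. g i x)) has_derivative (\<lambda>h. a *\<^sub>R (\<Sum>i\<in>I. limit_jacobian (g i) x *v h))) (at x)"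
      by (intro has_derivative_scaleR_right has_derivative_sum C11_bound_has_derivative[OF g] that assms)
    moreover have "(\<lambda>h. a *\<^sub>R (\<Sum>i\<in>I. limit_jacobian (g i) x *v h)) = (*v) (a *\<^sub>R (\<Sum>i\<in>I. limit_jacobian (g i) x))"
      by (induction I rule: infinite_finite_induct)
        (auto simp: fun_eq_iff scaleR_matrix_vector_assoc matrix_vector_mult_add_rdistrib scaleR_add_right)
    ultimately show "(f has_derivative (*v) (a *\<^sub>R (\<Sum>i\<in>I. limit_jacobian (g i) x))) (at x)"
      using has_derivative_transform_within_open[OF _ \<open>open D\<close> that, of _ _ UNIV f] f by simp
  qed
  show "C11_bound f (a * (\<Sum>i\<in>I. c i)) D"
    unfolding C11_bound_def
  proof (intro allI impI ballI conjI)
    fix y r x x' assume "ball y r \<subseteq> D" "x \<in> ball y r" "x' \<in> ball y r"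
    then have xD: "x \<in> D" "x' \<in> D" by auto
    have gi: "norm (g i x' - g i x - limit_jacobian (g i) x *v (x' - x)) \<le> c i * (norm (x' - x))\<^sup>2"
      "norm (limit_jacobian (g i) x' - limit_jacobian (g i) x) \<le> c i * norm (x' - x)" if "i \<in> I" for i
      using g[OF that] \<open>ball y r \<subseteq> D\<close> \<open>x \<in> ball y r\<close> \<open>x' \<in> ball y r\<close> unfolding C11_bound_def by blast+
    have "(a *\<^sub>R (\<Sum>i\<in>I. limit_jacobian (g i) x)) *v h = a *\<^sub>R (\<Sum>i\<in>I. limit_jacobian (g i) x *v h)" for h
      by (induction I rule: infinite_finite_induct)
        (auto simp: scaleR_matrix_vector_assoc matrix_vector_mult_add_rdistrib scaleR_add_right)
    then have "f x' - f x - limit_jacobian f x *v (x' - x)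
        = a *\<^sub>R (\<Sum>i\<in>I. g i x' - g i x - limit_jacobian (g i) x *v (x' - x))"
      by (simp add: f xD J sum_subtractf scaleR_diff_right)
    also have "norm \<dots> \<le> a * (\<Sum>i\<in>I. c i * (norm (x' - x))\<^sup>2)"
      using \<open>a \<ge> 0\<close> by (auto intro!: mult_left_mono order_trans[OF norm_sum] sum_mono gi)
    finally show "norm (f x' - f x - limit_jacobian f x *v (x' - x)) \<le> a * sum c I * (norm (x' - x))\<^sup>2"
      by (simp add: sum_distrib_right mult.assoc)
    have "limit_jacobian f x' - limit_jacobian f x
        = a *\<^sub>R (\<Sum>i\<in>I. limit_jacobian (g i) x' - limit_jacobian (g i) x)"
      by (simp add: xD J sum_subtractf scaleR_diff_right)
    also have "norm \<dots> \<le> a * (\<Sum>i\<in>I. c i * norm (x' - x))"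
      using \<open>a \<ge> 0\<close> by (auto intro!: mult_left_mono order_trans[OF norm_sum] sum_mono gi)
    finally show "norm (limit_jacobian f x' - limit_jacobian f x) \<le> a * sum c I * norm (x' - x)"
      by (simp add: sum_distrib_right mult.assoc)
  qed
qed

section \<open>Borel moduli for random maps with Lipschitz derivative\<close>

lemma Lipschitz_jacobian_remainder:
  fixes g :: "real^'n \<Rightarrow> real^'m"
  assumes "convex U" "\<And>x. x \<in> U \<Longrightarrow> g differentiable (at x)"
    and lip: "\<And>x x'. x \<in> U \<Longrightarrow> x' \<in> U \<Longrightarrow> norm (jacobian g (at x) - jacobian g (at x')) \<le> c * norm (x - x')"
    and x: "x \<in> U" "x' \<in> U" and "c \<ge> 0"
  shows "norm (g x' - g x - jacobian g (at x) *v (x' - x)) \<le> c * (norm (x' - x))\<^sup>2"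
proof -
  have sub: "closed_segment x x' \<subseteq> U"
    using assms(1) x by (simp add: closed_segment_subset)
  \<comment> \<open>The mean value inequality for the deviation from the linearization at
    \<open>x\<close>; it gives \<open>c\<close> in place of the sharp \<open>c / 2\<close>.\<close>
  have "norm (g x' - g x - jacobian g (at x) *v (x' - x)) \<le> norm (x' - x) * (c * norm (x' - x))"
  proof (rule differentiable_bound_linearization[where S="closed_segment x x'" and f' = "\<lambda>y. (*v) (jacobian g (at y))" and ?x0.0 = x])
    fix t :: real assume "t \<in> {0..1}"
    then show "x + t *\<^sub>R (x' - x) \<in> closed_segment x x'"
      by (auto simp: in_segment algebra_simps intro!: exI[of _ t])
  next
    fix y assume "y \<in> closed_segment x x'"
    then have "y \<in> U" using sub by auto
    then show "(g has_derivative (*v) (jacobian g (at y))) (at y within closed_segment x x')"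
      using assms(2) jacobian_works has_derivative_at_withinI by blast
    have "norm (jacobian g (at y) *v h - jacobian g (at x) *v h) \<le> (c * norm (x' - x)) * norm h" for h
    proof -
      have "norm (jacobian g (at y) *v h - jacobian g (at x) *v h) \<le> norm (jacobian g (at y) - jacobian g (at x)) * norm h"
        by (metis matrix_vector_mult_diff_rdistrib norm_matrix_vector_mult_le)
      also have "\<dots> \<le> (c * norm (y - x)) * norm h"
        by (intro mult_right_mono lip \<open>y \<in> U\<close> x) simp
      also have "\<dots> \<le> (c * norm (x' - x)) * norm h"
        using segment_bound1[OF \<open>y \<in> closed_segment x x'\<close>] \<open>c \<ge> 0\<close>
        by (intro mult_right_mono mult_left_mono) auto
      finally show ?thesis .
    qed
    then show "onorm ((*v) (jacobian g (at y)) - (*v) (jacobian g (at x))) \<le> c * norm (x' - x)"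
      by (intro onorm_le) simp
  qed simp
  then show ?thesis
    by (simp add: power2_eq_square ac_simps)
qed

lemma bounded_bilinear_matrix_vector_mult:
  "bounded_bilinear ((*v) :: real^'n^'m \<Rightarrow> real^'n \<Rightarrow> real^'m)"
proof
  show "\<exists>K. \<forall>(A :: real^'n^'m) x. norm (A *v x) \<le> norm A * norm x * K"
    using norm_matrix_vector_mult_le by (intro exI[of _ 1]) auto
qed (auto simp: matrix_vector_mult_add_rdistrib matrix_vector_right_distrib
    matrix_vector_mult_scaleR scaleR_matrix_vector_assoc)

lemmas continuous_on_matrix_vector_mult =
  bounded_bilinear.continuous_on[OF bounded_bilinear_matrix_vector_mult]

lemma borel_measurable_matrix_vector_mult:
  fixes A :: "'a \<Rightarrow> real^'n^'m"
  assumes "A \<in> borel_measurable M" "h \<in> borel_measurable M"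
  shows "(\<lambda>\<omega>. A \<omega> *v h \<omega>) \<in> borel_measurable M"
  using assms by (rule borel_measurable_continuous_Pair)
    (intro continuous_on_matrix_vector_mult continuous_on_fst continuous_on_snd continuous_on_id)

text \<open>\<open>R\<close> adds up the two quotients whose boundedness is
  \<open>C11_bound\<close>, so that a single supremum yields a common constant. Each quotient is at
  most the positive part of \<open>C\<close>, hence the factor 2.\<close>

lemma C11_majorant:
  fixes G :: "real^'n \<Rightarrow> 's::euclidean_space \<Rightarrow> real^'m"
  assumes "prob_space M" and \<xi>: "\<xi> \<in> borel_measurable M" and "open D"
    and G: "(\<lambda>(x, s). G x s) \<in> borel_measurable borel"
    and C1: "AE \<omega> in M. C1_on (\<lambda>x. G x (\<xi> \<omega>)) D"
    and lip: "AE \<omega> in M. \<forall>x\<in>D. \<forall>x'\<in>D. norm (jacobian (\<lambda>y. G y (\<xi> \<omega>)) (at x)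
      - jacobian (\<lambda>y. G y (\<xi> \<omega>)) (at x')) \<le> C \<omega> * norm (x - x')"
  obtains c where "c \<in> borel_measurable borel" "\<And>s. 0 \<le> c s" "AE \<omega> in M. c (\<xi> \<omega>) \<le> 2 * max 0 (C \<omega>)"
    "\<And>\<eta>. \<eta> \<in> borel_measurable M \<Longrightarrow> distr M borel \<eta> = distr M borel \<xi> \<Longrightarrow>
      AE \<omega> in M. C11_bound (\<lambda>x. G x (\<eta> \<omega>)) (c (\<eta> \<omega>)) D"
proof -
  define J where "J x s = limit_jacobian (\<lambda>y. G y s) x" for x s
  \<comment> \<open>The parameter of the family is a pair of points. Without the diagonal the
    quotients are continuous, and the set of pairs is still open, hence Borel.\<close>
  define P where "P = \<Union>{ball y r \<times> ball y r | y r. ball y r \<subseteq> D} - {p. fst p = snd p}"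
  define R where "R p s = norm (G (snd p) s - G (fst p) s - J (fst p) s *v (snd p - fst p)) / (norm (snd p - fst p))\<^sup>2
    + norm (J (snd p) s - J (fst p) s) / norm (snd p - fst p)" for p s
  have PD: "fst p \<in> D" "snd p \<in> D" "fst p \<noteq> snd p" if "p \<in> P" for p
    using that by (auto simp: P_def)
  have P_irrefl: "(x, x) \<notin> P" for x
    by (simp add: P_def)
  have "open P"
    unfolding P_def
    by (intro open_Diff open_Union closed_Collect_eq continuous_intros) (auto intro: open_Times)
  then have "P \<in> sets borel"
    by simp
  have R: "(\<lambda>(p, s). R p s) \<in> borel_measurable borel"
  proof -
    have [measurable]: "(\<lambda>x :: ((real^'n) \<times> (real^'n)) \<times> 's. fst (fst x)) \<in> borel_measurable borel"
      "(\<lambda>x :: ((real^'n) \<times> (real^'n)) \<times> 's. snd (fst x)) \<in> borel_measurable borel"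
      "(\<lambda>x :: ((real^'n) \<times> (real^'n)) \<times> 's. snd x) \<in> borel_measurable borel"
      by (intro borel_measurable_continuous_onI continuous_intros)+
    have [measurable]: "(\<lambda>x. G (y x) (t x)) \<in> borel_measurable borel"
      if [measurable]: "y \<in> borel_measurable borel" "t \<in> borel_measurable borel" for y t
      using measurable_compose[of "\<lambda>x. (y x, t x)" borel borel "\<lambda>(x, s). G x s" borel] G by simp
    note [measurable] = borel_measurable_limit_jacobian[OF G] borel_measurable_matrix_vector_mult
    show ?thesis
      unfolding R_def J_def case_prod_beta by measurable
  qed
  have bound: "AE \<omega> in M. continuous_on P (\<lambda>p. R p (\<xi> \<omega>)) \<and> (\<forall>p\<in>P. R p (\<xi> \<omega>) \<le> 2 * max 0 (C \<omega>))"
    using C1 lip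
  proof eventually_elim
    case (elim \<omega>)
    define g where "g x = G x (\<xi> \<omega>)" for x
    have diff: "g differentiable (at x)" if "x \<in> D" for x
      using elim(1) that by (simp add: C1_on_def g_def[abs_def])
    have J: "J x (\<xi> \<omega>) = jacobian g (at x)" if "x \<in> D" for x
      unfolding J_def using limit_jacobian_eqI[of g] diff[OF that] jacobian_works
      by (auto simp: g_def[abs_def])
    have contJ: "continuous_on D (\<lambda>x. J x (\<xi> \<omega>))"
      using elim(1) by (simp add: C1_on_def J g_def[abs_def] cong: continuous_on_cong)
    have contg: "continuous_on D g"
      using diff by (intro continuous_at_imp_continuous_on ballI differentiable_imp_continuous_within)
    have "continuous_on P (\<lambda>p. R p (\<xi> \<omega>))"
      unfolding R_def g_def[symmetric] using PD(1,2)
      by (intro continuous_intros continuous_on_matrix_vector_mult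
          continuous_on_compose2[OF contg] continuous_on_compose2[OF contJ])
        (auto simp: P_irrefl)
    moreover have "R p (\<xi> \<omega>) \<le> 2 * max 0 (C \<omega>)" if "p \<in> P" for p
    proof -
      define B where "B = max 0 (C \<omega>)"
      obtain y r where yr: "ball y r \<subseteq> D" "fst p \<in> ball y r" "snd p \<in> ball y r"
        using \<open>p \<in> P\<close> by (auto simp: P_def)
      have lip': "norm (jacobian g (at x) - jacobian g (at x')) \<le> B * norm (x - x')"
        if "x \<in> ball y r" "x' \<in> ball y r" for x x'
      proof -
        have "norm (jacobian g (at x) - jacobian g (at x')) \<le> C \<omega> * norm (x - x')"
          using elim(2) that yr(1) unfolding g_def[abs_def] by blast
        also have "\<dots> \<le> B * norm (x - x')"
          by (intro mult_right_mono) (auto simp: B_def)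
        finally show ?thesis .
      qed
      have n: "norm (snd p - fst p) > 0"
        using PD(3)[OF \<open>p \<in> P\<close>] by simp
      have "norm (g (snd p) - g (fst p) - jacobian g (at (fst p)) *v (snd p - fst p)) \<le> B * (norm (snd p - fst p))\<^sup>2"
        by (rule Lipschitz_jacobian_remainder[where U="ball y r"])
          (use yr diff lip' in \<open>auto simp: B_def\<close>)
      moreover have "norm (J (snd p) (\<xi> \<omega>) - J (fst p) (\<xi> \<omega>)) \<le> B * norm (snd p - fst p)"
        using lip' yr PD[OF \<open>p \<in> P\<close>] by (simp add: J)
      ultimately have "R p (\<xi> \<omega>) \<le> B + B"
        unfolding R_def g_def[symmetric] using n PD[OF \<open>p \<in> P\<close>]
        by (intro add_mono) (simp_all add: J pos_divide_le_eq)
      then show ?thesis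
        by (simp add: B_def)
    qed
    ultimately show ?case by blast
  qed
  show thesis
  proof (rule uniform_majorant_transfer[OF \<open>prob_space M\<close> \<xi> \<open>P \<in> sets borel\<close> R bound], rule that)
    fix c
    assume "c \<in> borel_measurable borel" "\<And>s. 0 \<le> c s" and c: "AE \<omega> in M. c (\<xi> \<omega>) \<le> max 0 (2 * max 0 (C \<omega>))"
      "\<And>\<eta>. \<eta> \<in> borel_measurable M \<Longrightarrow> distr M borel \<eta> = distr M borel \<xi> \<Longrightarrow>
        AE \<omega> in M. \<forall>p\<in>P. R p (\<eta> \<omega>) \<le> c (\<eta> \<omega>)"
    then show "c \<in> borel_measurable borel" "\<And>s. 0 \<le> c s"
      by auto
    show "AE \<omega> in M. c (\<xi> \<omega>) \<le> 2 * max 0 (C \<omega>)"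
      using c(1) by simp
    fix \<eta> assume "\<eta> \<in> borel_measurable M" "distr M borel \<eta> = distr M borel \<xi>"
    from c(2)[OF this] show "AE \<omega> in M. C11_bound (\<lambda>x. G x (\<eta> \<omega>)) (c (\<eta> \<omega>)) D"
    proof eventually_elim
      case (elim \<omega>)
      show ?case
        unfolding C11_bound_def
      proof (intro allI impI ballI)
        fix y r x x' assume xr: "ball y r \<subseteq> D" "x \<in> ball y r" "x' \<in> ball y r"
        show "norm (G x' (\<eta> \<omega>) - G x (\<eta> \<omega>) - limit_jacobian (\<lambda>x. G x (\<eta> \<omega>)) x *v (x' - x))
            \<le> c (\<eta> \<omega>) * (norm (x' - x))\<^sup>2 \<and>
          norm (limit_jacobian (\<lambda>x. G x (\<eta> \<omega>)) x' - limit_jacobian (\<lambda>x. G x (\<eta> \<omega>)) x)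
            \<le> c (\<eta> \<omega>) * norm (x' - x)"
        proof (cases "x = x'")
          case False
          have "(x, x') \<in> \<Union>{ball y r \<times> ball y r | y r. ball y r \<subseteq> D}"
            using xr by (intro UnionI[of "ball y r \<times> ball y r"]) blast+
          with False have "(x, x') \<in> P"
            by (simp add: P_def)
          then have R: "R (x, x') (\<eta> \<omega>) \<le> c (\<eta> \<omega>)"
            using elim by blast
          have "norm (G x' (\<eta> \<omega>) - G x (\<eta> \<omega>) - J x (\<eta> \<omega>) *v (x' - x)) / (norm (x' - x))\<^sup>2 \<le> c (\<eta> \<omega>)"
            "norm (J x' (\<eta> \<omega>) - J x (\<eta> \<omega>)) / norm (x' - x) \<le> c (\<eta> \<omega>)"
            using R unfolding R_def fst_conv snd_conv
            by (smt (verit) divide_nonneg_nonneg norm_ge_zero zero_le_power2)+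
          then show ?thesis
            using False by (simp add: J_def pos_divide_le_eq)
        qed simp
      qed
    qed
  qed
qed

section \<open>The normal map near a reference point\<close>

locale normal_map_point =
  fixes S D :: "(real^'q) set" and x0 z0 :: "real^'q" and L :: "real^'q^'q"
  assumes S: "polyhedron S" "S \<noteq> {}" and D: "open D" "x0 \<in> D" and z0: "closest_point S z0 = x0"
    and homeo: "\<exists>g. homeomorphism UNIV UNIV
      (\<lambda>h. L *v closest_point (critical_cone S x0 (z0 - x0)) h + h
        - closest_point (critical_cone S x0 (z0 - x0)) h) g"
begin

definition K where "K = critical_cone S x0 (z0 - x0)"

definition LK where "LK h = L *v closest_point K h + h - closest_point K h"

lemma x0_in_S: "x0 \<in> S"
  using closest_point_in_set[OF polyhedron_imp_closed[OF S(1)] S(2), of z0] by (simp add: z0)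

lemma K: "closed K" "convex K" "0 \<in> K" "\<And>w t. w \<in> K \<Longrightarrow> t > 0 \<Longrightarrow> t *\<^sub>R w \<in> K"
  unfolding K_def using critical_cone_closed_convex[OF S(1) x0_in_S] zero_in_critical_cone[OF x0_in_S]
  by (auto intro: critical_cone_scaleR)

lemma continuous_on_closest_point_K: "continuous_on A (closest_point K)"
  using K by (intro continuous_on_closest_point) auto

lemma continuous_on_LK: "continuous_on A LK"
  unfolding LK_def
  by (intro continuous_intros continuous_on_matrix_vector_mult continuous_on_closest_point_K)

text \<open>\<open>LK\<close> is continuous, positively homogeneous and injective with value
  \<open>0\<close> at \<open>0\<close>, so its norm has a positive minimum on the unit
  sphere.\<close>

lemma LK_lower_bound:
  obtains m where "m > 0" "\<And>h. m * norm h \<le> norm (LK h)"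
proof -
  obtain g where g: "homeomorphism UNIV UNIV LK g"
    using homeo unfolding K_def[symmetric] LK_def[abs_def] by blast
  have LK0: "LK 0 = 0"
    using closest_point_self[OF K(3)] by (simp add: LK_def)
  have LK_scale: "LK (t *\<^sub>R h) = t *\<^sub>R LK h" if "t > 0" for t h
    unfolding LK_def using closest_point_cone_scaleR[OF K that]
    by (simp add: matrix_vector_mult_scaleR scaleR_diff_right scaleR_add_right)
  have LK_inj: "LK h \<noteq> 0" if "h \<noteq> 0" for h
    using g that LK0 unfolding homeomorphism_def by (metis UNIV_I)
  obtain u where u: "u \<in> sphere 0 1" "\<And>h. h \<in> sphere 0 1 \<Longrightarrow> norm (LK u) \<le> norm (LK h)"
    using continuous_attains_inf[of "sphere 0 1" "\<lambda>h. norm (LK h)"]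
      continuous_on_norm[OF continuous_on_LK] by auto
  show thesis
  proof (rule that[of "norm (LK u)"])
    show "norm (LK u) > 0"
      using LK_inj[of u] u(1) by (cases "u = 0") auto
    fix h
    show "norm (LK u) * norm h \<le> norm (LK h)"
    proof (cases "h = 0")
      case False
      then have "norm (LK u) \<le> norm (LK ((1 / norm h) *\<^sub>R h))"
        by (intro u(2)) simp
      then show ?thesis
        using False by (simp add: LK_scale divide_simps)
    qed simp
  qed
qed

text \<open>A zero \<open>z0 + h\<close> of the normal map of \<open>f\<close> is a fixed point of
  \<open>h \<mapsto> LK\<^sup>-\<^sup>1 (L \<Pi>\<^sub>K h - f (x0 + \<Pi>\<^sub>K h) - (z0 - x0))\<close>, to which Brouwer's theorem
  applies on a small ball.\<close>

lemma perturbation: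
  obtains r m where "r > 0" "m > 0"
    "\<And>f c \<delta>. \<lbrakk>C11_bound f c D; 0 < \<delta>; \<delta> \<le> r; 0 \<le> c; c * \<delta> \<le> m / 4;
        norm (limit_jacobian f x0 - L) \<le> m / 4; norm (f x0 + (z0 - x0)) \<le> m * \<delta> / 2\<rbrakk> \<Longrightarrow>
      \<exists>z. norm (z - z0) \<le> \<delta> \<and> closest_point S z \<in> D \<and> normal_map S f z = 0"
    "\<And>f c \<delta> z. \<lbrakk>C11_bound f c D; 0 < \<delta>; \<delta> \<le> r; 0 \<le> c; c * \<delta> \<le> m / 4;
        norm (limit_jacobian f x0 - L) \<le> m / 4; norm (z - z0) \<le> \<delta>; normal_map S f z = 0\<rbrakk> \<Longrightarrow>
      norm (z - z0) \<le> 2 / m * norm (f x0 + (z0 - x0)) \<and>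
      norm (LK (z - z0) + normal_map_deriv S f z (z0 - z))
        \<le> (norm (limit_jacobian f x0 - L) + c * norm (z - z0)) * norm (z - z0) \<and>
      norm (f x0 + (z0 - x0) - normal_map_deriv S f z (z0 - z))
        \<le> 2 * (norm (limit_jacobian f x0 - L) + c * norm (z - z0)) * norm (z - z0)"
proof -
  obtain g where g: "homeomorphism UNIV UNIV LK g"
    using homeo unfolding K_def[symmetric] LK_def[abs_def] by blast
  obtain m where m: "m > 0" "\<And>h. m * norm h \<le> norm (LK h)"
    using LK_lower_bound by blast
  obtain r1 where r1: "r1 > 0" "\<And>h. norm h \<le> r1 \<Longrightarrow> closest_point S (z0 + h) = x0 + closest_point K h"
    using closest_point_polyhedron_local[OF S, of z0] unfolding z0 K_def by blast
  obtain r2 where r2: "r2 > 0" "ball x0 r2 \<subseteq> D"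
    using D openE by blast
  \<comment> \<open>Half of \<open>r2\<close> keeps \<open>x0 + closest_point K h\<close> in the
    open ball inside \<open>D\<close> on which \<open>C11_bound\<close> compares points.\<close>
  define r where "r = min r1 (r2 / 2)"
  have r: "r > 0" "r \<le> r1" "r < r2"
    using r1(1) r2(1) by (auto simp: r_def)
  have Pi_le: "norm (closest_point K h) \<le> norm h" for h
    by (rule norm_closest_point_le[OF K(1-3)])
  have Pi_in: "x0 + closest_point K h \<in> ball x0 r2" if "norm h \<le> r" for h
    using Pi_le[of h] that r(3) by (simp add: dist_norm)
  have rem: "norm (f (x0 + closest_point K h) - f x0 - L *v closest_point K h)
      \<le> (norm (limit_jacobian f x0 - L) + c * norm h) * norm h"
    "norm (f (x0 + closest_point K h) - f x0 - limit_jacobian f x0 *v closest_point K h)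
      \<le> c * norm h * norm h"
    "norm (limit_jacobian f (x0 + closest_point K h) - L) \<le> norm (limit_jacobian f x0 - L) + c * norm h"
    if f: "C11_bound f c D" "0 \<le> c" and h: "norm h \<le> r" for f c h
  proof -
    let ?k = "closest_point K h"
    have x0: "x0 \<in> ball x0 r2"
      using r2(1) by simp
    have "norm (f (x0 + ?k) - f x0 - limit_jacobian f x0 *v ?k) \<le> c * (norm ?k)\<^sup>2"
      and J: "norm (limit_jacobian f (x0 + ?k) - limit_jacobian f x0) \<le> c * norm ?k"
      using f(1)[unfolded C11_bound_def, rule_format, OF r2(2) x0 Pi_in[OF h]] by simp_all
    moreover have "c * (norm ?k)\<^sup>2 \<le> c * norm h * norm h"
      using Pi_le[of h] f(2) by (simp add: power2_eq_square mult.assoc mult_left_mono mult_mono)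
    ultimately show 1: "norm (f (x0 + ?k) - f x0 - limit_jacobian f x0 *v ?k) \<le> c * norm h * norm h"
      by linarith
    have 2: "norm ((limit_jacobian f x0 - L) *v ?k) \<le> norm (limit_jacobian f x0 - L) * norm h"
      by (rule order_trans[OF norm_matrix_vector_mult_le]) (intro mult_left_mono Pi_le norm_ge_zero)
    have eq: "f (x0 + ?k) - f x0 - L *v ?k
      = (f (x0 + ?k) - f x0 - limit_jacobian f x0 *v ?k) + (limit_jacobian f x0 - L) *v ?k"
      by (simp add: matrix_vector_mult_diff_rdistrib)
    show "norm (f (x0 + ?k) - f x0 - L *v ?k) \<le> (norm (limit_jacobian f x0 - L) + c * norm h) * norm h"
      unfolding eq distrib_right by (rule norm_triangle_le) (use 1 2 in linarith)
    have "c * norm ?k \<le> c * norm h"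
      using Pi_le f(2) by (rule mult_left_mono)
    then show "norm (limit_jacobian f (x0 + ?k) - L) \<le> norm (limit_jacobian f x0 - L) + c * norm h"
      using J norm_triangle_ineq[of "limit_jacobian f x0 - L" "limit_jacobian f (x0 + ?k) - limit_jacobian f x0"]
      by simp
  qed
  show thesis
  proof (rule that[OF r(1) m(1)])
    fix f c \<delta>
    assume f: "C11_bound f c D" and \<delta>: "0 < \<delta>" "\<delta> \<le> r" and c: "0 \<le> c" "c * \<delta> \<le> m / 4"
      and A: "norm (limit_jacobian f x0 - L) \<le> m / 4" and e: "norm (f x0 + (z0 - x0)) \<le> m * \<delta> / 2"
    define \<Psi> where "\<Psi> h = g (L *v closest_point K h - f (x0 + closest_point K h) - (z0 - x0))" for h
    have contf: "continuous_on D f"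
      using C11_bound_has_derivative[OF f D(1)]
      by (intro continuous_at_imp_continuous_on ballI has_derivative_continuous) blast
    have "(\<lambda>h. x0 + closest_point K h) ` cball 0 \<delta> \<subseteq> D"
      using Pi_in r2(2) \<delta>(2) by fastforce
    then have "continuous_on (cball 0 \<delta>) (\<lambda>h. f (x0 + closest_point K h))"
      by (intro continuous_on_compose2[OF contf] continuous_on_add continuous_on_const
          continuous_on_closest_point_K)
    then have cont: "continuous_on (cball 0 \<delta>) (\<lambda>h. L *v closest_point K h - f (x0 + closest_point K h) - (z0 - x0))"
      by (intro continuous_on_diff continuous_on_const continuous_on_matrix_vector_mult
          continuous_on_closest_point_K)
    have "continuous_on UNIV g"
      using g by (simp add: homeomorphism_def)
    then have "continuous_on (cball 0 \<delta>) \<Psi>"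
      unfolding \<Psi>_def by (rule continuous_on_compose2[OF _ cont]) simp
    moreover have "\<Psi> \<in> cball 0 \<delta> \<rightarrow> cball 0 \<delta>"
    proof
      fix h :: "real^'q" assume h: "h \<in> cball 0 \<delta>"
      then have hr: "norm h \<le> r" "norm h \<le> \<delta>"
        using \<delta> by auto
      \<comment> \<open>\<open>LK\<close> undoes \<open>g\<close>, so the lower bound for
        \<open>LK\<close> becomes an upper bound for \<open>\<Psi>\<close>.\<close>
      have "m * norm (\<Psi> h) \<le> norm (L *v closest_point K h - f (x0 + closest_point K h) - (z0 - x0))"
        using m(2)[of "\<Psi> h"] g unfolding \<Psi>_def homeomorphism_def by simp
      also have "\<dots> = norm ((f (x0 + closest_point K h) - f x0 - L *v closest_point K h) + (f x0 + (z0 - x0)))"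
        by (subst norm_minus_cancel[symmetric]) (simp add: algebra_simps)
      also have "\<dots> \<le> (norm (limit_jacobian f x0 - L) + c * norm h) * norm h + m * \<delta> / 2"
        by (rule order_trans[OF norm_triangle_ineq]) (intro add_mono rem(1)[OF f c(1) hr(1)] e)
      \<comment> \<open>The derivative error and \<open>c * norm h\<close> contribute
        \<open>m / 4\<close> each, the residual at \<open>x0\<close> the other half of
        \<open>m * \<delta>\<close>.\<close>
      also have "\<dots> \<le> (m / 4 + m / 4) * \<delta> + m * \<delta> / 2"
      proof -
        have "c * norm h \<le> m / 4"
          using mult_left_mono[OF hr(2) c(1)] c(2) by linarith
        then show ?thesis
          using A hr(2) c(1) m(1) by (intro add_mono mult_mono) auto
      qed
      finally show "\<Psi> h \<in> cball 0 \<delta>"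
        using m(1) by (simp add: field_simps)
    qed
    ultimately obtain h where h: "h \<in> cball 0 \<delta>" "\<Psi> h = h"
      using brouwer[of "cball 0 \<delta>" \<Psi>] \<delta>(1) by auto
    have hr: "norm h \<le> r" "norm h \<le> r1"
      using h(1) \<delta>(2) r(2) by auto
    have "LK h = L *v closest_point K h - f (x0 + closest_point K h) - (z0 - x0)"
      using g h(2) unfolding \<Psi>_def homeomorphism_def by (metis UNIV_I)
    then have "normal_map S f (z0 + h) = 0"
      unfolding normal_map_def r1(2)[OF hr(2)] LK_def by (simp add: algebra_simps)
    moreover have "closest_point S (z0 + h) \<in> D"
      using Pi_in[OF hr(1)] r2(2) r1(2)[OF hr(2)] by auto
    ultimately show "\<exists>z. norm (z - z0) \<le> \<delta> \<and> closest_point S z \<in> D \<and> normal_map S f z = 0"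
      using h(1) by (intro exI[of _ "z0 + h"]) auto
  next
    fix f c \<delta> z
    assume f: "C11_bound f c D" and \<delta>: "0 < \<delta>" "\<delta> \<le> r" and c: "0 \<le> c" "c * \<delta> \<le> m / 4"
      and A: "norm (limit_jacobian f x0 - L) \<le> m / 4"
      and z: "norm (z - z0) \<le> \<delta>" "normal_map S f z = 0"
    define h where "h = z - z0"
    define k where "k = closest_point K h"
    define e where "e = f x0 + (z0 - x0)"
    define b where "b = norm (limit_jacobian f x0 - L) + c * norm h"
    have hr: "norm h \<le> r" "norm h \<le> r1" "norm h \<le> \<delta>" and zh: "z = z0 + h"
      using z(1) \<delta>(2) r(2) by (auto simp: h_def)
    have Pz: "closest_point S z = x0 + k"
      unfolding zh k_def by (rule r1(2)[OF hr(2)])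
    have xD: "x0 + k \<in> D"
      using Pi_in[OF hr(1)] r2(2) by (auto simp: k_def)
    have eq: "f (x0 + k) + (z0 - x0) + h - k = 0"
      using z(2) unfolding normal_map_def Pz by (simp add: zh algebra_simps)
    then have LKh: "LK h + e = - (f (x0 + k) - f x0 - L *v k)"
      unfolding LK_def e_def k_def[symmetric] by (simp add: algebra_simps eq_neg_iff_add_eq_0)
    have LKe: "norm (LK h + e) \<le> b * norm h"
      unfolding LKh norm_minus_cancel b_def k_def by (rule rem(1)[OF f c(1) hr(1)])
    \<comment> \<open>Half of the lower bound \<open>m * norm h\<close> absorbs the remainder, which
      leaves the factor \<open>2 / m\<close>.\<close>
    have "b \<le> m / 4 + m / 4"
      unfolding b_def using A mult_left_mono[OF hr(3) c(1)] c(2) by linarith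
    then have "b * norm h \<le> m / 2 * norm h"
      by (intro mult_right_mono) auto
    moreover have "m * norm h \<le> norm (LK h)"
      by (rule m(2))
    moreover have "norm (LK h) \<le> norm (LK h + e) + norm e"
      using norm_triangle_ineq4[of "LK h + e" e] by simp
    ultimately have "m / 2 * norm h \<le> norm e"
      using LKe by linarith
    then have h_le: "norm h \<le> 2 / m * norm e"
      using m(1) by (simp add: field_simps)
    have "B_derivative (closest_point S) (z0 + h) (- h) = - k"
      unfolding k_def K_def
      using B_derivative_closest_point_towards[OF S, of r1 z0 h] r1(2) hr(2) by (simp add: z0 K_def)
    then have deriv: "normal_map_deriv S f z (z0 - z) = - (limit_jacobian f (x0 + k) *v k) - h + k"
      unfolding normal_map_deriv_def Pz C11_bound_jacobian[OF f D(1) xD]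
      by (simp add: zh bounded_bilinear.minus_right[OF bounded_bilinear_matrix_vector_mult])
    have Jk: "norm ((limit_jacobian f (x0 + k) - L) *v k) \<le> b * norm h"
    proof -
      have "norm ((limit_jacobian f (x0 + k) - L) *v k) \<le> norm (limit_jacobian f (x0 + k) - L) * norm k"
        by (rule norm_matrix_vector_mult_le)
      also have "\<dots> \<le> b * norm h"
        unfolding b_def k_def using c(1) by (intro mult_mono rem(3)[OF f c(1) hr(1)] Pi_le) auto
      finally show ?thesis .
    qed
    have "LK h + normal_map_deriv S f z (z0 - z) = - ((limit_jacobian f (x0 + k) - L) *v k)"
      unfolding deriv LK_def k_def[symmetric] by (simp add: matrix_vector_mult_diff_rdistrib)
    then have T1: "norm (LK h + normal_map_deriv S f z (z0 - z)) \<le> b * norm h"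
      using Jk by simp
    \<comment> \<open>Both \<open>e\<close> and the derivative term are compared with
      \<open>LK h\<close>, at cost \<open>b * norm h\<close> each; hence the factor 2 in the last
      estimate.\<close>
    have "e - normal_map_deriv S f z (z0 - z) = (LK h + e) - (LK h + normal_map_deriv S f z (z0 - z))"
      by simp
    then have "norm (e - normal_map_deriv S f z (z0 - z)) \<le> b * norm h + b * norm h"
      using norm_triangle_ineq4[of "LK h + e" "LK h + normal_map_deriv S f z (z0 - z)"] LKe T1 by simp
    then show "norm (z - z0) \<le> 2 / m * norm (f x0 + (z0 - x0)) \<and>
      norm (LK (z - z0) + normal_map_deriv S f z (z0 - z))
        \<le> (norm (limit_jacobian f x0 - L) + c * norm (z - z0)) * norm (z - z0) \<and>
      norm (f x0 + (z0 - x0) - normal_map_deriv S f z (z0 - z))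
        \<le> 2 * (norm (limit_jacobian f x0 - L) + c * norm (z - z0)) * norm (z - z0)"
      using h_le T1 unfolding h_def[symmetric] b_def[symmetric] e_def[symmetric] by simp
  qed
qed

lemma normal_map_deriv_eq_LK:
  assumes "jacobian f (at x0) = L"
  shows "normal_map_deriv S f z0 h = LK h"
  by (simp add: normal_map_deriv_def B_derivative_closest_point[OF S] z0 assms LK_def K_def)

end

section \<open>Moment and tail estimates\<close>

lemma (in prob_space) indep_vars_Suc:
  assumes "indep_vars (\<lambda>_. N) X {1..}"
  shows "indep_vars (\<lambda>_. N) (\<lambda>i. X (Suc i)) UNIV"
proof -
  define \<F> where "\<F> i = {X i -` A \<inter> space M |A. A \<in> sets N}" for i
  have X: "\<And>i. i \<ge> 1 \<Longrightarrow> random_variable N (X i)" and indep: "indep_sets \<F> {1..}"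
    using assms unfolding indep_vars_def2 \<F>_def by auto
  have "indep_sets (\<lambda>i. \<F> (Suc i)) UNIV"
  proof (rule indep_setsI)
    fix i show "\<F> (Suc i) \<subseteq> events"
      using indep by (simp add: indep_sets_def)
  next
    fix A J assume J: "J \<noteq> {}" "finite J" and A: "\<forall>j\<in>J. A j \<in> \<F> (Suc j)"
    have "prob (\<Inter>j\<in>Suc ` J. A (j - 1)) = (\<Prod>j\<in>Suc ` J. prob (A (j - 1)))"
      by (rule indep_setsD[OF indep]) (use J A in auto)
    then show "prob (\<Inter>j\<in>J. A j) = (\<Prod>j\<in>J. prob (A j))"
      by (simp add: prod.reindex)
  qed
  then show ?thesis
    unfolding indep_vars_def2 \<F>_def using X by auto
qed

lemma (in prob_space) indep_vars_second_moment_sum: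
  fixes V :: "nat \<Rightarrow> 'a \<Rightarrow> 'b::euclidean_space"
  assumes indep: "indep_vars (\<lambda>_. borel) V UNIV"
    and mean: "\<And>i. expectation (V i) = 0"
    and int: "\<And>i. integrable M (\<lambda>\<omega>. (norm (V i \<omega>))\<^sup>2)"
    and var: "\<And>i. expectation (\<lambda>\<omega>. (norm (V i \<omega>))\<^sup>2) = v"
  shows "integrable M (\<lambda>\<omega>. (norm (\<Sum>i<n. V i \<omega>))\<^sup>2)"
    and "expectation (\<lambda>\<omega>. (norm (\<Sum>i<n. V i \<omega>))\<^sup>2) = real n * v"
proof -
  have V[measurable]: "V i \<in> borel_measurable M" for i
    using indep by (auto simp: indep_vars_def2)
  have intV: "integrable M (V i)" for i
  proof (rule Bochner_Integration.integrable_bound)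
    show "integrable M (\<lambda>\<omega>. 1 + (norm (V i \<omega>))\<^sup>2)"
      using int by simp
    show "AE \<omega> in M. norm (V i \<omega>) \<le> norm (1 + (norm (V i \<omega>))\<^sup>2)"
    proof (rule AE_I2)
      fix \<omega>
      have "norm (V i \<omega>) \<le> 1 + (norm (V i \<omega>))\<^sup>2"
        using sum_squares_bound[of 1 "norm (V i \<omega>)"] norm_ge_zero[of "V i \<omega>"]
        unfolding power_one mult_1_right by linarith
      also have "\<dots> \<le> norm (1 + (norm (V i \<omega>))\<^sup>2)"
        by simp
      finally show "norm (V i \<omega>) \<le> norm (1 + (norm (V i \<omega>))\<^sup>2)" .
    qed
  qed simp
  have intVV: "integrable M (\<lambda>\<omega>. V i \<omega> \<bullet> V j \<omega>)" for i j
  proof (rule Bochner_Integration.integrable_bound)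
    show "integrable M (\<lambda>\<omega>. (norm (V i \<omega>))\<^sup>2 + (norm (V j \<omega>))\<^sup>2)"
      using int by simp
    show "AE \<omega> in M. norm (V i \<omega> \<bullet> V j \<omega>) \<le> norm ((norm (V i \<omega>))\<^sup>2 + (norm (V j \<omega>))\<^sup>2)"
    proof (rule AE_I2)
      fix \<omega>
      have "\<bar>V i \<omega> \<bullet> V j \<omega>\<bar> \<le> norm (V i \<omega>) * norm (V j \<omega>)"
        by (rule Cauchy_Schwarz_ineq2)
      also have "\<dots> \<le> (norm (V i \<omega>))\<^sup>2 + (norm (V j \<omega>))\<^sup>2"
        using sum_squares_bound[of "norm (V i \<omega>)" "norm (V j \<omega>)"]
          mult_nonneg_nonneg[OF norm_ge_zero norm_ge_zero, of "V i \<omega>" "V j \<omega>"] by linarith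
      finally show "norm (V i \<omega> \<bullet> V j \<omega>) \<le> norm ((norm (V i \<omega>))\<^sup>2 + (norm (V j \<omega>))\<^sup>2)"
        by simp
    qed
  qed simp
  have orth: "expectation (\<lambda>\<omega>. V i \<omega> \<bullet> V j \<omega>) = (if i = j then v else 0)" for i j
  proof (cases "i = j")
    case True
    then show ?thesis
      using var by (simp add: power2_norm_eq_inner)
  next
    case False
    \<comment> \<open>Independence factorizes products of real variables, so orthogonality is
      obtained coordinate by coordinate.\<close>
    have b: "integrable M (\<lambda>\<omega>. (V i \<omega> \<bullet> b) * (V j \<omega> \<bullet> b)) \<and>
      expectation (\<lambda>\<omega>. (V i \<omega> \<bullet> b) * (V j \<omega> \<bullet> b)) = 0" for b
    proof -
      have ind: "indep_vars (\<lambda>_. borel) (\<lambda>i \<omega>. V i \<omega> \<bullet> b) {i, j}"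
        by (intro indep_vars_compose2[OF indep_vars_subset[OF indep]]) auto
      have int': "integrable M (\<lambda>\<omega>. V i \<omega> \<bullet> b)" for i
        using intV by simp
      have "expectation (\<lambda>\<omega>. \<Prod>i\<in>{i,j}. V i \<omega> \<bullet> b) = (\<Prod>i\<in>{i,j}. expectation (\<lambda>\<omega>. V i \<omega> \<bullet> b))"
        by (rule indep_vars_lebesgue_integral[OF _ ind int']) simp
      moreover have "integrable M (\<lambda>\<omega>. \<Prod>i\<in>{i,j}. V i \<omega> \<bullet> b)"
        by (rule indep_vars_integrable[OF _ ind int']) simp
      moreover have "expectation (\<lambda>\<omega>. V i \<omega> \<bullet> b) = 0" for i
        using mean intV by simp
      ultimately show ?thesis
        using False by simp
    qed
    have "expectation (\<lambda>\<omega>. V i \<omega> \<bullet> V j \<omega>) = (\<Sum>b\<in>Basis. expectation (\<lambda>\<omega>. (V i \<omega> \<bullet> b) * (V j \<omega> \<bullet> b)))"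
      using b by (subst Bochner_Integration.integral_sum[symmetric]) (auto simp: euclidean_inner[symmetric])
    then show ?thesis
      using False b by simp
  qed
  have eq: "(norm (\<Sum>i<n. V i \<omega>))\<^sup>2 = (\<Sum>i<n. \<Sum>j<n. V i \<omega> \<bullet> V j \<omega>)" for \<omega>
    unfolding power2_norm_eq_inner inner_sum_left inner_sum_right by (rule sum.swap)
  show "integrable M (\<lambda>\<omega>. (norm (\<Sum>i<n. V i \<omega>))\<^sup>2)"
    unfolding eq by (intro Bochner_Integration.integrable_sum intVV)
  show "expectation (\<lambda>\<omega>. (norm (\<Sum>i<n. V i \<omega>))\<^sup>2) = real n * v"
    unfolding eq using intVV by (simp add: Bochner_Integration.integral_sum orth)
qed

lemma (in prob_space) indep_vars_sum_Chebyshev: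
  fixes V :: "nat \<Rightarrow> 'a \<Rightarrow> 'b::euclidean_space"
  assumes "indep_vars (\<lambda>_. borel) V UNIV" "\<And>i. expectation (V i) = 0"
    "\<And>i. integrable M (\<lambda>\<omega>. (norm (V i \<omega>))\<^sup>2)"
    "\<And>i. expectation (\<lambda>\<omega>. (norm (V i \<omega>))\<^sup>2) = v" and "a > 0"
  shows "prob {\<omega>\<in>space M. norm (\<Sum>i<n. V i \<omega>) > a} \<le> real n * v / a\<^sup>2"
proof -
  have [measurable]: "V i \<in> borel_measurable M" for i
    using assms(1) by (auto simp: indep_vars_def2)
  note mom = indep_vars_second_moment_sum[OF assms(1-4), of n]
  have "prob {\<omega>\<in>space M. norm (\<Sum>i<n. V i \<omega>) > a} \<le> prob {\<omega>\<in>space M. (norm (\<Sum>i<n. V i \<omega>))\<^sup>2 \<ge> a\<^sup>2}"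
    using \<open>a > 0\<close> by (intro finite_measure_mono) (auto intro: power_mono)
  also have "\<dots> \<le> expectation (\<lambda>\<omega>. (norm (\<Sum>i<n. V i \<omega>))\<^sup>2) / a\<^sup>2"
    using \<open>a > 0\<close> by (intro integral_Markov_inequality_measure[where A="{}"] mom(1)) auto
  finally show ?thesis
    unfolding mom(2) .
qed

section \<open>Convergence in probability\<close>

lemma (in prob_space) prob_eventually_avoided:
  assumes [measurable]: "\<And>n. A n \<in> events"
    and "AE \<omega> in M. \<forall>\<^sub>F n in sequentially. \<omega> \<notin> A n"
  shows "(\<lambda>n. prob (A n)) \<longlonglongrightarrow> 0"
proof -
  have "(\<lambda>n. expectation (indicator (A n) :: 'a \<Rightarrow> real)) \<longlonglongrightarrow> expectation (\<lambda>_. 0 :: real)"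
  proof (rule integral_dominated_convergence[where w="\<lambda>_. 1"])
    show "AE \<omega> in M. (\<lambda>n. indicator (A n) \<omega> :: real) \<longlonglongrightarrow> 0"
      using assms(2)
    proof eventually_elim
      case (elim \<omega>)
      then have "\<forall>\<^sub>F n in sequentially. (indicator (A n) \<omega> :: real) = 0"
        by eventually_elim simp
      then show ?case
        by (rule tendsto_eventually)
    qed
  qed (auto simp: indicator_def)
  then show ?thesis
    by simp
qed

text \<open>The index from which \<open>A n\<close> excludes \<open>E n\<close> may depend on
  \<open>\<omega>\<close>. Dominated convergence still makes the intersection of \<open>E n\<close>
  and \<open>A n\<close> asymptotically null; the rest of \<open>E n\<close> lies in the complement
  of \<open>A n\<close>.\<close>

lemma (in prob_space) prob_tendsto_0I:
  assumes E[measurable]: "\<And>n. E n \<in> events"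
    and good: "\<And>\<eta>. \<eta> > 0 \<Longrightarrow> \<exists>A. (\<forall>n. A n \<in> events) \<and>
      (AE \<omega> in M. \<forall>\<^sub>F n in sequentially. \<omega> \<in> A n \<longrightarrow> \<omega> \<notin> E n) \<and>
      (\<forall>\<^sub>F n in sequentially. prob (space M - A n) \<le> \<eta>)"
  shows "(\<lambda>n. prob (E n)) \<longlonglongrightarrow> 0"
proof (rule tendstoI)
  fix e :: real assume "e > 0"
  obtain A where A[measurable]: "\<And>n. A n \<in> events"
    and ae: "AE \<omega> in M. \<forall>\<^sub>F n in sequentially. \<omega> \<in> A n \<longrightarrow> \<omega> \<notin> E n"
    and small: "\<forall>\<^sub>F n in sequentially. prob (space M - A n) \<le> e / 2"
    using good[of "e / 2"] \<open>e > 0\<close> by auto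
  have "(\<lambda>n. prob (E n \<inter> A n)) \<longlonglongrightarrow> 0"
    by (rule prob_eventually_avoided) (use ae in \<open>auto elim!: eventually_mono\<close>)
  then have "\<forall>\<^sub>F n in sequentially. prob (E n \<inter> A n) < e / 2"
    by (rule order_tendstoD) (use \<open>e > 0\<close> in simp)
  with small show "\<forall>\<^sub>F n in sequentially. dist (prob (E n)) 0 < e"
  proof eventually_elim
    case (elim n)
    have "prob (E n) \<le> prob ((E n \<inter> A n) \<union> (space M - A n))"
      using sets.sets_into_space[OF E] by (intro finite_measure_mono) auto
    also have "\<dots> \<le> prob (E n \<inter> A n) + prob (space M - A n)"
      by (intro measure_subadditive) auto
    finally show ?case
      using elim by simp
  qed
qed

text \<open>Slutsky's argument: the cosine is 1-Lipschitz and bounded by 1, so the integrands differ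
  by at most \<open>norm t * a\<close> off the event where \<open>X n\<close> and \<open>Y n\<close>
  are far apart, and by at most 2 on it.\<close>

lemma (in prob_space) cos_expectation_diff_tendsto:
  fixes X Y :: "nat \<Rightarrow> 'a \<Rightarrow> 'b::euclidean_space"
  assumes [measurable]: "\<And>n. X n \<in> borel_measurable M" "\<And>n. Y n \<in> borel_measurable M"
    and XY: "\<And>e. e > 0 \<Longrightarrow> (\<lambda>n. prob {\<omega>\<in>space M. norm (X n \<omega> - Y n \<omega>) > e}) \<longlonglongrightarrow> 0"
    and Y: "(\<lambda>n. expectation (\<lambda>\<omega>. cos (t \<bullet> Y n \<omega> + d))) \<longlonglongrightarrow> l"
  shows "(\<lambda>n. expectation (\<lambda>\<omega>. cos (t \<bullet> X n \<omega> + d))) \<longlonglongrightarrow> l"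
proof -
  have "(\<lambda>n. expectation (\<lambda>\<omega>. cos (t \<bullet> X n \<omega> + d)) - expectation (\<lambda>\<omega>. cos (t \<bullet> Y n \<omega> + d))) \<longlonglongrightarrow> 0"
  proof (rule tendstoI)
    fix e :: real assume "e > 0"
    define a where "a = e / (2 * (norm t + 1))"
    have a: "a > 0" "norm t * a \<le> e / 2"
      using \<open>e > 0\<close> add_nonneg_pos[OF norm_ge_zero[of t] zero_less_one]
      by (auto simp: a_def field_simps)
    have int: "integrable M (\<lambda>\<omega>. cos (t \<bullet> Z n \<omega> + d))"
      if [measurable]: "\<And>n. Z n \<in> borel_measurable M" for Z :: "nat \<Rightarrow> 'a \<Rightarrow> 'b" and n
      by (rule integrable_const_bound[where B=1]) auto
    have "\<forall>\<^sub>F n in sequentially. prob {\<omega>\<in>space M. norm (X n \<omega> - Y n \<omega>) > a} < e / 4"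
      using XY[OF a(1)] by (rule order_tendstoD) (use \<open>e > 0\<close> in simp)
    then show "\<forall>\<^sub>F n in sequentially. dist (expectation (\<lambda>\<omega>. cos (t \<bullet> X n \<omega> + d))
      - expectation (\<lambda>\<omega>. cos (t \<bullet> Y n \<omega> + d))) 0 < e"
    proof eventually_elim
      case (elim n)
      let ?A = "{\<omega>\<in>space M. norm (X n \<omega> - Y n \<omega>) > a}"
      have intA: "integrable M (\<lambda>\<omega>. 2 * indicator ?A \<omega> :: real)"
        by (intro integrable_mult_right integrable_real_indicator) (auto simp: emeasure_eq_measure)
      have "\<bar>expectation (\<lambda>\<omega>. cos (t \<bullet> X n \<omega> + d)) - expectation (\<lambda>\<omega>. cos (t \<bullet> Y n \<omega> + d))\<bar>
        = \<bar>expectation (\<lambda>\<omega>. cos (t \<bullet> X n \<omega> + d) - cos (t \<bullet> Y n \<omega> + d))\<bar>"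
        using int by simp
      also have "\<dots> \<le> expectation (\<lambda>\<omega>. \<bar>cos (t \<bullet> X n \<omega> + d) - cos (t \<bullet> Y n \<omega> + d)\<bar>)"
        by (rule integral_abs_bound)
      also have "\<dots> \<le> expectation (\<lambda>\<omega>. e / 2 + 2 * indicator ?A \<omega>)"
      proof (rule integral_mono)
        show "integrable M (\<lambda>\<omega>. e / 2 + 2 * indicator ?A \<omega>)"
          using intA by simp
        fix \<omega> assume \<omega>: "\<omega> \<in> space M"
        show "\<bar>cos (t \<bullet> X n \<omega> + d) - cos (t \<bullet> Y n \<omega> + d)\<bar> \<le> e / 2 + 2 * indicator ?A \<omega>"
        proof (cases "\<omega> \<in> ?A")
          case True
          then show ?thesis
            using abs_cos_le_one[of "t \<bullet> X n \<omega> + d"] abs_cos_le_one[of "t \<bullet> Y n \<omega> + d"] \<open>e > 0\<close>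
            unfolding indicator_simps(1)[OF True] by linarith
        next
          case False
          have "\<bar>cos x - cos y\<bar> \<le> \<bar>x - y\<bar>" for x y :: real
          proof -
            have "\<bar>cos x - cos y\<bar> = 2 * (\<bar>sin ((x + y) / 2)\<bar> * \<bar>sin ((y - x) / 2)\<bar>)"
              by (simp add: cos_diff_cos abs_mult)
            also have "\<dots> \<le> 2 * (1 * \<bar>(y - x) / 2\<bar>)"
              by (intro mult_left_mono mult_mono abs_sin_le_one abs_sin_x_le_abs_x) auto
            finally show ?thesis by simp
          qed
          then have "\<bar>cos (t \<bullet> X n \<omega> + d) - cos (t \<bullet> Y n \<omega> + d)\<bar> \<le> \<bar>t \<bullet> (X n \<omega> - Y n \<omega>)\<bar>"
            by (simp add: inner_diff_right) (metis add_diff_cancel_right)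
          also have "\<dots> \<le> norm t * norm (X n \<omega> - Y n \<omega>)"
            by (rule Cauchy_Schwarz_ineq2)
          also have "\<dots> \<le> norm t * a"
            using False \<omega> by (intro mult_left_mono) auto
          finally show ?thesis
            using a(2) False by simp
        qed
      qed (use int in auto)
      also have "\<dots> = e / 2 + 2 * prob ?A"
        using intA by (simp add: prob_space)
      finally show ?case
        using elim by (simp add: dist_real_def)
    qed
  qed
  from tendsto_add[OF this Y] show ?thesis
    by simp
qed

lemma (in prob_space) covariance_matrix_quadratic:
  fixes X :: "'a \<Rightarrow> real^'n"
  assumes [measurable]: "X \<in> borel_measurable M"
    and int: "integrable M X" "integrable M (\<lambda>\<omega>. (norm (X \<omega>))\<^sup>2)"
  shows "t \<bullet> (covariance_matrix M X *v t) = expectation (\<lambda>\<omega>. (t \<bullet> (X \<omega> - expectation X))\<^sup>2)"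
proof -
  have comp: "expectation (\<lambda>\<omega>. X \<omega> $ i) = expectation X $ i" for i
    using integral_inner_left[OF int(1), of "axis i 1"] by (simp add: cart_eq_inner_axis)
  define V where "V \<omega> = X \<omega> - expectation X" for \<omega>
  have [measurable]: "V \<in> borel_measurable M"
    unfolding V_def by measurable
  have intV: "integrable M (\<lambda>\<omega>. V \<omega> $ i * V \<omega> $ j)" for i j
  proof (rule Bochner_Integration.integrable_bound)
    show "integrable M (\<lambda>\<omega>. 2 * (norm (X \<omega>))\<^sup>2 + 2 * (norm (expectation X))\<^sup>2)"
      using int(2) by simp
    have "(\<lambda>\<omega>. (V \<omega> \<bullet> axis i 1) * (V \<omega> \<bullet> axis j 1)) \<in> borel_measurable M"
      by measurable
    then show "(\<lambda>\<omega>. V \<omega> $ i * V \<omega> $ j) \<in> borel_measurable M"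
      by (simp add: cart_eq_inner_axis)
    show "AE \<omega> in M. norm (V \<omega> $ i * V \<omega> $ j) \<le> norm (2 * (norm (X \<omega>))\<^sup>2 + 2 * (norm (expectation X))\<^sup>2)"
    proof (rule AE_I2)
      fix \<omega>
      have "\<bar>V \<omega> $ i * V \<omega> $ j\<bar> \<le> norm (V \<omega>) * norm (V \<omega>)"
        unfolding abs_mult by (intro mult_mono component_le_norm_cart) auto
      also have "\<dots> \<le> (norm (X \<omega>) + norm (expectation X)) * (norm (X \<omega>) + norm (expectation X))"
        unfolding V_def by (intro mult_mono norm_triangle_ineq4) auto
      also have "\<dots> \<le> 2 * (norm (X \<omega>))\<^sup>2 + 2 * (norm (expectation X))\<^sup>2"
        using sum_squares_bound[of "norm (X \<omega>)" "norm (expectation X)"]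
        by (simp add: power2_eq_square algebra_simps)
      finally show "norm (V \<omega> $ i * V \<omega> $ j) \<le> norm (2 * (norm (X \<omega>))\<^sup>2 + 2 * (norm (expectation X))\<^sup>2)"
        by simp
    qed
  qed
  have "expectation (\<lambda>\<omega>. (t \<bullet> V \<omega>)\<^sup>2) = expectation (\<lambda>\<omega>. \<Sum>i\<in>UNIV. \<Sum>j\<in>UNIV. t $ i * t $ j * (V \<omega> $ i * V \<omega> $ j))"
    by (simp add: inner_vec_def power2_eq_square sum_product ac_simps)
  also have "\<dots> = (\<Sum>i\<in>UNIV. \<Sum>j\<in>UNIV. t $ i * t $ j * expectation (\<lambda>\<omega>. V \<omega> $ i * V \<omega> $ j))"
    using intV by (simp add: Bochner_Integration.integral_sum)
  also have "\<dots> = t \<bullet> (covariance_matrix M X *v t)"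
    by (simp add: covariance_matrix_def comp V_def inner_vec_def matrix_vector_mult_def sum_distrib_left ac_simps)
  finally show ?thesis
    by (simp add: V_def)
qed

lemma borel_measurable_completion_AE:
  assumes "g \<in> borel_measurable (completion M)" "AE \<omega> in M. f \<omega> = g \<omega>"
  shows "f \<in> borel_measurable (completion M)"
proof (rule measurableI)
  fix A :: "'b set" assume "A \<in> sets borel"
  then have sets: "g -` A \<inter> space (completion M) \<in> sets (completion M)"
    using assms(1) by (intro measurable_sets)
  have ae: "AE \<omega> in completion M. \<omega> \<in> g -` A \<inter> space (completion M) \<longleftrightarrow> \<omega> \<in> f -` A \<inter> space (completion M)"
    using AE_completion[OF assms(2)] by eventually_elim simp
  show "f -` A \<inter> space (completion M) \<in> sets (completion M)"
    by (rule completion.in_sets_AE[OF ae sets]) simp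
qed simp

section \<open>Averages over an i.i.d. sample\<close>

locale saa = prob_space M for M :: "'w measure" +
  fixes \<xi> :: "'w \<Rightarrow> 's::euclidean_space" and \<eta> :: "nat \<Rightarrow> 'w \<Rightarrow> 's"
    and G :: "real^'q \<Rightarrow> 's \<Rightarrow> real^'q" and c :: "'s \<Rightarrow> real"
    and D :: "(real^'q) set" and x0 :: "real^'q"
  assumes \<xi>[measurable]: "\<xi> \<in> borel_measurable M"
    and \<eta>_indep: "indep_vars (\<lambda>_. borel) \<eta> UNIV"
    and \<eta>_distr: "\<And>i. distr M borel (\<eta> i) = distr M borel \<xi>"
    and open_D: "open D" and x0_D: "x0 \<in> D"
    and G: "(\<lambda>(x, s). G x s) \<in> borel_measurable borel"
    and c[measurable]: "c \<in> borel_measurable borel" and c_nonneg: "\<And>s. 0 \<le> c s"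
    and c_integrable: "integrable M (\<lambda>\<omega>. c (\<xi> \<omega>))"
    and C11: "AE \<omega> in M. C11_bound (\<lambda>x. G x (\<xi> \<omega>)) (c (\<xi> \<omega>)) D"
    and C11_\<eta>: "AE \<omega> in M. \<forall>i. C11_bound (\<lambda>x. G x (\<eta> i \<omega>)) (c (\<eta> i \<omega>)) D"
    and G_integrable: "\<And>x. x \<in> D \<Longrightarrow> integrable M (\<lambda>\<omega>. G x (\<xi> \<omega>))"
    and G_square: "integrable M (\<lambda>\<omega>. (norm (G x0 (\<xi> \<omega>)))\<^sup>2)"
    and J_square: "integrable M (\<lambda>\<omega>. (norm (limit_jacobian (\<lambda>x. G x (\<xi> \<omega>)) x0))\<^sup>2)"
begin

lemma \<eta>[measurable]: "\<eta> i \<in> borel_measurable M"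
  using \<eta>_indep by (auto simp: indep_vars_def2)

lemma borel_measurable_G[measurable (raw)]:
  "x \<in> borel_measurable N \<Longrightarrow> s \<in> borel_measurable N \<Longrightarrow> (\<lambda>\<omega>. G (x \<omega>) (s \<omega>)) \<in> borel_measurable N"
  using measurable_compose[of "\<lambda>\<omega>. (x \<omega>, s \<omega>)" N borel "\<lambda>(x, s). G x s" borel] G by simp

definition J where "J s = limit_jacobian (\<lambda>x. G x s) x0"

lemma borel_measurable_J[measurable]: "J \<in> borel_measurable borel"
  unfolding J_def by (rule borel_measurable_limit_jacobian[OF G]) auto

definition mean where "mean x = expectation (\<lambda>\<omega>. G x (\<xi> \<omega>))"

definition mean_J where "mean_J = expectation (\<lambda>\<omega>. J (\<xi> \<omega>))"

text \<open>Samples are numbered from \<open>0\<close> here, and \<open>G\<close> is Borel on the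
  whole space, so these averages are measurable on \<open>M\<close> itself; the completion enters
  only with \<open>z\<close>.\<close>

definition sample where "sample n \<omega> x = (1 / real n) *\<^sub>R (\<Sum>i<n. G x (\<eta> i \<omega>))"

definition sample_J where "sample_J n \<omega> = (1 / real n) *\<^sub>R (\<Sum>i<n. J (\<eta> i \<omega>))"

definition sample_c where "sample_c n \<omega> = (1 / real n) * (\<Sum>i<n. c (\<eta> i \<omega>))"

lemma sample_integral:
  fixes h :: "'s \<Rightarrow> 'b::{banach, second_countable_topology}"
  assumes [measurable]: "h \<in> borel_measurable borel"
  shows "integrable M (\<lambda>\<omega>. h (\<eta> i \<omega>)) \<longleftrightarrow> integrable M (\<lambda>\<omega>. h (\<xi> \<omega>))"
    and "expectation (\<lambda>\<omega>. h (\<eta> i \<omega>)) = expectation (\<lambda>\<omega>. h (\<xi> \<omega>))"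
  using integrable_distr_eq[of "\<eta> i" M borel h] integrable_distr_eq[of \<xi> M borel h]
    integral_distr[of "\<eta> i" M borel h] integral_distr[of \<xi> M borel h]
  by (auto simp: \<eta>_distr)

lemma integrable_of_square:
  fixes X :: "'w \<Rightarrow> 'b::{banach, second_countable_topology}"
  assumes [measurable]: "X \<in> borel_measurable M" and "integrable M (\<lambda>\<omega>. (norm (X \<omega>))\<^sup>2)"
  shows "integrable M X"
  by (rule integrable_norm_cancel[OF square_integrable_imp_integrable[of "\<lambda>\<omega>. norm (X \<omega>)"]])
    (use assms in auto)

lemma centered:
  fixes h :: "'s \<Rightarrow> 'b::euclidean_space"
  assumes [measurable]: "h \<in> borel_measurable borel" and sq: "integrable M (\<lambda>\<omega>. (norm (h (\<xi> \<omega>)))\<^sup>2)"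
  defines "\<mu> \<equiv> expectation (\<lambda>\<omega>. h (\<xi> \<omega>))"
  shows "indep_vars (\<lambda>_. borel) (\<lambda>i \<omega>. h (\<eta> i \<omega>) - \<mu>) UNIV"
    and "expectation (\<lambda>\<omega>. h (\<eta> i \<omega>) - \<mu>) = 0"
    and "integrable M (\<lambda>\<omega>. (norm (h (\<eta> i \<omega>) - \<mu>))\<^sup>2)"
    and "expectation (\<lambda>\<omega>. (norm (h (\<eta> i \<omega>) - \<mu>))\<^sup>2) = expectation (\<lambda>\<omega>. (norm (h (\<xi> \<omega>) - \<mu>))\<^sup>2)"
proof -
  have int: "integrable M (\<lambda>\<omega>. h (\<xi> \<omega>))"
    by (rule integrable_of_square) (use sq in auto)
  show "indep_vars (\<lambda>_. borel) (\<lambda>i \<omega>. h (\<eta> i \<omega>) - \<mu>) UNIV"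
    by (rule indep_vars_compose2[OF \<eta>_indep]) auto
  show "expectation (\<lambda>\<omega>. h (\<eta> i \<omega>) - \<mu>) = 0"
    using int sample_integral[of h i] by (simp add: \<mu>_def prob_space)
  have "integrable M (\<lambda>\<omega>. (norm (h (\<xi> \<omega>) - \<mu>))\<^sup>2)"
  proof (rule Bochner_Integration.integrable_bound)
    show "integrable M (\<lambda>\<omega>. 2 * (norm (h (\<xi> \<omega>)))\<^sup>2 + 2 * (norm \<mu>)\<^sup>2)"
      using sq by simp
    show "AE \<omega> in M. norm ((norm (h (\<xi> \<omega>) - \<mu>))\<^sup>2) \<le> norm (2 * (norm (h (\<xi> \<omega>)))\<^sup>2 + 2 * (norm \<mu>)\<^sup>2)"
    proof (rule AE_I2)
      fix \<omega>
      have "(norm (h (\<xi> \<omega>) - \<mu>))\<^sup>2 \<le> (norm (h (\<xi> \<omega>)) + norm \<mu>)\<^sup>2"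
        by (intro power_mono norm_triangle_ineq4) auto
      also have "\<dots> \<le> 2 * (norm (h (\<xi> \<omega>)))\<^sup>2 + 2 * (norm \<mu>)\<^sup>2"
        using sum_squares_bound[of "norm (h (\<xi> \<omega>))" "norm \<mu>"] by (simp add: power2_sum)
      finally show "norm ((norm (h (\<xi> \<omega>) - \<mu>))\<^sup>2) \<le> norm (2 * (norm (h (\<xi> \<omega>)))\<^sup>2 + 2 * (norm \<mu>)\<^sup>2)"
        by simp
    qed
  qed measurable
  then show "integrable M (\<lambda>\<omega>. (norm (h (\<eta> i \<omega>) - \<mu>))\<^sup>2)"
    using sample_integral(1)[of "\<lambda>s. (norm (h s - \<mu>))\<^sup>2" i] by simp
  show "expectation (\<lambda>\<omega>. (norm (h (\<eta> i \<omega>) - \<mu>))\<^sup>2) = expectation (\<lambda>\<omega>. (norm (h (\<xi> \<omega>) - \<mu>))\<^sup>2)"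
    by (rule sample_integral(2)[of "\<lambda>s. (norm (h s - \<mu>))\<^sup>2"]) measurable
qed

lemma sample_Chebyshev:
  fixes h :: "'s \<Rightarrow> 'b::euclidean_space"
  assumes [measurable]: "h \<in> borel_measurable borel" and sq: "integrable M (\<lambda>\<omega>. (norm (h (\<xi> \<omega>)))\<^sup>2)"
  defines "\<mu> \<equiv> expectation (\<lambda>\<omega>. h (\<xi> \<omega>))"
  assumes "a > 0" "n > 0"
  shows "prob {\<omega>\<in>space M. norm ((1 / real n) *\<^sub>R (\<Sum>i<n. h (\<eta> i \<omega>)) - \<mu>) > a}
    \<le> expectation (\<lambda>\<omega>. (norm (h (\<xi> \<omega>) - \<mu>))\<^sup>2) / (real n * a\<^sup>2)"
proof -
  have "norm ((1 / real n) *\<^sub>R (\<Sum>i<n. h (\<eta> i \<omega>)) - \<mu>) > a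
      \<longleftrightarrow> norm (\<Sum>i<n. h (\<eta> i \<omega>) - \<mu>) > real n * a" for \<omega>
  proof -
    have "(1 / real n) *\<^sub>R (\<Sum>i<n. h (\<eta> i \<omega>)) - \<mu> = (1 / real n) *\<^sub>R (\<Sum>i<n. h (\<eta> i \<omega>) - \<mu>)"
      using \<open>n > 0\<close> by (simp add: sum_subtractf sum_constant_scaleR scaleR_diff_right)
    then show ?thesis
      using \<open>n > 0\<close> by (simp add: field_simps)
  qed
  moreover have "prob {\<omega>\<in>space M. norm (\<Sum>i<n. h (\<eta> i \<omega>) - \<mu>) > real n * a}
      \<le> real n * expectation (\<lambda>\<omega>. (norm (h (\<xi> \<omega>) - \<mu>))\<^sup>2) / (real n * a)\<^sup>2"
    using \<open>a > 0\<close> \<open>n > 0\<close> unfolding \<mu>_def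
    by (intro indep_vars_sum_Chebyshev centered[OF assms(1) sq]) auto
  ultimately show ?thesis
    using \<open>n > 0\<close> by (simp add: power_mult_distrib power2_eq_square mult.assoc mult.left_commute)
qed

text \<open>Differentiation under the expectation: the quadratic remainder is integrated, and the
  mean of \<open>c\<close> becomes its constant.\<close>

lemma jacobian_mean: "jacobian mean (at x0) = mean_J"
proof (rule jacobian_eqI)
  obtain \<rho> where \<rho>: "\<rho> > 0" "ball x0 \<rho> \<subseteq> D"
    using open_D x0_D openE by blast
  have Jint: "integrable M (\<lambda>\<omega>. J (\<xi> \<omega>))"
    by (rule integrable_of_square, measurable) (use J_square in \<open>simp add: J_def\<close>)
  show "(mean has_derivative (*v) mean_J) (at x0)"
  proof (rule has_derivative_quadratic[OF bounded_linear_matrix_vector_mul \<rho>(1)])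
    fix x assume x: "x \<in> ball x0 \<rho>"
    then have xD: "x \<in> D" using \<rho>(2) by auto
    have lin: "bounded_linear (\<lambda>A :: real^'q^'q. A *v (x - x0))"
      by (rule bounded_bilinear.bounded_linear_left[OF bounded_bilinear_matrix_vector_mult])
    have "mean x - mean x0 - mean_J *v (x - x0)
        = expectation (\<lambda>\<omega>. G x (\<xi> \<omega>) - G x0 (\<xi> \<omega>) - J (\<xi> \<omega>) *v (x - x0))"
      unfolding mean_def mean_J_def
      using G_integrable[OF xD] G_integrable[OF x0_D] integrable_bounded_linear[OF lin Jint]
      by (simp add: integral_bounded_linear[OF lin Jint])
    also have "norm \<dots> \<le> expectation (\<lambda>\<omega>. norm (G x (\<xi> \<omega>) - G x0 (\<xi> \<omega>) - J (\<xi> \<omega>) *v (x - x0)))"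
      by (rule integral_norm_bound)
    also have "\<dots> \<le> expectation (\<lambda>\<omega>. c (\<xi> \<omega>) * (norm (x - x0))\<^sup>2)"
    proof (rule integral_mono_AE)
      show "AE \<omega> in M. norm (G x (\<xi> \<omega>) - G x0 (\<xi> \<omega>) - J (\<xi> \<omega>) *v (x - x0)) \<le> c (\<xi> \<omega>) * (norm (x - x0))\<^sup>2"
        using C11
      proof eventually_elim
        case (elim \<omega>)
        have "x0 \<in> ball x0 \<rho>"
          using \<rho>(1) by simp
        then show ?case
          using elim \<rho>(2) x unfolding C11_bound_def J_def by blast
      qed
      show "integrable M (\<lambda>\<omega>. norm (G x (\<xi> \<omega>) - G x0 (\<xi> \<omega>) - J (\<xi> \<omega>) *v (x - x0)))"
        using G_integrable[OF xD] G_integrable[OF x0_D] integrable_bounded_linear[OF lin Jint] by simp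
    qed (use c_integrable in simp)
    finally show "norm (mean x - mean x0 - mean_J *v (x - x0)) \<le> expectation (\<lambda>\<omega>. c (\<xi> \<omega>)) * (norm (x - x0))\<^sup>2"
      by simp
  qed
qed

lemma sample_value_tail:
  assumes "B > 0" "n > 0"
  shows "prob {\<omega>\<in>space M. sqrt (real n) * norm (sample n \<omega> x0 - mean x0) > B}
    \<le> expectation (\<lambda>\<omega>. (norm (G x0 (\<xi> \<omega>) - mean x0))\<^sup>2) / B\<^sup>2"
proof -
  have "prob {\<omega>\<in>space M. norm (sample n \<omega> x0 - mean x0) > B / sqrt (real n)}
    \<le> expectation (\<lambda>\<omega>. (norm (G x0 (\<xi> \<omega>) - mean x0))\<^sup>2) / (real n * (B / sqrt (real n))\<^sup>2)"
    unfolding sample_def mean_def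
    by (rule sample_Chebyshev[where h = "G x0"]) (use assms G_square in auto)
  then show ?thesis
    using assms by (simp add: power_divide divide_simps mult.commute)
qed

lemma sample_J_tail:
  assumes "a > 0"
  shows "(\<lambda>n. prob {\<omega>\<in>space M. norm (sample_J n \<omega> - mean_J) > a}) \<longlonglongrightarrow> 0"
proof (rule tendsto_sandwich[OF _ _ tendsto_const])
  let ?v = "expectation (\<lambda>\<omega>. (norm (J (\<xi> \<omega>) - mean_J))\<^sup>2)"
  show "\<forall>\<^sub>F n in sequentially. prob {\<omega>\<in>space M. norm (sample_J n \<omega> - mean_J) > a} \<le> ?v / (real n * a\<^sup>2)"
    using eventually_gt_at_top[of 0]
  proof eventually_elim
    case (elim n)
    show ?case
      unfolding sample_J_def mean_J_def
      by (rule sample_Chebyshev) (use assms elim J_square in \<open>auto simp: J_def[symmetric]\<close>)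
  qed
  have "(\<lambda>n. (?v / a\<^sup>2) * (1 / real n)) \<longlonglongrightarrow> (?v / a\<^sup>2) * 0"
    by (intro tendsto_intros lim_1_over_n)
  then show "(\<lambda>n. ?v / (real n * a\<^sup>2)) \<longlonglongrightarrow> 0"
    by (simp add: mult.commute)
qed simp

lemma sample_c_tail:
  assumes "\<kappa> > 0"
  shows "prob {\<omega>\<in>space M. sample_c n \<omega> > \<kappa>} \<le> expectation (\<lambda>\<omega>. c (\<xi> \<omega>)) / \<kappa>"
proof -
  have int: "integrable M (\<lambda>\<omega>. c (\<eta> i \<omega>))" for i
    using sample_integral(1)[of c i] c_integrable by simp
  have int': "integrable M (sample_c n)"
    unfolding sample_c_def[abs_def] using int by simp
  have nonneg: "0 \<le> sample_c n \<omega>" for \<omega>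
    unfolding sample_c_def by (intro mult_nonneg_nonneg sum_nonneg c_nonneg) simp
  have "prob {\<omega>\<in>space M. sample_c n \<omega> > \<kappa>} \<le> prob {\<omega>\<in>space M. sample_c n \<omega> \<ge> \<kappa>}"
    using int' by (intro finite_measure_mono) auto
  also have "\<dots> \<le> expectation (sample_c n) / \<kappa>"
    using assms nonneg by (intro integral_Markov_inequality_measure[where A="{}"] int') auto
  \<comment> \<open>Only an inequality, since the average over no samples is \<open>0\<close> by the
    convention for division.\<close>
  also have "expectation (sample_c n) \<le> expectation (\<lambda>\<omega>. c (\<xi> \<omega>))"
    unfolding sample_c_def[abs_def] using int sample_integral(2)[of c]
    by (cases "n = 0") (auto intro!: Bochner_Integration.integral_nonneg c_nonneg)
  finally show ?thesis
    using assms by (simp add: divide_right_mono)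
qed

text \<open>Cramer-Wold reduction: for fixed \<open>t\<close> only the scalar variables
  \<open>t \<bullet> G x0 s\<close> at the samples matter.\<close>

lemma sample_CLT:
  "(\<lambda>n. expectation (\<lambda>\<omega>. cos (t \<bullet> (sqrt (real n) *\<^sub>R (sample n \<omega> x0 - mean x0)) + d)))
    \<longlonglongrightarrow> (\<integral>u. cos (u + d) \<partial>normal_law 0 (expectation (\<lambda>\<omega>. (t \<bullet> (G x0 (\<xi> \<omega>) - mean x0))\<^sup>2)))"
proof -
  define h where "h s = t \<bullet> G x0 s" for s
  have [measurable]: "h \<in> borel_measurable borel"
    unfolding h_def by measurable
  have "integrable M (\<lambda>\<omega>. (norm (h (\<xi> \<omega>)))\<^sup>2)"
  proof (rule Bochner_Integration.integrable_bound)
    show "integrable M (\<lambda>\<omega>. (norm t)\<^sup>2 * (norm (G x0 (\<xi> \<omega>)))\<^sup>2)"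
      using G_square by simp
    have "(h (\<xi> \<omega>))\<^sup>2 \<le> (norm t * norm (G x0 (\<xi> \<omega>)))\<^sup>2" for \<omega>
      unfolding h_def using Cauchy_Schwarz_ineq2[of t "G x0 (\<xi> \<omega>)"]
      by (intro power2_le_iff_abs_le[THEN iffD2]) auto
    then show "AE \<omega> in M. norm ((norm (h (\<xi> \<omega>)))\<^sup>2) \<le> norm ((norm t)\<^sup>2 * (norm (G x0 (\<xi> \<omega>)))\<^sup>2)"
      by (simp add: power_mult_distrib)
  qed measurable
  note cent = centered[OF \<open>h \<in> borel_measurable borel\<close> this]
  have \<mu>: "expectation (\<lambda>\<omega>. h (\<xi> \<omega>)) = t \<bullet> mean x0"
    unfolding h_def mean_def using G_integrable[OF x0_D] by simp
  have "(\<lambda>n. expectation (\<lambda>\<omega>. cos ((\<Sum>i<n. h (\<eta> i \<omega>) - t \<bullet> mean x0) / sqrt (real n) + d)))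
    \<longlonglongrightarrow> (\<integral>u. cos (u + d) \<partial>normal_law 0 (expectation (\<lambda>\<omega>. (norm (h (\<xi> \<omega>) - t \<bullet> mean x0))\<^sup>2)))"
  proof (rule clt_cos)
    show "distr M borel (\<lambda>\<omega>. h (\<eta> n \<omega>) - t \<bullet> mean x0)
      = distr (distr M borel \<xi>) borel (\<lambda>s. h s - t \<bullet> mean x0)" for n
      unfolding \<eta>_distr[of n, symmetric] by (subst distr_distr) (auto simp: comp_def)
  qed (use cent in \<open>simp_all add: \<mu>\<close>)
  moreover have "(\<Sum>i<n. h (\<eta> i \<omega>) - t \<bullet> mean x0) / sqrt (real n)
      = t \<bullet> (sqrt (real n) *\<^sub>R (sample n \<omega> x0 - mean x0))" for n \<omega>
  proof (cases "n = 0")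
    case False
    have "sqrt (real n) / real n = 1 / sqrt (real n)"
      using False by (simp add: real_div_sqrt field_simps)
    then have "sqrt (real n) * x / real n = x / sqrt (real n)" for x
      by (metis mult.commute mult.right_neutral times_divide_eq_left)
    then have *: "t \<bullet> (sqrt (real n) *\<^sub>R (sample n \<omega> x0 - mean x0))
        = (\<Sum>i<n. h (\<eta> i \<omega>)) / sqrt (real n) - sqrt (real n) * (t \<bullet> mean x0)"
      by (simp add: sample_def h_def inner_sum_right inner_diff_right right_diff_distrib)
    have "real n * x / sqrt (real n) = sqrt (real n) * x" for x
      by (metis mult.commute of_nat_0_le_iff real_div_sqrt times_divide_eq_right)
    then show ?thesis
      unfolding * by (simp add: sum_subtractf diff_divide_distrib)
  qed simp
  ultimately show ?thesis
    by (simp add: h_def inner_diff_right)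
qed

end

section \<open>Sample average normal maps\<close>

locale saa_normal_map = saa M \<xi> \<eta> G c D x0 + normal_map_point S D x0 z0 L
  for M :: "'w measure" and \<xi> :: "'w \<Rightarrow> 's::euclidean_space" and \<eta> G c
    and D :: "(real^'q) set" and x0 S z0 L +
  fixes f :: "nat \<Rightarrow> 'w \<Rightarrow> real^'q \<Rightarrow> real^'q" and Z :: "(real^'q) set" and z :: "nat \<Rightarrow> 'w \<Rightarrow> real^'q"
  assumes z0_eq: "z0 = x0 - mean x0" and L_eq: "L = mean_J"
    and f: "AE \<omega> in M. \<forall>n. \<forall>x\<in>D. f n \<omega> x = sample n \<omega> x"
    and Z: "z0 \<in> interior Z"
    and z[measurable]: "\<And>n. z n \<in> borel_measurable (completion M)"
    and z_D: "\<And>n \<omega>. \<omega> \<in> space M \<Longrightarrow> closest_point S (z n \<omega>) \<in> D"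
    and z_unique: "AE \<omega> in M. \<forall>\<^sub>F n in sequentially.
      {y \<in> Z. closest_point S y \<in> D \<and> normal_map S (f n \<omega>) y = 0} = {z n \<omega>}"
begin

lemma sample_C11:
  "AE \<omega> in M. \<forall>n. C11_bound (f n \<omega>) (sample_c n \<omega>) D \<and> limit_jacobian (f n \<omega>) x0 = sample_J n \<omega> \<and>
    f n \<omega> x0 = sample n \<omega> x0 \<and>
    (\<forall>x\<in>D. jacobian (f n \<omega>) (at x) = (1 / real n) *\<^sub>R (\<Sum>i<n. limit_jacobian (\<lambda>y. G y (\<eta> i \<omega>)) x))"
  using C11_\<eta> f
proof eventually_elim
  case (elim \<omega>)
  show ?case
  proof
    fix n
    have *: "f n \<omega> x = (1 / real n) *\<^sub>R (\<Sum>i<n. G x (\<eta> i \<omega>))" if "x \<in> D" for x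
      using elim that by (simp add: sample_def)
    note avg = C11_bound_average[of "{..<n}" "\<lambda>i x. G x (\<eta> i \<omega>)" "\<lambda>i. c (\<eta> i \<omega>)" D "f n \<omega>" "1 / real n",
        OF _ open_D *]
    have C11: "C11_bound (f n \<omega>) (sample_c n \<omega>) D"
      unfolding sample_c_def by (rule avg(1)) (use elim in auto)
    have J: "limit_jacobian (f n \<omega>) x = (1 / real n) *\<^sub>R (\<Sum>i<n. limit_jacobian (\<lambda>y. G y (\<eta> i \<omega>)) x)"
      if "x \<in> D" for x
      by (rule avg(2)) (use elim that in auto)
    show "C11_bound (f n \<omega>) (sample_c n \<omega>) D \<and> limit_jacobian (f n \<omega>) x0 = sample_J n \<omega> \<and>
      f n \<omega> x0 = sample n \<omega> x0 \<and>
      (\<forall>x\<in>D. jacobian (f n \<omega>) (at x) = (1 / real n) *\<^sub>R (\<Sum>i<n. limit_jacobian (\<lambda>y. G y (\<eta> i \<omega>)) x))"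
      using C11 J[OF x0_D] J C11_bound_jacobian[OF C11 open_D] elim x0_D
      by (simp add: sample_J_def J_def)
  qed
qed

definition saa_deriv where "saa_deriv n \<omega> = normal_map_deriv S (f n \<omega>) (z n \<omega>) (z0 - z n \<omega>)"

text \<open>As a function of \<open>\<omega>\<close> the Jacobian at the moving point
  \<open>z n \<omega>\<close> need not be measurable. Almost surely it equals the average of limit
  Jacobians, which are jointly Borel in point and sample; the completion absorbs the null
  set.\<close>

lemma borel_measurable_saa_deriv[measurable]: "saa_deriv n \<in> borel_measurable (completion M)"
proof (rule borel_measurable_completion_AE)
  have [measurable]: "closest_point S \<in> borel_measurable borel"
    using S by (intro borel_measurable_continuous_onI continuous_on_closest_point
        polyhedron_imp_convex polyhedron_imp_closed)
  have [measurable]: "\<eta> i \<in> borel_measurable (completion M)" for i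
    by (rule measurable_completion) measurable
  note [measurable] = borel_measurable_limit_jacobian[OF G] borel_measurable_matrix_vector_mult
    borel_measurable_B_derivative_closest_point[OF S]
  show "(\<lambda>\<omega>. ((1 / real n) *\<^sub>R (\<Sum>i<n. limit_jacobian (\<lambda>y. G y (\<eta> i \<omega>)) (closest_point S (z n \<omega>))))
      *v B_derivative (closest_point S) (z n \<omega>) (z0 - z n \<omega>)
      + (z0 - z n \<omega>) - B_derivative (closest_point S) (z n \<omega>) (z0 - z n \<omega>)) \<in> borel_measurable (completion M)"
    by measurable
  show "AE \<omega> in M. saa_deriv n \<omega> = ((1 / real n) *\<^sub>R (\<Sum>i<n. limit_jacobian (\<lambda>y. G y (\<eta> i \<omega>)) (closest_point S (z n \<omega>))))
      *v B_derivative (closest_point S) (z n \<omega>) (z0 - z n \<omega>)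
      + (z0 - z n \<omega>) - B_derivative (closest_point S) (z n \<omega>) (z0 - z n \<omega>)"
    using sample_C11 AE_space
  proof eventually_elim
    case (elim \<omega>)
    then show ?case
      using z_D[of \<omega> n] unfolding saa_deriv_def normal_map_deriv_def by simp
  qed
qed

lemma borel_measurable_sample[measurable]:
  "(\<lambda>\<omega>. sample n \<omega> x) \<in> borel_measurable M" "sample_J n \<in> borel_measurable M" "sample_c n \<in> borel_measurable M"
  unfolding sample_def sample_J_def[abs_def] sample_c_def[abs_def] by measurable

definition good where
  "good B \<kappa> a n = {\<omega>\<in>space M. sqrt (real n) * norm (sample n \<omega> x0 - mean x0) \<le> B \<and>
     sample_c n \<omega> \<le> \<kappa> \<and> norm (sample_J n \<omega> - mean_J) \<le> a}"

lemma sets_good[measurable]: "good B \<kappa> a n \<in> sets M"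
  unfolding good_def by measurable

text \<open>\<open>B\<close> and \<open>\<kappa>\<close> are fixed before \<open>a\<close>, since
  \<open>a\<close> will be chosen depending on \<open>B\<close>. Their bounds are uniform in
  \<open>n\<close>, while any \<open>a\<close> is admissible for large \<open>n\<close>.\<close>

lemma good_complement:
  assumes "\<delta> > 0"
  obtains B \<kappa> where "B > 0" "\<kappa> > 0"
    "\<And>a. a > 0 \<Longrightarrow> \<forall>\<^sub>F n in sequentially. prob (space M - good B \<kappa> a n) \<le> \<delta>"
proof -
  define v where "v = expectation (\<lambda>\<omega>. (norm (G x0 (\<xi> \<omega>) - mean x0))\<^sup>2)"
  define e where "e = expectation (\<lambda>\<omega>. c (\<xi> \<omega>))"
  have v: "v \<ge> 0" and e: "e \<ge> 0"
    unfolding v_def e_def using c_nonneg by (auto intro!: Bochner_Integration.integral_nonneg)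
  \<comment> \<open>Each of the three bad events gets a third of \<open>\<delta>\<close>; adding
    \<open>1\<close> keeps \<open>B\<close> and \<open>\<kappa>\<close> positive when the moments
    vanish.\<close>
  define B where "B = sqrt (3 * (v + 1) / \<delta>)"
  define \<kappa> where "\<kappa> = 3 * (e + 1) / \<delta>"
  have B: "B > 0" "v / B\<^sup>2 \<le> \<delta> / 3" and \<kappa>: "\<kappa> > 0" "e / \<kappa> \<le> \<delta> / 3"
    using v e \<open>\<delta> > 0\<close> by (auto simp: B_def \<kappa>_def field_simps)
  show thesis
  proof (rule that[OF B(1) \<kappa>(1)])
    fix a :: real assume "a > 0"
    have "\<forall>\<^sub>F n in sequentially. prob {\<omega>\<in>space M. norm (sample_J n \<omega> - mean_J) > a} < \<delta> / 3"
      using sample_J_tail[OF \<open>a > 0\<close>] by (rule order_tendstoD) (use \<open>\<delta> > 0\<close> in simp)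
    then show "\<forall>\<^sub>F n in sequentially. prob (space M - good B \<kappa> a n) \<le> \<delta>"
      using eventually_gt_at_top[of 0]
    proof eventually_elim
      case (elim n)
      let ?A = "{\<omega>\<in>space M. sqrt (real n) * norm (sample n \<omega> x0 - mean x0) > B}"
      let ?B = "{\<omega>\<in>space M. sample_c n \<omega> > \<kappa>}"
      let ?C = "{\<omega>\<in>space M. norm (sample_J n \<omega> - mean_J) > a}"
      have "prob (space M - good B \<kappa> a n) = prob (?A \<union> (?B \<union> ?C))"
        by (rule arg_cong[where f = prob]) (auto simp: good_def)
      also have "\<dots> \<le> prob ?A + (prob ?B + prob ?C)"
        by (intro order_trans[OF measure_subadditive] add_left_mono measure_subadditive) auto
      also have "\<dots> \<le> \<delta> / 3 + (\<delta> / 3 + \<delta> / 3)"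
        using sample_value_tail[OF B(1) elim(2)] sample_c_tail[OF \<kappa>(1), of n] B(2) \<kappa>(2) elim(1)
        unfolding v_def[symmetric] e_def[symmetric] by linarith
      finally show ?case
        by simp
    qed
  qed
qed

lemma error_avoided:
  assumes "B > 0" "\<kappa> > 0" "\<epsilon> > 0"
  obtains a where "a > 0" "AE \<omega> in M. \<forall>\<^sub>F n in sequentially. \<omega> \<in> good B \<kappa> a n \<longrightarrow>
    sqrt (real n) * norm (LK (z n \<omega> - z0) + saa_deriv n \<omega>) \<le> \<epsilon> \<and>
    sqrt (real n) * norm (sample n \<omega> x0 - mean x0 - saa_deriv n \<omega>) \<le> \<epsilon>"
proof -
  obtain r m where r: "r > 0" and m: "m > 0" and
    exist: "\<And>f c \<delta>. \<lbrakk>C11_bound f c D; 0 < \<delta>; \<delta> \<le> r; 0 \<le> c; c * \<delta> \<le> m / 4;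
        norm (limit_jacobian f x0 - L) \<le> m / 4; norm (f x0 + (z0 - x0)) \<le> m * \<delta> / 2\<rbrakk> \<Longrightarrow>
      \<exists>z. norm (z - z0) \<le> \<delta> \<and> closest_point S z \<in> D \<and> normal_map S f z = 0" and
    bound: "\<And>f c \<delta> z. \<lbrakk>C11_bound f c D; 0 < \<delta>; \<delta> \<le> r; 0 \<le> c; c * \<delta> \<le> m / 4;
        norm (limit_jacobian f x0 - L) \<le> m / 4; norm (z - z0) \<le> \<delta>; normal_map S f z = 0\<rbrakk> \<Longrightarrow>
      norm (z - z0) \<le> 2 / m * norm (f x0 + (z0 - x0)) \<and>
      norm (LK (z - z0) + normal_map_deriv S f z (z0 - z))
        \<le> (norm (limit_jacobian f x0 - L) + c * norm (z - z0)) * norm (z - z0) \<and>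
      norm (f x0 + (z0 - x0) - normal_map_deriv S f z (z0 - z))
        \<le> 2 * (norm (limit_jacobian f x0 - L) + c * norm (z - z0)) * norm (z - z0)"
    by (rule perturbation) blast
  obtain r' where r': "r' > 0" "cball z0 r' \<subseteq> Z"
    using Z by (auto simp: mem_interior_cball)
  \<comment> \<open>Small enough for the perturbation estimates, for the ball to stay inside
    \<open>Z\<close>, and for the modulus bound
    \<open>\<kappa> * \<delta> \<le> m / 4\<close>.\<close>
  define \<delta> where "\<delta> = min (min r r') (m / (4 * \<kappa>))"
  have \<delta>: "\<delta> > 0" "\<delta> \<le> r" "\<delta> \<le> r'" "\<kappa> * \<delta> \<le> m / 4"
  proof -
    show "\<delta> > 0" "\<delta> \<le> r" "\<delta> \<le> r'"
      using r r' m assms by (auto simp: \<delta>_def)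
    have "\<kappa> * \<delta> \<le> \<kappa> * (m / (4 * \<kappa>))"
      using assms by (intro mult_left_mono) (auto simp: \<delta>_def)
    then show "\<kappa> * \<delta> \<le> m / 4"
      using assms by simp
  qed
  \<comment> \<open>On the good event the bracket in the error is at most \<open>2 * a\<close> and
    the scaled distance to \<open>z0\<close> at most \<open>2 / m * B\<close>; the total
    \<open>8 * a * B / m\<close> is to be at most \<open>\<epsilon>\<close>.\<close>
  define a where "a = min (m / 4) (\<epsilon> * m / (8 * B))"
  have a: "a > 0" "a \<le> m / 4" "2 * (a + a) * (2 / m * B) \<le> \<epsilon>"
  proof -
    show "a > 0" "a \<le> m / 4"
      using m assms by (auto simp: a_def)
    have "a \<le> \<epsilon> * m / (8 * B)"
      by (simp add: a_def)
    then show "2 * (a + a) * (2 / m * B) \<le> \<epsilon>"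
      using m assms by (simp add: field_simps)
  qed
  have lim: "(\<lambda>n. k / sqrt (real n)) \<longlonglongrightarrow> 0" for k
    using tendsto_mult[OF tendsto_const[of k] lim_inverse_n'[THEN tendsto_real_sqrt]]
    by (simp add: real_sqrt_divide)
  have "\<forall>\<^sub>F n in sequentially. B / sqrt (real n) < m * \<delta> / 2"
    using lim by (rule order_tendstoD) (use m \<delta> in simp)
  moreover have "\<forall>\<^sub>F n in sequentially. (\<kappa> * (2 / m) * B) / sqrt (real n) < a"
    using lim by (rule order_tendstoD) (rule a)
  ultimately have large: "\<forall>\<^sub>F n in sequentially. n > 0 \<and> B / sqrt (real n) < m * \<delta> / 2 \<and> (\<kappa> * (2 / m) * B) / sqrt (real n) < a"
    using eventually_gt_at_top[of 0] by eventually_elim simp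
  show thesis
  proof (rule that[OF a(1)])
    show "AE \<omega> in M. \<forall>\<^sub>F n in sequentially. \<omega> \<in> good B \<kappa> a n \<longrightarrow>
      sqrt (real n) * norm (LK (z n \<omega> - z0) + saa_deriv n \<omega>) \<le> \<epsilon> \<and>
      sqrt (real n) * norm (sample n \<omega> x0 - mean x0 - saa_deriv n \<omega>) \<le> \<epsilon>"
      using sample_C11 z_unique
    proof eventually_elim
      case (elim \<omega>)
      note C11 = elim(1)
      from elim(2) large show ?case
      proof eventually_elim
        case (elim n)
        have n: "n > 0" "sqrt (real n) > 0" and uniq: "{y \<in> Z. closest_point S y \<in> D \<and> normal_map S (f n \<omega>) y = 0} = {z n \<omega>}"
          using elim by auto
        show ?case
        proof
          assume "\<omega> \<in> good B \<kappa> a n"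
          then have B: "sqrt (real n) * norm (sample n \<omega> x0 - mean x0) \<le> B"
            and c: "sample_c n \<omega> \<le> \<kappa>" and A: "norm (sample_J n \<omega> - L) \<le> a"
            by (auto simp: good_def L_eq)
          have fC11: "C11_bound (f n \<omega>) (sample_c n \<omega>) D" and fJ: "limit_jacobian (f n \<omega>) x0 = sample_J n \<omega>"
            and fe: "f n \<omega> x0 + (z0 - x0) = sample n \<omega> x0 - mean x0"
            using C11 by (auto simp: z0_eq)
          define e where "e = norm (sample n \<omega> x0 - mean x0)"
          define h where "h = norm (z n \<omega> - z0)"
          have e: "e \<le> B / sqrt (real n)"
            using B n(2) by (simp add: e_def field_simps)
          have c0: "0 \<le> sample_c n \<omega>"
            unfolding sample_c_def by (intro mult_nonneg_nonneg sum_nonneg c_nonneg) simp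
          have c\<delta>: "sample_c n \<omega> * \<delta> \<le> m / 4"
            using mult_right_mono[OF c less_imp_le[OF \<delta>(1)]] \<delta>(4) by (rule order_trans)
          have A4: "norm (limit_jacobian (f n \<omega>) x0 - L) \<le> m / 4"
            using A a(2) by (simp add: fJ)
          have "norm (f n \<omega> x0 + (z0 - x0)) \<le> m * \<delta> / 2"
            using e elim(2)[THEN conjunct2, THEN conjunct1] unfolding fe e_def by linarith
          from exist[OF fC11 \<delta>(1,2) c0 c\<delta> A4 this] obtain y
            where y: "norm (y - z0) \<le> \<delta>" "closest_point S y \<in> D" "normal_map S (f n \<omega>) y = 0"
            by blast
          have "y \<in> cball z0 r'"
            using y(1) \<delta>(3) by (simp add: dist_norm norm_minus_commute)
          then have "y \<in> {y \<in> Z. closest_point S y \<in> D \<and> normal_map S (f n \<omega>) y = 0}"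
            using y r'(2) by blast
          \<comment> \<open>The zero supplied by Brouwer lies in \<open>Z\<close>, so uniqueness
            identifies it with \<open>z n \<omega>\<close>, which is thereby within
            \<open>\<delta>\<close> of \<open>z0\<close>.\<close>
          then have yz: "y = z n \<omega>"
            using uniq by simp
          note b = bound[OF fC11 \<delta>(1,2) c0 c\<delta> A4 y(1,3), unfolded yz fe fJ saa_deriv_def[symmetric],
              folded e_def h_def]
          have h: "h \<le> 2 / m * e" "h \<ge> 0"
            using b by (auto simp: h_def)
          have "2 / m * e \<le> 2 / m * (B / sqrt (real n))"
            using e m by (intro mult_left_mono) auto
          with h(1) have h': "h \<le> 2 / m * B / sqrt (real n)"
            by simp
          have "sample_c n \<omega> * h \<le> \<kappa> * (2 / m * B / sqrt (real n))"
            using c h' h(2) assms by (intro mult_mono) auto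
          also have "\<dots> < a"
            using elim(2) by (simp add: mult.assoc)
          finally have ch: "norm (sample_J n \<omega> - L) + sample_c n \<omega> * h \<le> a + a"
            using A by linarith
          have sh: "sqrt (real n) * h \<le> 2 / m * B"
            using mult_left_mono[OF h', of "sqrt (real n)"] n by simp
          have "sqrt (real n) * (2 * (norm (sample_J n \<omega> - L) + sample_c n \<omega> * h) * h)
            = 2 * (norm (sample_J n \<omega> - L) + sample_c n \<omega> * h) * (sqrt (real n) * h)"
            by simp
          also have "\<dots> \<le> 2 * (a + a) * (2 / m * B)"
            by (rule mult_mono[OF mult_left_mono[OF ch] sh]) (use h(2) a(1) in auto)
          also have "\<dots> \<le> \<epsilon>"
            by (rule a)
          finally have *: "sqrt (real n) * (2 * (norm (sample_J n \<omega> - L) + sample_c n \<omega> * h) * h) \<le> \<epsilon>" .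
          have "norm (LK (z n \<omega> - z0) + saa_deriv n \<omega>) \<le> 2 * (norm (sample_J n \<omega> - L) + sample_c n \<omega> * h) * h"
          proof -
            have "0 \<le> (norm (sample_J n \<omega> - L) + sample_c n \<omega> * h) * h"
              using h(2) c0 by simp
            then show ?thesis
              using b by linarith
          qed
          moreover have "norm (sample n \<omega> x0 - mean x0 - saa_deriv n \<omega>) \<le> 2 * (norm (sample_J n \<omega> - L) + sample_c n \<omega> * h) * h"
            using b by blast
          ultimately show "sqrt (real n) * norm (LK (z n \<omega> - z0) + saa_deriv n \<omega>) \<le> \<epsilon> \<and>
              sqrt (real n) * norm (sample n \<omega> x0 - mean x0 - saa_deriv n \<omega>) \<le> \<epsilon>"
            using * n(2) by (meson mult_left_mono order_trans less_imp_le)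
        qed
      qed
    qed
  qed
qed

text \<open>The disjunction lets one argument serve both the linearization error of the first claim
  and the comparison with the sampling error behind the second.\<close>

lemma error_tendsto:
  assumes [measurable]: "\<And>n. T n \<in> borel_measurable (completion M)"
    and T: "\<And>n \<omega>. T n \<omega> = LK (z n \<omega> - z0) + saa_deriv n \<omega> \<or> T n \<omega> = sample n \<omega> x0 - mean x0 - saa_deriv n \<omega>"
    and "\<epsilon> > 0"
  shows "(\<lambda>n. measure (completion M) {\<omega>\<in>space M. sqrt (real n) * norm (T n \<omega>) > \<epsilon>}) \<longlonglongrightarrow> 0"
proof -
  interpret M': prob_space "completion M"
    by (rule prob_space_completion)
  have "(\<lambda>n. measure (completion M) {\<omega>\<in>space (completion M). sqrt (real n) * norm (T n \<omega>) > \<epsilon>}) \<longlonglongrightarrow> 0"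
  proof (rule M'.prob_tendsto_0I)
    fix \<delta> :: real assume "\<delta> > 0"
    obtain B \<kappa> where B: "B > 0" "\<kappa> > 0"
      "\<And>a. a > 0 \<Longrightarrow> \<forall>\<^sub>F n in sequentially. prob (space M - good B \<kappa> a n) \<le> \<delta>"
      using good_complement[OF \<open>\<delta> > 0\<close>] by blast
    obtain a where a: "a > 0" "AE \<omega> in M. \<forall>\<^sub>F n in sequentially. \<omega> \<in> good B \<kappa> a n \<longrightarrow>
      sqrt (real n) * norm (LK (z n \<omega> - z0) + saa_deriv n \<omega>) \<le> \<epsilon> \<and>
      sqrt (real n) * norm (sample n \<omega> x0 - mean x0 - saa_deriv n \<omega>) \<le> \<epsilon>"
      using error_avoided[OF B(1,2) \<open>\<epsilon> > 0\<close>] by blast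
    have "AE \<omega> in completion M. \<forall>\<^sub>F n in sequentially. \<omega> \<in> good B \<kappa> a n \<longrightarrow>
      \<omega> \<notin> {\<omega>\<in>space (completion M). sqrt (real n) * norm (T n \<omega>) > \<epsilon>}"
      using AE_completion[OF a(2)]
    proof eventually_elim
      case (elim \<omega>)
      then show ?case
      proof eventually_elim
        case (elim n)
        then show ?case
          using T[of n \<omega>] by auto
      qed
    qed
    moreover have "\<forall>\<^sub>F n in sequentially. measure (completion M) (space (completion M) - good B \<kappa> a n) \<le> \<delta>"
      using B(3)[OF a(1)] by simp
    ultimately show "\<exists>A. (\<forall>n. A n \<in> sets (completion M)) \<and>
      (AE \<omega> in completion M. \<forall>\<^sub>F n in sequentially. \<omega> \<in> A n \<longrightarrow>
        \<omega> \<notin> {\<omega>\<in>space (completion M). sqrt (real n) * norm (T n \<omega>) > \<epsilon>}) \<and>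
      (\<forall>\<^sub>F n in sequentially. measure (completion M) (space (completion M) - A n) \<le> \<delta>)"
      by (intro exI[of _ "good B \<kappa> a"]) auto
  qed measurable
  then show ?thesis
    by simp
qed

lemma borel_measurable_LK_z[measurable]: "(\<lambda>\<omega>. LK (z n \<omega> - z0)) \<in> borel_measurable (completion M)"
proof -
  have "LK \<in> borel_measurable borel"
    by (rule borel_measurable_continuous_onI[OF continuous_on_LK])
  then show ?thesis
    by (rule measurable_compose[rotated]) measurable
qed

lemma linearization_error:
  assumes "\<epsilon> > 0"
  shows "(\<lambda>n. measure (completion M) {\<omega>\<in>space M.
    sqrt (real n) * norm (LK (z n \<omega> - z0) + saa_deriv n \<omega>) > \<epsilon>}) \<longlonglongrightarrow> 0"
  by (rule error_tendsto) (use assms in auto)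

text \<open>Up to an error vanishing in probability the variable is minus the scaled sampling error
  at \<open>x0\<close>, whose projections obey the central limit theorem.\<close>

lemma deriv_conv_in_distribution:
  assumes N: "prob_space N" and Y: "normal_vector N Y0 0 \<Sigma>"
    and \<Sigma>: "\<And>t. t \<bullet> (\<Sigma> *v t) = expectation (\<lambda>\<omega>. (t \<bullet> (G x0 (\<xi> \<omega>) - mean x0))\<^sup>2)"
  shows "conv_in_distribution (completion M) (\<lambda>n \<omega>. - (sqrt (real n) *\<^sub>R saa_deriv n \<omega>)) N Y0"
proof (rule conv_in_distribution_cosI[OF prob_space_completion N])
  interpret M': prob_space "completion M"
    by (rule prob_space_completion)
  define e where "e n \<omega> = sqrt (real n) *\<^sub>R (sample n \<omega> x0 - mean x0)" for n \<omega>
  have [measurable]: "e n \<in> borel_measurable M" for n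
    unfolding e_def by measurable
  then have e'[measurable]: "e n \<in> borel_measurable (completion M)" for n
    by (rule measurable_completion)
  have [measurable]: "(\<lambda>\<omega>. sample n \<omega> x0) \<in> borel_measurable (completion M)" for n
    by (rule measurable_completion) measurable
  show X[measurable]: "(\<lambda>\<omega>. - (sqrt (real n) *\<^sub>R saa_deriv n \<omega>)) \<in> borel_measurable (completion M)" for n
    by measurable
  show Y0[measurable]: "Y0 \<in> borel_measurable N"
    using Y by (simp add: normal_vector_def)
  have diff: "norm (- (sqrt (real n) *\<^sub>R saa_deriv n \<omega>) - - e n \<omega>)
      = sqrt (real n) * norm (sample n \<omega> x0 - mean x0 - saa_deriv n \<omega>)" for n \<omega>
  proof -
    have "- (sqrt (real n) *\<^sub>R saa_deriv n \<omega>) - - e n \<omega> = sqrt (real n) *\<^sub>R (sample n \<omega> x0 - mean x0 - saa_deriv n \<omega>)"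
      by (simp add: e_def scaleR_diff_right)
    then show ?thesis
      by simp
  qed
  have err: "(\<lambda>n. measure (completion M) {\<omega>\<in>space M.
      norm (- (sqrt (real n) *\<^sub>R saa_deriv n \<omega>) - - e n \<omega>) > \<epsilon>}) \<longlonglongrightarrow> 0" if "\<epsilon> > 0" for \<epsilon>
    unfolding diff by (rule error_tendsto) (use that in auto)
  show "(\<lambda>n. M'.expectation (\<lambda>\<omega>. cos (t \<bullet> (- (sqrt (real n) *\<^sub>R saa_deriv n \<omega>)) + d)))
    \<longlonglongrightarrow> (\<integral>\<omega>. cos (t \<bullet> Y0 \<omega> + d) \<partial>N)" for t d
  proof (rule M'.cos_expectation_diff_tendsto[where Y = "\<lambda>n \<omega>. - e n \<omega>"])
    \<comment> \<open>The sign is moved to \<open>t\<close>; the covariance form is even, so the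
      limit law is unaffected.\<close>
    have "(- t) \<bullet> (\<Sigma> *v (- t)) = t \<bullet> (\<Sigma> *v t)"
      by (simp add: bounded_bilinear.minus_right[OF bounded_bilinear_matrix_vector_mult])
    then have "(\<integral>u. cos (u + d) \<partial>normal_law 0 (expectation (\<lambda>\<omega>. ((- t) \<bullet> (G x0 (\<xi> \<omega>) - mean x0))\<^sup>2)))
        = (\<integral>u. cos (u + d) \<partial>distr N borel (\<lambda>\<omega>. t \<bullet> Y0 \<omega>))"
      using Y \<Sigma>[of "- t"] by (simp add: normal_vector_def)
    also have "\<dots> = (\<integral>\<omega>. cos (t \<bullet> Y0 \<omega> + d) \<partial>N)"
      by (rule integral_distr) measurable
    finally have lim: "(\<integral>u. cos (u + d) \<partial>normal_law 0 (expectation (\<lambda>\<omega>. ((- t) \<bullet> (G x0 (\<xi> \<omega>) - mean x0))\<^sup>2)))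
        = (\<integral>\<omega>. cos (t \<bullet> Y0 \<omega> + d) \<partial>N)" .
    have "M'.expectation (\<lambda>\<omega>. cos (t \<bullet> (- e n \<omega>) + d)) = expectation (\<lambda>\<omega>. cos ((- t) \<bullet> e n \<omega> + d))" for n
      by (subst integral_completion) auto
    then show "(\<lambda>n. M'.expectation (\<lambda>\<omega>. cos (t \<bullet> (- e n \<omega>) + d))) \<longlonglongrightarrow> (\<integral>\<omega>. cos (t \<bullet> Y0 \<omega> + d) \<partial>N)"
      using sample_CLT[of "- t" d] unfolding lim e_def by simp
  qed (use err in auto)
  fix \<delta> :: real assume "\<delta> > 0"
  define v where "v = expectation (\<lambda>\<omega>. (norm (G x0 (\<xi> \<omega>) - mean x0))\<^sup>2)"
  have v: "v \<ge> 0"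
    unfolding v_def by (rule Bochner_Integration.integral_nonneg) simp
  \<comment> \<open>Tightness: the threshold \<open>B + 1\<close> allows \<open>B\<close> for the
    sampling error and \<open>1\<close> for the vanishing error, each exceeded with probability at
    most \<open>\<delta> / 2\<close>.\<close>
  define B where "B = sqrt (2 * (v + 1) / \<delta>)"
  have B: "B > 0" "v / B\<^sup>2 \<le> \<delta> / 2"
    using v \<open>\<delta> > 0\<close> by (auto simp: B_def field_simps)
  have "\<forall>\<^sub>F n in sequentially. measure (completion M) {\<omega>\<in>space M.
      norm (- (sqrt (real n) *\<^sub>R saa_deriv n \<omega>) - - e n \<omega>) > 1} < \<delta> / 2"
    using err[OF zero_less_one] by (rule order_tendstoD) (use \<open>\<delta> > 0\<close> in simp)
  then have "\<forall>\<^sub>F n in sequentially. measure (completion M) {\<omega>\<in>space (completion M).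
      norm (- (sqrt (real n) *\<^sub>R saa_deriv n \<omega>)) > B + 1} \<le> \<delta>"
    using eventually_gt_at_top[of 0]
  proof eventually_elim
    case (elim n)
    let ?A = "{\<omega>\<in>space M. norm (- (sqrt (real n) *\<^sub>R saa_deriv n \<omega>) - - e n \<omega>) > 1}"
    let ?B = "{\<omega>\<in>space M. norm (e n \<omega>) > B}"
    have sets: "?A \<in> sets (completion M)" "?B \<in> sets M"
    proof -
      have "{\<omega>\<in>space (completion M). norm (- (sqrt (real n) *\<^sub>R saa_deriv n \<omega>) - - e n \<omega>) > 1} \<in> sets (completion M)"
        by measurable
      then show "?A \<in> sets (completion M)" by simp
    qed measurable
    have "{\<omega>\<in>space (completion M). norm (- (sqrt (real n) *\<^sub>R saa_deriv n \<omega>)) > B + 1} \<subseteq> ?A \<union> ?B"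
    proof (rule subsetI, rule ccontr)
      fix \<omega> assume "\<omega> \<in> {\<omega>\<in>space (completion M). norm (- (sqrt (real n) *\<^sub>R saa_deriv n \<omega>)) > B + 1}" "\<omega> \<notin> ?A \<union> ?B"
      then show False
        using norm_triangle_ineq[of "- (sqrt (real n) *\<^sub>R saa_deriv n \<omega>) - - e n \<omega>" "- e n \<omega>"] by auto
    qed
    then have "measure (completion M) {\<omega>\<in>space (completion M). norm (- (sqrt (real n) *\<^sub>R saa_deriv n \<omega>)) > B + 1}
        \<le> measure (completion M) (?A \<union> ?B)"
      by (rule M'.finite_measure_mono) (intro sets.Un sets(1) sets_completionI_sets sets(2))
    also have "\<dots> \<le> measure (completion M) ?A + measure (completion M) ?B"
      by (intro measure_subadditive sets(1) sets_completionI_sets sets(2))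
        (simp_all only: infinity_ennreal_def M'.emeasure_finite not_False_eq_True)
    also have "measure (completion M) ?B \<le> v / B\<^sup>2"
      using sample_value_tail[OF B(1) elim(2)] sets(2) by (simp add: e_def v_def)
    finally show ?case
      using elim(1) B(2) by linarith
  qed
  then show "\<exists>R. \<forall>\<^sub>F n in sequentially. measure (completion M) {\<omega>\<in>space (completion M).
      norm (- (sqrt (real n) *\<^sub>R saa_deriv n \<omega>)) > R} \<le> \<delta>"
    by blast
qed

end

section \<open>Passing from \<open>F\<close> to its Borel extension\<close>

lemma jacobian_cong_open:
  assumes "open D" "x \<in> D" "\<And>y. y \<in> D \<Longrightarrow> f y = g y"
  shows "jacobian f (at x) = jacobian g (at x)"
proof -
  have "(f has_derivative A) (at x) \<longleftrightarrow> (g has_derivative A) (at x)" for A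
    using has_derivative_transform_within_open[OF _ assms(1,2)] assms(3) by metis
  then show ?thesis
    by (simp add: jacobian_def frechet_derivative_def)
qed

lemma C1_on_cong:
  assumes "open D" "\<And>x. x \<in> D \<Longrightarrow> f x = g x"
  shows "C1_on f D \<longleftrightarrow> C1_on g D"
proof -
  have "f differentiable (at x) \<longleftrightarrow> g differentiable (at x)" if "x \<in> D" for x
    using has_derivative_transform_within_open[OF _ assms(1) that] assms(2)
    unfolding differentiable_def by metis
  moreover have "jacobian f (at x) = jacobian g (at x)" if "x \<in> D" for x
    by (rule jacobian_cong_open[OF assms(1) that assms(2)])
  ultimately show ?thesis
    by (simp add: C1_on_def cong: continuous_on_cong)
qed

theorem theorem3p3:
  fixes M :: "'w measure"
    and N :: "'v measure"
    and \<xi> :: "'w \<Rightarrow> real^'d"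
    and \<xi>s :: "nat \<Rightarrow> 'w \<Rightarrow> real^'d"
    and \<Xi> :: "(real^'d) set"
    and D S X0 Z :: "(real^'q) set"
    and F :: "real^'q \<Rightarrow> real^'d \<Rightarrow> real^'q"
    and C :: "'w \<Rightarrow> real"
    and x0 z0 :: "real^'q"
    and L :: "real^'q^'q"
    and K :: "(real^'q) set"
    and f0 L\<^sub>K :: "real^'q \<Rightarrow> real^'q"
    and f :: "nat \<Rightarrow> 'w \<Rightarrow> real^'q \<Rightarrow> real^'q"
    and z :: "nat \<Rightarrow> 'w \<Rightarrow> real^'q"
    and \<Sigma>0 :: "real^'q^'q"
    and Y0 :: "'v \<Rightarrow> real^'q"
  defines "f0 \<equiv> mean_map M F \<xi>"
    and "f \<equiv> saa_map F \<xi>s"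
    and "z0 \<equiv> x0 - f0 x0"
    and "L \<equiv> jacobian f0 (at x0)"
    and "K \<equiv> tangent_cone S x0 \<inter> {v. (z0 - x0) \<bullet> v = 0}"
    and "L\<^sub>K \<equiv> (\<lambda>h. L *v closest_point K h + h - closest_point K h)"
    and "\<Sigma>0 \<equiv> covariance_matrix (completion M) (\<lambda>\<omega>. F x0 (\<xi> \<omega>))"
  \<comment> \<open>setting\<close>
  assumes "prob_space M"
    and "\<xi> \<in> borel_measurable M" and "closed \<Xi>" and "AE \<omega> in M. \<xi> \<omega> \<in> \<Xi>"
    and "open D"
    and "(\<lambda>(x, s). F x s) \<in> borel_measurable (restrict_space borel (D \<times> \<Xi>))"
    and "\<And>x. x \<in> D \<Longrightarrow> integrable (completion M) (\<lambda>\<omega>. F x (\<xi> \<omega>))"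
    and "polyhedron S"
    and "prob_space.indep_vars M (\<lambda>_. borel) \<xi>s {1..}"
    and "\<And>i. i \<ge> 1 \<Longrightarrow> distr M borel (\<xi>s i) = distr M borel \<xi>"
  \<comment> \<open>(a)\<close>
    and "\<And>x. x \<in> D \<Longrightarrow> integrable (completion M) (\<lambda>\<omega>. (norm (F x (\<xi> \<omega>)))\<^sup>2)"
  \<comment> \<open>(b)\<close>
    and "AE \<omega> in M. C1_on (\<lambda>x. F x (\<xi> \<omega>)) D"
    and "\<And>x. x \<in> D \<Longrightarrow>
           integrable (completion M) (\<lambda>\<omega>. (norm (jacobian (\<lambda>y. F y (\<xi> \<omega>)) (at x)))\<^sup>2)"
  \<comment> \<open>(c)\<close>
    and "C \<in> borel_measurable M" and "integrable M (\<lambda>\<omega>. (C \<omega>)\<^sup>2)"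
    and "AE \<omega> in M. \<forall>x\<in>D. \<forall>x'\<in>D.
           norm (F x (\<xi> \<omega>) - F x' (\<xi> \<omega>))
             + norm (jacobian (\<lambda>y. F y (\<xi> \<omega>)) (at x) - jacobian (\<lambda>y. F y (\<xi> \<omega>)) (at x'))
           \<le> C \<omega> * norm (x - x')"
  \<comment> \<open>the solution of the true problem\<close>
    and "x0 \<in> S \<inter> D" and "solves_inclusion S f0 x0"
    and "\<exists>g. homeomorphism UNIV UNIV L\<^sub>K g"
  \<comment> \<open>the neighbourhoods and the solutions of the sample average problems\<close>
    and "X0 \<subseteq> D" and "x0 \<in> interior X0" and "z0 \<in> interior Z"
    and "\<And>n. z n \<in> borel_measurable (completion M)"
    and "\<And>n \<omega>. \<omega> \<in> space M \<Longrightarrow> closest_point S (z n \<omega>) \<in> D"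
    and "AE \<omega> in M. \<exists>N\<^sub>\<omega>. \<forall>n\<ge>N\<^sub>\<omega>.
           {y \<in> Z. closest_point S y \<in> D \<and> normal_map S (f n \<omega>) y = 0} = {z n \<omega>} \<and>
           {x \<in> X0. solves_inclusion S (f n \<omega>) x} = {closest_point S (z n \<omega>)}"
  \<comment> \<open>the limit distribution\<close>
    and "prob_space N" and "normal_vector N Y0 0 \<Sigma>0"
  shows "(\<forall>\<epsilon>>0. (\<lambda>n. measure (completion M) {\<omega> \<in> space M.
            sqrt (real n) * norm (normal_map_deriv S f0 z0 (z n \<omega> - z0)
                                  + normal_map_deriv S (f n \<omega>) (z n \<omega>) (z0 - z n \<omega>)) > \<epsilon>})
          \<longlonglongrightarrow> 0) \<and>
    conv_in_distribution (completion M)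
      (\<lambda>n \<omega>. - (sqrt (real n) *\<^sub>R normal_map_deriv S (f n \<omega>) (z n \<omega>) (z0 - z n \<omega>))) N Y0"
proof -
  interpret prob_space M by fact
  have \<xi>[measurable]: "\<xi> \<in> borel_measurable M"
    by fact
  have x0: "x0 \<in> S" "x0 \<in> D"
    using assms(24) by auto
  define \<eta> where "\<eta> i = \<xi>s (Suc i)" for i
  \<comment> \<open>\<open>F\<close> is measurable only on the product of \<open>D\<close> and
    \<open>\<Xi>\<close>; extension by zero is Borel everywhere and, for \<open>s\<close> in
    \<open>\<Xi>\<close>, agrees with \<open>F\<close> on the open set \<open>D\<close>, hence has
    the same derivatives there.\<close>
  define G where "G x s = indicator (D \<times> \<Xi>) (x, s) *\<^sub>R F x s" for x s
  have G_eq: "G x s = F x s" if "x \<in> D" "s \<in> \<Xi>" for x s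
    using that by (simp add: G_def)
  have "D \<times> \<Xi> \<in> sets (borel \<Otimes>\<^sub>M borel)"
    using assms(10,12) by (intro pair_measureI) auto
  then have "D \<times> \<Xi> \<in> sets borel"
    unfolding borel_prod .
  then have G: "(\<lambda>(x, s). G x s) \<in> borel_measurable borel"
    using assms(13) by (subst (asm) borel_measurable_restrict_space_iff) (auto simp: G_def case_prod_beta')
  have \<eta>_distr: "distr M borel (\<eta> i) = distr M borel \<xi>" for i
    using assms(17)[of "Suc i"] by (simp add: \<eta>_def)
  have \<eta>_indep: "indep_vars (\<lambda>_. borel) \<eta> UNIV"
    unfolding \<eta>_def by (rule indep_vars_Suc) fact
  then have \<eta>[measurable]: "\<eta> i \<in> borel_measurable M" for i
    by (auto simp: indep_vars_def2)
  have \<Xi>[measurable]: "\<Xi> \<in> sets borel"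
    using assms(10) by simp
  \<comment> \<open>Membership in a closed set is a Borel property of the value, so the common law
    suffices here.\<close>
  have \<eta>_\<Xi>: "AE \<omega> in M. \<forall>i. \<eta> i \<omega> \<in> \<Xi>"
    unfolding AE_all_countable
  proof
    fix i
    have "AE s in distr M borel \<xi>. s \<in> \<Xi>"
      using assms(11) by (subst AE_distr_iff) auto
    then show "AE \<omega> in M. \<eta> i \<omega> \<in> \<Xi>"
      unfolding \<eta>_distr[of i, symmetric] by (subst (asm) AE_distr_iff) auto
  qed
  have C1: "AE \<omega> in M. C1_on (\<lambda>x. G x (\<xi> \<omega>)) D"
    using assms(11,19)
  proof eventually_elim
    case (elim \<omega>)
    then show ?case
      using C1_on_cong[OF assms(12), of "\<lambda>x. G x (\<xi> \<omega>)" "\<lambda>x. F x (\<xi> \<omega>)"] G_eq by simp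
  qed
  have jac: "AE \<omega> in M. \<forall>x\<in>D. jacobian (\<lambda>y. G y (\<xi> \<omega>)) (at x) = jacobian (\<lambda>y. F y (\<xi> \<omega>)) (at x)"
    using assms(11) by eventually_elim (intro ballI jacobian_cong_open[OF assms(12)] G_eq)
  have lip: "AE \<omega> in M. \<forall>x\<in>D. \<forall>x'\<in>D. norm (jacobian (\<lambda>y. G y (\<xi> \<omega>)) (at x)
      - jacobian (\<lambda>y. G y (\<xi> \<omega>)) (at x')) \<le> C \<omega> * norm (x - x')"
    using jac assms(23)
  proof eventually_elim
    case (elim \<omega>)
    show ?case
    proof (intro ballI)
      fix x x' assume "x \<in> D" "x' \<in> D"
      moreover have "b \<le> e" if "a + b \<le> e" "0 \<le> a" for a b e :: real
        using that by linarith
      ultimately show "norm (jacobian (\<lambda>y. G y (\<xi> \<omega>)) (at x)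
          - jacobian (\<lambda>y. G y (\<xi> \<omega>)) (at x')) \<le> C \<omega> * norm (x - x')"
        using elim by (metis norm_ge_zero)
    qed
  qed
  obtain c where c[measurable]: "c \<in> borel_measurable borel" and c_nonneg: "\<And>s. 0 \<le> c s"
    and c_le: "AE \<omega> in M. c (\<xi> \<omega>) \<le> 2 * max 0 (C \<omega>)"
    and c_C11: "\<forall>\<eta>. \<eta> \<in> borel_measurable M \<longrightarrow> distr M borel \<eta> = distr M borel \<xi> \<longrightarrow>
      (AE \<omega> in M. C11_bound (\<lambda>x. G x (\<eta> \<omega>)) (c (\<eta> \<omega>)) D)"
    by (rule C11_majorant[OF assms(8) \<xi> assms(12) G C1 lip]) blast
  have C11: "AE \<omega> in M. C11_bound (\<lambda>x. G x (\<xi> \<omega>)) (c (\<xi> \<omega>)) D"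
    using c_C11 by simp
  have GF: "AE \<omega> in completion M. G x (\<xi> \<omega>) = F x (\<xi> \<omega>)" if "x \<in> D" for x
    using AE_completion[OF assms(11)] by eventually_elim (rule G_eq[OF that])
  have G_x[measurable]: "(\<lambda>\<omega>. G x (\<xi> \<omega>)) \<in> borel_measurable M" for x
    using measurable_compose[of "\<lambda>\<omega>. (x, \<xi> \<omega>)" M borel "\<lambda>(x, s). G x s" borel] G by simp
  have F_x: "(\<lambda>\<omega>. F x (\<xi> \<omega>)) \<in> borel_measurable (completion M)" if "x \<in> D" for x
    using assms(14)[OF that] by simp
  interpret saa M \<xi> \<eta> G c D x0
  proof
    show "AE \<omega> in M. \<forall>i. C11_bound (\<lambda>x. G x (\<eta> i \<omega>)) (c (\<eta> i \<omega>)) D"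
      unfolding AE_all_countable using c_C11 \<eta> \<eta>_distr by blast
    have "integrable M C"
      by (rule square_integrable_imp_integrable) fact+
    then have "integrable M (\<lambda>\<omega>. 2 * max 0 (C \<omega>))"
      by simp
    then show "integrable M (\<lambda>\<omega>. c (\<xi> \<omega>))"
      by (rule Bochner_Integration.integrable_bound)
        (use c_le c_nonneg in \<open>auto elim!: eventually_mono\<close>)
    show "integrable M (\<lambda>\<omega>. G x (\<xi> \<omega>))" if "x \<in> D" for x
    proof -
      have "integrable (completion M) (\<lambda>\<omega>. G x (\<xi> \<omega>))"
        by (rule integrable_cong_AE_imp[OF assms(14)[OF that]])
          (use GF[OF that] in \<open>auto intro: measurable_completion elim!: eventually_mono\<close>)
      then show ?thesis
        by (subst (asm) integrable_completion) auto
    qed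
    have "integrable (completion M) (\<lambda>\<omega>. (norm (G x0 (\<xi> \<omega>)))\<^sup>2)"
      by (rule integrable_cong_AE_imp[OF assms(18)[OF x0(2)]])
        (use GF[OF x0(2)] in \<open>auto intro!: measurable_completion elim!: eventually_mono\<close>)
    then show "integrable M (\<lambda>\<omega>. (norm (G x0 (\<xi> \<omega>)))\<^sup>2)"
      by (subst (asm) integrable_completion) auto
    have [measurable]: "(\<lambda>\<omega>. limit_jacobian (\<lambda>x. G x (\<xi> \<omega>)) x0) \<in> borel_measurable M"
      by (rule borel_measurable_limit_jacobian[OF G]) auto
    have "AE \<omega> in M. (norm (jacobian (\<lambda>y. F y (\<xi> \<omega>)) (at x0)))\<^sup>2 = (norm (limit_jacobian (\<lambda>x. G x (\<xi> \<omega>)) x0))\<^sup>2"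
      using jac C11
    proof eventually_elim
      case (elim \<omega>)
      then show ?case
        using C11_bound_jacobian[OF elim(2) assms(12) x0(2)] x0(2) by simp
    qed
    then have "integrable (completion M) (\<lambda>\<omega>. (norm (limit_jacobian (\<lambda>x. G x (\<xi> \<omega>)) x0))\<^sup>2)"
      by (intro integrable_cong_AE_imp[OF assms(20)[OF x0(2)]] AE_completion measurable_completion) auto
    then show "integrable M (\<lambda>\<omega>. (norm (limit_jacobian (\<lambda>x. G x (\<xi> \<omega>)) x0))\<^sup>2)"
      by (subst (asm) integrable_completion) auto
  qed (use \<xi> \<eta>_indep \<eta>_distr assms(12) x0(2) G c c_nonneg C11 in auto)
  have mean_f0: "mean x = f0 x" if "x \<in> D" for x
  proof -
    have "f0 x = (\<integral>\<omega>. G x (\<xi> \<omega>) \<partial>completion M)"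
      unfolding f0_def mean_map_def using GF[OF that] F_x[OF that]
      by (intro integral_cong_AE) (auto intro: measurable_completion elim!: eventually_mono)
    then show ?thesis
      by (simp add: integral_completion mean_def)
  qed
  have jac_f0: "jacobian f0 (at x0) = mean_J"
    using jacobian_cong_open[OF assms(12) x0(2), of mean f0] mean_f0 jacobian_mean by simp
  \<comment> \<open>The inclusion says that \<open>- f0 x0\<close>, which is \<open>z0 - x0\<close>,
    is normal to \<open>S\<close> at \<open>x0\<close>: exactly the variational inequality of the
    projection.

    @DONE_PLACEHOLDER\<close>
  have z0_x0: "closest_point S z0 = x0"
  proof (rule closest_point_eqI)
    obtain v where v: "v \<in> normal_cone S x0" "0 = f0 x0 + v"
      using assms(25) by (auto simp: solves_inclusion_def)
    then have "z0 - x0 = v"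
      using minus_unique[OF v(2)[symmetric]] by (simp add: z0_def)
    then show "(z0 - x0) \<bullet> (s - x0) \<le> 0" if "s \<in> S" for s
      using v(1) that by (simp add: normal_cone_def)
  qed (use x0(1) polyhedron_imp_convex polyhedron_imp_closed assms(15) in auto)
  interpret A: saa_normal_map M \<xi> \<eta> G c D x0 S z0 L f Z z
  proof
    show "\<exists>g. homeomorphism UNIV UNIV (\<lambda>h. L *v closest_point (critical_cone S x0 (z0 - x0)) h + h
        - closest_point (critical_cone S x0 (z0 - x0)) h) g"
      using assms(26) by (simp add: L\<^sub>K_def K_def critical_cone_def)
    show "z0 = x0 - mean x0"
      using mean_f0[OF x0(2)] by (simp add: z0_def)
    show "L = mean_J"
      unfolding L_def by (rule jac_f0)
    show "AE \<omega> in M. \<forall>n. \<forall>x\<in>D. f n \<omega> x = sample n \<omega> x"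
      using \<eta>_\<Xi>
    proof eventually_elim
      case (elim \<omega>)
      have "(\<Sum>i=1..n. F x (\<xi>s i \<omega>)) = (\<Sum>i<n. G x (\<eta> i \<omega>))" if "x \<in> D" for n x
        using G_eq[OF that] elim by (simp add: sum.atLeast1_atMost_eq \<eta>_def)
      then show ?case
        by (simp add: f_def saa_map_def sample_def)
    qed
    show "AE \<omega> in M. \<forall>\<^sub>F n in sequentially.
        {y \<in> Z. closest_point S y \<in> D \<and> normal_map S (f n \<omega>) y = 0} = {z n \<omega>}"
      using assms(32) by eventually_elim (auto simp: eventually_sequentially)
  qed (use assms(12,15,29,30,31) x0 z0_x0 in auto)
  have LK: "normal_map_deriv S f0 z0 h = A.LK h" for h
    by (rule A.normal_map_deriv_eq_LK) (simp add: L_def)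
  have "t \<bullet> (\<Sigma>0 *v t) = expectation (\<lambda>\<omega>. (t \<bullet> (G x0 (\<xi> \<omega>) - mean x0))\<^sup>2)" for t
  proof -
    interpret M': prob_space "completion M"
      by (rule prob_space_completion)
    have "t \<bullet> (\<Sigma>0 *v t) = M'.expectation (\<lambda>\<omega>. (t \<bullet> (F x0 (\<xi> \<omega>) - mean x0))\<^sup>2)"
      unfolding \<Sigma>0_def mean_f0[OF x0(2)] f0_def mean_map_def
      by (rule M'.covariance_matrix_quadratic) (use F_x x0(2) assms(14,18) in auto)
    also have "\<dots> = M'.expectation (\<lambda>\<omega>. (t \<bullet> (G x0 (\<xi> \<omega>) - mean x0))\<^sup>2)"
      using GF[OF x0(2)] F_x[OF x0(2)] measurable_completion[OF G_x[of x0]]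
      by (intro integral_cong_AE) (auto elim!: eventually_mono)
    finally show ?thesis
      by (simp add: integral_completion)
  qed
  then show ?thesis
    using A.linearization_error A.deriv_conv_in_distribution[OF assms(33,34)]
    by (simp add: LK A.saa_deriv_def)
qed

end
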